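(* Let $\mathfrak g$ be a finite-dimensional Lie algebra over $\mathbb K=\mathbb R$ or $\mathbb C$ and let $g$ be a metric on $\mathfrak g$ (not necessarily ad-invariant). Then there is a semisimple derivation $N\in\mathfrak{co}(\mathfrak g,g)\cap\mathrm{Der}(\mathfrak g)$ such that $$\mathrm{tr}(N\psi)=\mathrm{tr}(\psi)\quad\text{for every }\psi\in\mathfrak{co}(\mathfrak g,g)\cap\mathrm{Der}(\mathfrak g).$$ This derivation is unique up to automorphisms preserving the conformal class of the metric (i.e. any two such $N$ are conjugate by an element of $\mathrm{CO}(\mathfrak g,g)\cap\mathrm{Aut}(\mathfrak g)$), and its eigenvalues are rational numbers.
   Context: A metric on $\mathfrak g$ is a nondegenerate symmetric $\mathbb K$-bilinear form. $\mathrm{CO}(\mathfrak g,g)$ is the group of invertible linear maps $f\colon\mathfrak g\to\mathfrak g$ for which there is a constant $l\in\mathbb K$ with $g(fX,fY)=l\,g(X,Y)$ for all $X,Y$. Its Lie algebra is $\mathfrak{co}(\mathfrak g,g)=\{f\in\mathfrak{gl}(\mathfrak g): \exists\, l\in\mathbb K,\ g(fX,Y)+g(X,fY)=l\,g(X,Y)\ \forall X,Y\in\mathfrak g\}$. $\mathrm{Der}(\mathfrak g)$ is the Lie algebra of derivations and $\mathrm{Aut}(\mathfrak g)$ the automorphism group of $\mathfrak g$. Semisimple means diagonalizable over $\mathbb C$. *)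

theory Defs
  imports Complex_Main "HOL-Library.Product_Plus"
begin

locale fd_lie_algebra = vector_space scale
  for scale :: "'k::field \<Rightarrow> 'v::ab_group_add \<Rightarrow> 'v" +
  fixes bracket :: "'v \<Rightarrow> 'v \<Rightarrow> 'v"
  assumes finite_dimensional: "\<exists>B. finite B \<and> span B = UNIV"
    and bracket_linear_right: "\<And>x. Vector_Spaces.linear scale scale (\<lambda>y. bracket x y)"
    and bracket_linear_left: "\<And>y. Vector_Spaces.linear scale scale (\<lambda>x. bracket x y)"
    and bracket_alternating: "\<And>x. bracket x x = 0"
    and bracket_jacobi:
      "\<And>x y z. bracket x (bracket y z) + bracket y (bracket z x) + bracket z (bracket x y) = 0"

definition is_metric ::
  "('k::field \<Rightarrow> 'v::ab_group_add \<Rightarrow> 'v) \<Rightarrow> ('v \<Rightarrow> 'v \<Rightarrow> 'k) \<Rightarrow> bool" where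
  "is_metric scale g \<longleftrightarrow>
     (\<forall>x. Vector_Spaces.linear scale (*) (\<lambda>y. g x y)) \<and>
     (\<forall>y. Vector_Spaces.linear scale (*) (\<lambda>x. g x y)) \<and>
     (\<forall>x y. g x y = g y x) \<and>
     (\<forall>x. (\<forall>y. g x y = 0) \<longrightarrow> x = 0)"

definition conf_group ::
  "('k::field \<Rightarrow> 'v::ab_group_add \<Rightarrow> 'v) \<Rightarrow> ('v \<Rightarrow> 'v \<Rightarrow> 'k) \<Rightarrow> ('v \<Rightarrow> 'v) set" where
  "conf_group scale g =
     {f. Vector_Spaces.linear scale scale f \<and> bij f \<and> (\<exists>l. \<forall>x y. g (f x) (f y) = l * g x y)}"

definition conf_algebra ::
  "('k::field \<Rightarrow> 'v::ab_group_add \<Rightarrow> 'v) \<Rightarrow> ('v \<Rightarrow> 'v \<Rightarrow> 'k) \<Rightarrow> ('v \<Rightarrow> 'v) set" where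
  "conf_algebra scale g =
     {f. Vector_Spaces.linear scale scale f \<and>
         (\<exists>l. \<forall>x y. g (f x) y + g x (f y) = l * g x y)}"

definition lie_derivations ::
  "('k::field \<Rightarrow> 'v::ab_group_add \<Rightarrow> 'v) \<Rightarrow> ('v \<Rightarrow> 'v \<Rightarrow> 'v) \<Rightarrow> ('v \<Rightarrow> 'v) set" where
  "lie_derivations scale bracket =
     {D. Vector_Spaces.linear scale scale D \<and>
         (\<forall>x y. D (bracket x y) = bracket (D x) y + bracket x (D y))}"

definition lie_automorphisms ::
  "('k::field \<Rightarrow> 'v::ab_group_add \<Rightarrow> 'v) \<Rightarrow> ('v \<Rightarrow> 'v \<Rightarrow> 'v) \<Rightarrow> ('v \<Rightarrow> 'v) set" where
  "lie_automorphisms scale bracket =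
     {f. Vector_Spaces.linear scale scale f \<and> bij f \<and>
         (\<forall>x y. f (bracket x y) = bracket (f x) (f y))}"

definition is_basis :: "('k::field \<Rightarrow> 'v::ab_group_add \<Rightarrow> 'v) \<Rightarrow> 'v set \<Rightarrow> bool" where
  "is_basis scale B \<longleftrightarrow> \<not> module.dependent scale B \<and> module.span scale B = UNIV"

text \<open>The choice of basis is immaterial, see \<open>lin_trace_eq\<close> below.\<close>

definition lin_trace :: "('k::field \<Rightarrow> 'v::ab_group_add \<Rightarrow> 'v) \<Rightarrow> ('v \<Rightarrow> 'v) \<Rightarrow> 'k" where
  "lin_trace scale f =
     (let B = (SOME B. is_basis scale B) in \<Sum>b\<in>B. module.representation scale B (f b) b)"

definition eigenvalue_of ::
  "('k::field \<Rightarrow> 'v::ab_group_add \<Rightarrow> 'v) \<Rightarrow> ('v \<Rightarrow> 'v) \<Rightarrow> 'k \<Rightarrow> bool" where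
  "eigenvalue_of scale f c \<longleftrightarrow> (\<exists>v. v \<noteq> 0 \<and> f v = scale c v)"

definition is_diagonalizable ::
  "('k::field \<Rightarrow> 'v::ab_group_add \<Rightarrow> 'v) \<Rightarrow> ('v \<Rightarrow> 'v) \<Rightarrow> bool" where
  "is_diagonalizable scale f \<longleftrightarrow>
     (\<exists>B. is_basis scale B \<and> (\<forall>b\<in>B. \<exists>c. f b = scale c b))"

text \<open>The complexification of a real vector space \<open>V\<close> is \<open>V \<times> V\<close>, where \<open>(x, y)\<close> stands for
  \<open>x + i y\<close>; a real linear map \<open>f\<close> extends to it as \<open>map_prod f f\<close>.\<close>

definition complexify ::
  "(real \<Rightarrow> 'v::ab_group_add \<Rightarrow> 'v) \<Rightarrow> complex \<Rightarrow> 'v \<times> 'v \<Rightarrow> 'v \<times> 'v" where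
  "complexify scale c p =
     (scale (Re c) (fst p) - scale (Im c) (snd p), scale (Re c) (snd p) + scale (Im c) (fst p))"

lemma vector_space_complexify:
  assumes "vector_space scale"
  shows "vector_space (complexify scale)"
proof -
  interpret vector_space scale by fact
  show ?thesis
    by standard (auto simp: complexify_def scale_right_distrib scale_left_distrib
        scale_left_diff_distrib scale_right_diff_distrib algebra_simps)
qed

lemma lin_trace_eq:
  assumes "fd_lie_algebra scale bracket" "Vector_Spaces.linear scale scale f" "is_basis scale B"
  shows "lin_trace scale f = (\<Sum>b\<in>B. module.representation scale B (f b) b)"
proof -
  interpret fd_lie_algebra scale bracket by fact
  interpret f: Vector_Spaces.linear scale scale f by fact
  have fin: "finite B" if "is_basis scale B" for B
    using that finite_dimensional independent_span_bound[of _ B]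
    unfolding is_basis_def by blast
  have expand: "representation B (f b) b = (\<Sum>c\<in>C. representation C b c * representation B (f c) b)"
    if B: "is_basis scale B" and C: "is_basis scale C" for B C b
  proof -
    have "b = (\<Sum>c\<in>C. scale (representation C b c) c)"
      using C fin[OF C] by (subst sum_representation_eq) (auto simp: is_basis_def)
    then have "f b = (\<Sum>c\<in>C. scale (representation C b c) (f c))"
      by (metis (no_types, lifting) f.scale f.sum sum.cong)
    then show ?thesis
      using B by (simp add: is_basis_def representation_sum representation_scale)
  qed
  have swap: "(\<Sum>b\<in>B. representation B (f b) b) = (\<Sum>c\<in>C. representation C (f c) c)"
    if B: "is_basis scale B" and C: "is_basis scale C" for B C
  proof -
    have "(\<Sum>c\<in>C. representation C (f c) c) =
        (\<Sum>c\<in>C. \<Sum>b\<in>B. representation B (f c) b * representation C b c)"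
    proof (rule sum.cong[OF refl])
      fix c
      have "f c = (\<Sum>b\<in>B. scale (representation B (f c) b) b)"
        using B fin[OF B] by (subst sum_representation_eq) (auto simp: is_basis_def)
      then have "representation C (f c) c
          = representation C (\<Sum>b\<in>B. scale (representation B (f c) b) b) c" by simp
      then show "representation C (f c) c
          = (\<Sum>b\<in>B. representation B (f c) b * representation C b c)"
        using C by (simp add: is_basis_def representation_sum representation_scale)
    qed
    also have "\<dots> = (\<Sum>b\<in>B. representation B (f b) b)"
      by (subst sum.swap) (simp add: expand[OF B C] mult.commute)
    finally show ?thesis by simp
  qed
  have "is_basis scale (SOME B. is_basis scale B)"
    using assms(3) by (rule someI)
  from swap[OF this assms(3)] show ?thesis
    by (simp add: lin_trace_def Let_def)
qed

end

(* Let h be the intersection of co(g, g) and Der(g), complexified over the reals. If D is in h and f is an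
   additive function commuting with conjugation, then the map acting as f(c) on each generalized eigenspace
   of D for c is again in h, since eigenvalues enter the conditions defining h only through c + c' = c''. In
   particular h contains semisimple parts. Taking for f a rational-valued Q-linear functional of the real or
   imaginary part of c makes tr(D f(D)) positive definite after one more application of the functional. Hence
   the radical r of the trace form on h consists of nilpotent maps, and the eigenvalues of any solution N are
   rational.

   By Engel's theorem r acts nilpotently, which gives an h-invariant flag. Since traces of nilpotent maps
   vanish, tr(N0 .) = tr on h for some N0 in h, and the semisimple part of N0 still represents the trace: its
   nilpotent part n is central modulo r on the commutant of the semisimple part, so n B is nilpotent there.

   Two solutions differ by an element of r. Splitting the difference as A + [N, E] with A commuting with N and
   conjugating by exp E leaves, modulo the next step of the flag, only A, and A vanishes there since both
   solutions are diagonalizable. *)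

theory Submission
  imports Defs "HOL-Library.Function_Algebras" "HOL-Computational_Algebra.Computational_Algebra"
    "HOL-Computational_Algebra.Field_as_Ring"
begin

section \<open>Spectral calculus of a complex endomorphism\<close>

text \<open>The usual route goes through algebraic groups: h splits into a reductive and a nilpotent
  part, and N is found in the centre of the reductive one. Here a single closure property takes
  over: h contains f(D) for every additive f compatible with conjugation. It yields both the
  semisimple parts and the test elements for the trace form, and no complement of r is ever
  constructed. The price is that the needed commutation relations hold only modulo r. The flag
  absorbs this: r acts as zero on its successive quotients, so relations modulo r become exact
  there, and a map that is nilpotent on all quotients is nilpotent. Both ground fields are covered
  by a real space h of complex endomorphisms with the form Re tr(AB). Over the complex numbers h is
  closed under multiplication by i, so real parts of traces determine the traces; over the reals h
  consists of complexified maps, whose traces are real. Constructions inside h may use real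
  coefficients only, which is the origin of the quadratic polynomial in
  \<open>ad_decomposition\<close>.\<close>

locale vspace = vector_space scale
  for scale :: "'k::field_char_0 \<Rightarrow> 'v::ab_group_add \<Rightarrow> 'v"
begin

abbreviation lin :: "('v \<Rightarrow> 'v) \<Rightarrow> bool" where
  "lin f \<equiv> Vector_Spaces.linear scale scale f"

lemma lin_iff: "lin f \<longleftrightarrow> (\<forall>x y. f (x + y) = f x + f y) \<and> (\<forall>c x. f (scale c x) = scale c (f x))"
  using vector_space_axioms by (simp add: Vector_Spaces.linear_iff)

lemma linI: "(\<And>x y. f (x + y) = f x + f y) \<Longrightarrow> (\<And>c x. f (scale c x) = scale c (f x)) \<Longrightarrow> lin f"
  by (simp add: lin_iff)

lemma lin_add: "lin f \<Longrightarrow> f (x + y) = f x + f y"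
  and lin_scale: "lin f \<Longrightarrow> f (scale c x) = scale c (f x)"
  by (simp_all add: lin_iff)

lemma lin_zero: "lin f \<Longrightarrow> f 0 = 0"
  using lin_scale[of f 0 0] by simp

lemma lin_neg: "lin f \<Longrightarrow> f (- x) = - f x"
  using lin_scale[of f "-1" x] by simp

lemma lin_diff: "lin f \<Longrightarrow> f (x - y) = f x - f y"
  using lin_add[of f x "-y"] lin_neg[of f y] by simp

lemma lin_sum: "lin f \<Longrightarrow> f (sum g A) = (\<Sum>a\<in>A. f (g a))"
  by (induction A rule: infinite_finite_induct) (auto simp: lin_zero lin_add)

lemma lin_id: "lin (\<lambda>x. x)" "lin id"
  by (auto intro: linI)

lemma lin_comp: "lin f \<Longrightarrow> lin g \<Longrightarrow> lin (f \<circ> g)"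
  by (auto simp: lin_iff)

lemma lin_plus: "lin f \<Longrightarrow> lin g \<Longrightarrow> lin (f + g)"
  by (auto simp: lin_iff scale_right_distrib algebra_simps)

lemma lin_minus: "lin f \<Longrightarrow> lin g \<Longrightarrow> lin (f - g)"
  by (auto simp: lin_iff scale_right_diff_distrib algebra_simps)

lemma lin_uminus: "lin f \<Longrightarrow> lin (- f)"
  by (auto simp: lin_iff)

lemma lin_0: "lin 0" "lin (\<lambda>x. 0)"
  by (auto simp: lin_iff)

lemma lin_smul: "lin f \<Longrightarrow> lin (\<lambda>x. scale c (f x))"
  by (auto simp: lin_iff scale_right_distrib mult.commute)

lemma lin_funpow: "lin f \<Longrightarrow> lin (f ^^ n)"
  by (induction n) (auto intro: lin_comp lin_id)

lemma lin_sumf: "(\<And>i. i \<in> I \<Longrightarrow> lin (F i)) \<Longrightarrow> lin (\<lambda>x. \<Sum>i\<in>I. F i x)"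
  by (auto simp: lin_iff sum.distrib scale_sum_right)

lemma lin_inv: "lin f \<Longrightarrow> bij f \<Longrightarrow> lin (inv f)"
  by (intro linI; metis lin_add lin_scale bij_inv_eq_iff)

lemma subspace_preimage: "lin f \<Longrightarrow> subspace U \<Longrightarrow> subspace {x. f x \<in> U}"
  by (auto simp: subspace_def lin_add lin_scale lin_zero)

end

text \<open>\<open>lin_trace_eq\<close> speaks of Lie algebras; the zero bracket makes it available
  on every finite-dimensional space.\<close>

lemma fd_lie_algebra_trivial:
  assumes "vspace scale" "finite_dimensional_vector_space scale B"
  shows "fd_lie_algebra scale (\<lambda>_ _. 0)"
proof -
  interpret vspace scale by fact
  interpret finite_dimensional_vector_space scale B by fact
  show ?thesis
  proof
    show "\<exists>B. finite B \<and> span B = UNIV" using finite_Basis span_Basis by blast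
  qed (simp_all add: lin_0)
qed

section \<open>Polynomials in an endomorphism and primary decomposition\<close>

lemma bezout_poly:
  fixes p q :: "complex poly"
  assumes "coprime p q"
  obtains u v where "u * p + v * q = 1"
proof -
  obtain u v where "bezout_coefficients p q = (u, v)" by fastforce
  then show ?thesis using that bezout_coefficients[of p q u v] assms by auto
qed

lemma coprime_linear_powers:
  fixes a b :: complex
  assumes "a \<noteq> b"
  shows "coprime ([:-a, 1:] ^ j) ([:-b, 1:] ^ k)"
proof -
  have "coprime [:-a, 1:] [:-b, 1:]"
  proof (rule coprimeI)
    fix c assume c: "c dvd [:-a, 1:]" "c dvd [:-b, 1:]"
    then have "c dvd [:-a, 1:] - [:-b, 1:]" by (rule dvd_diff)
    also have "[:-a, 1:] - [:-b, 1:] = [:b - a:]" by simp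
    finally have "c dvd [:b - a:]" .
    moreover have "is_unit [:b - a:]"
      using assms by (simp add: is_unit_const_poly_iff dvd_field_iff)
    ultimately show "is_unit c" by (rule dvd_trans)
  qed
  then show ?thesis by simp
qed

locale complex_endo = finite_dimensional_vector_space scale Basis + vspace scale
  for scale :: "complex \<Rightarrow> 'w::ab_group_add \<Rightarrow> 'w" and Basis
begin

text \<open>Horner's scheme: the fold gives the recursion \<open>peval_pCons\<close>, from which the
  other rules follow by induction on the polynomial.\<close>

definition peval :: "('w \<Rightarrow> 'w) \<Rightarrow> complex poly \<Rightarrow> 'w \<Rightarrow> 'w" where
  "peval D p = fold_coeffs (\<lambda>a f x. scale a x + D (f x)) p (\<lambda>x. 0)"

lemma peval_0 [simp]: "peval D 0 x = 0"
  by (simp add: peval_def)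

lemma peval_pCons: "lin D \<Longrightarrow> peval D (pCons a p) x = scale a x + D (peval D p x)"
  by (cases "p = 0 \<and> a = 0") (auto simp: peval_def lin_zero)

lemma lin_peval: "lin D \<Longrightarrow> lin (peval D p)"
  by (induction p) (auto simp: lin_iff peval_pCons algebra_simps scale_right_distrib)

lemma peval_1 [simp]: "lin D \<Longrightarrow> peval D 1 x = x"
  by (simp add: one_pCons peval_pCons lin_zero)

lemma peval_add: "lin D \<Longrightarrow> peval D (p + q) x = peval D p x + peval D q x"
  by (induction p q rule: poly_induct2) (auto simp: peval_pCons lin_add scale_left_distrib)

lemma peval_smult: "lin D \<Longrightarrow> peval D (smult c p) x = scale c (peval D p x)"
  by (induction p) (auto simp: peval_pCons lin_scale scale_right_distrib)

lemma peval_minus: "lin D \<Longrightarrow> peval D (p - q) x = peval D p x - peval D q x"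
  using peval_add[of D p "smult (-1) q" x] peval_smult[of D "-1" q x] by simp

lemma peval_sum: "lin D \<Longrightarrow> peval D (\<Sum>i\<in>I. p i) x = (\<Sum>i\<in>I. peval D (p i) x)"
  by (induction I rule: infinite_finite_induct) (auto simp: peval_add)

lemma peval_mult: "lin D \<Longrightarrow> peval D (p * q) x = peval D p (peval D q x)"
  by (induction p) (auto simp: peval_pCons peval_add peval_smult)

lemma peval_comm: "lin D \<Longrightarrow> peval D p (peval D q x) = peval D q (peval D p x)"
  by (metis mult.commute peval_mult)

lemma peval_dvd: "lin D \<Longrightarrow> p dvd q \<Longrightarrow> peval D p x = 0 \<Longrightarrow> peval D q x = 0"
  by (metis dvdE lin_peval lin_zero mult.commute peval_mult)

lemma peval_monom: "lin D \<Longrightarrow> peval D (monom 1 n) x = (D ^^ n) x"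
  by (induction n) (auto simp: monom_Suc monom_0 peval_pCons lin_zero)

lemma peval_commute: "lin D \<Longrightarrow> lin A \<Longrightarrow> (\<And>x. A (D x) = D (A x)) \<Longrightarrow> A (peval D p x) = peval D p (A x)"
  by (induction p) (auto simp: peval_pCons lin_add lin_scale lin_zero)

lemma peval_stable: "lin D \<Longrightarrow> subspace U \<Longrightarrow> (\<And>x. x \<in> U \<Longrightarrow> D x \<in> U) \<Longrightarrow> x \<in> U \<Longrightarrow> peval D p x \<in> U"
  by (induction p) (auto simp: peval_pCons subspace_add subspace_scale subspace_0)

lemma peval_linear_power: "lin D \<Longrightarrow> peval D ([:-c, 1:] ^ k) x = ((\<lambda>y. D y - scale c y) ^^ k) x"
proof (induction k)
  case (Suc k)
  show ?case
    unfolding power_Suc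
    by (subst peval_mult) (simp_all add: Suc peval_pCons lin_zero)
qed simp

text \<open>Otherwise no power D^n x would lie in the span of the earlier ones, and there would be
  independent sets of every size.\<close>

lemma annihilator_exists:
  assumes "lin D"
  shows "\<exists>p. p \<noteq> 0 \<and> peval D p x = 0"
proof -
  define U where "U n = span ((\<lambda>i. (D ^^ i) x) ` {..<n})" for n
  have "\<exists>n. (D ^^ n) x \<in> U n"
  proof (rule ccontr)
    assume "\<not> ?thesis"
    then have no: "(D ^^ n) x \<notin> U n" for n by auto
    have "independent ((\<lambda>i. (D ^^ i) x) ` {..<n}) \<and> card ((\<lambda>i. (D ^^ i) x) ` {..<n}) = n" for n
    proof (induction n)
      case (Suc n)
      let ?S = "(\<lambda>i. (D ^^ i) x) ` {..<n}"
      have ns: "(D ^^ n) x \<notin> span ?S" using no[of n] by (simp only: U_def not_False_eq_True)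
      then have "(D ^^ n) x \<notin> ?S" using span_base by metis
      moreover have "independent (insert ((D ^^ n) x) ?S)"
        using Suc ns by (intro independent_insertI) auto
      moreover have "(\<lambda>i. (D ^^ i) x) ` {..<Suc n} = insert ((D ^^ n) x) ?S"
        by (simp add: lessThan_Suc)
      ultimately show ?case using Suc by simp
    qed (auto simp: independent_empty)
    then have "Suc dimension \<le> dim UNIV"
      by (metis independent_card_le_dim subset_UNIV)
    then show False by (simp add: dimension_def)
  qed
  then obtain n where n: "(D ^^ n) x \<in> U n" ..
  \<comment> \<open>The values at x of polynomials of degree below n. Subtracting one of them from
    X^n leaves the coefficient 1 at n, so the annihilator obtained is nonzero.\<close>
  let ?T = "{y. \<exists>q. (\<forall>i\<ge>n. coeff q i = 0) \<and> y = peval D q x}"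
  have "subspace ?T"
    unfolding subspace_def
  proof (intro conjI ballI allI)
    show "0 \<in> ?T" by (auto intro!: exI[of _ 0])
  next
    fix y z assume "y \<in> ?T" "z \<in> ?T"
    then obtain p q where "\<forall>i\<ge>n. coeff p i = 0" "\<forall>i\<ge>n. coeff q i = 0"
      "y = peval D p x" "z = peval D q x" by blast
    then show "y + z \<in> ?T"
      using assms by (auto intro!: exI[of _ "p + q"] simp: peval_add)
  next
    fix c y assume "y \<in> ?T"
    then obtain q where "\<forall>i\<ge>n. coeff q i = 0" "y = peval D q x" by blast
    then show "scale c y \<in> ?T"
      using assms by (auto intro!: exI[of _ "smult c q"] simp: peval_smult)
  qed
  moreover have "(\<lambda>i. (D ^^ i) x) ` {..<n} \<subseteq> ?T"
  proof clarsimp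
    fix i assume "i < n"
    then show "\<exists>q. (\<forall>i\<ge>n. coeff q i = 0) \<and> (D ^^ i) x = peval D q x"
      using assms by (intro exI[of _ "monom 1 i"]) (simp add: peval_monom)
  qed
  ultimately have "U n \<subseteq> ?T" unfolding U_def by (intro span_minimal)
  with n obtain q where q: "\<forall>i\<ge>n. coeff q i = 0" "(D ^^ n) x = peval D q x" by blast
  have "monom 1 n - q \<noteq> 0"
    using q(1) by (metis (mono_tags) coeff_monom eq_iff_diff_eq_0 le_refl zero_neq_one)
  moreover have "peval D (monom 1 n - q) x = 0"
    using assms q(2) by (simp add: peval_minus peval_monom)
  ultimately show ?thesis by blast
qed

lemma global_annihilator:
  assumes D: "lin D"
  obtains p where "p \<noteq> 0" "\<And>x. peval D p x = 0"
proof -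
  from annihilator_exists[OF D] obtain q where q: "\<And>x. q x \<noteq> 0" "\<And>x. peval D (q x) x = 0" by metis
  define p where "p = (\<Prod>b\<in>Basis. q b)"
  have "p \<noteq> 0" using q(1) finite_Basis by (simp add: p_def)
  moreover have "peval D p x = 0" for x
  proof -
    have "subspace {x. peval D p x \<in> {0}}"
      by (rule subspace_preimage) (simp_all add: D lin_peval)
    moreover have "Basis \<subseteq> {x. peval D p x \<in> {0}}"
    proof clarsimp
      fix b assume "b \<in> Basis"
      then have "q b dvd p" unfolding p_def using finite_Basis by (rule dvd_prodI[rotated])
      then show "peval D p b = 0" using q(2) D peval_dvd by blast
    qed
    ultimately have "span Basis \<subseteq> {x. peval D p x \<in> {0}}" by (intro span_minimal)
    then show ?thesis by (auto simp: span_Basis)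
  qed
  ultimately show ?thesis using that by blast
qed

definition gen_eigenspace :: "('w \<Rightarrow> 'w) \<Rightarrow> complex \<Rightarrow> 'w set" where
  "gen_eigenspace D c = {x. \<exists>k. peval D ([:-c, 1:] ^ k) x = 0}"

lemma gen_eigenspace_funpow:
  "lin D \<Longrightarrow> x \<in> gen_eigenspace D c \<longleftrightarrow> (\<exists>k. ((\<lambda>y. D y - scale c y) ^^ k) x = 0)"
  by (simp add: gen_eigenspace_def peval_linear_power)

lemma subspace_gen_eigenspace:
  assumes D: "lin D"
  shows "subspace (gen_eigenspace D c)"
  unfolding subspace_def
proof (intro conjI ballI allI)
  show "0 \<in> gen_eigenspace D c"
    by (auto simp: gen_eigenspace_def lin_zero[OF lin_peval[OF D]])
next
  fix x y assume "x \<in> gen_eigenspace D c" "y \<in> gen_eigenspace D c"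
  then obtain j k where jk: "peval D ([:-c, 1:] ^ j) x = 0" "peval D ([:-c, 1:] ^ k) y = 0"
    by (auto simp: gen_eigenspace_def)
  have "peval D ([:-c, 1:] ^ (j + k)) x = 0" "peval D ([:-c, 1:] ^ (j + k)) y = 0"
    using jk D by (simp_all add: power_add peval_mult lin_zero lin_peval peval_comm[of D "_ ^ j"])
  then show "x + y \<in> gen_eigenspace D c"
    unfolding gen_eigenspace_def by (auto simp: lin_add[OF lin_peval[OF D]] intro!: exI[of _ "j + k"])
next
  fix a x assume "x \<in> gen_eigenspace D c"
  then show "scale a x \<in> gen_eigenspace D c"
    by (auto simp: gen_eigenspace_def lin_scale[OF lin_peval[OF D]])
qed

lemma gen_eigenspace_disjoint:
  assumes D: "lin D" and "a \<noteq> b" "x \<in> gen_eigenspace D a" "x \<in> gen_eigenspace D b"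
  shows "x = 0"
proof -
  obtain j k where jk: "peval D ([:-a, 1:] ^ j) x = 0" "peval D ([:-b, 1:] ^ k) x = 0"
    using assms by (auto simp: gen_eigenspace_def)
  obtain u v where "u * [:-a, 1:] ^ j + v * [:-b, 1:] ^ k = 1"
    using bezout_poly[OF coprime_linear_powers[OF assms(2)]] by blast
  then have "x = peval D (u * [:-a, 1:] ^ j + v * [:-b, 1:] ^ k) x" using D by simp
  also have "\<dots> = 0" using D jk by (simp add: peval_add peval_mult lin_zero[OF lin_peval[OF D]])
  finally show ?thesis .
qed

lemma gen_eigenspace_stable:
  assumes "lin D" "lin A" "\<And>x. A (D x) = D (A x)" "x \<in> gen_eigenspace D c"
  shows "A x \<in> gen_eigenspace D c"
proof -
  obtain k where "peval D ([:-c, 1:] ^ k) x = 0" using assms(4) by (auto simp: gen_eigenspace_def)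
  then have "peval D ([:-c, 1:] ^ k) (A x) = 0"
    using assms(2) peval_commute[OF assms(1-3)] by (metis lin_zero)
  then show ?thesis by (auto simp: gen_eigenspace_def)
qed

lemma peval_gen_eigenspace: "lin D \<Longrightarrow> x \<in> gen_eigenspace D c \<Longrightarrow> peval D p x \<in> gen_eigenspace D c"
  by (rule gen_eigenspace_stable) (auto simp: lin_peval peval_commute[OF _ _ refl])

lemma eigenvector_gen_eigenspace: "lin D \<Longrightarrow> D x = scale c x \<Longrightarrow> x \<in> gen_eigenspace D c"
  by (auto simp: gen_eigenspace_funpow intro!: exI[of _ 1])

text \<open>The components are given by polynomials \<open>a c\<close> that do not depend on x; this
  is why the functional calculus below consists of polynomials in D.\<close>

lemma primary_decomposition_aux:
  assumes D: "lin D" and "finite F"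
  shows "\<exists>a. \<forall>x. peval D (\<Prod>c\<in>F. [:-c, 1:] ^ k) x = 0 \<longrightarrow>
           x = (\<Sum>c\<in>F. peval D (a c) x) \<and> (\<forall>c\<in>F. peval D ([:-c, 1:] ^ k) (peval D (a c) x) = 0)"
  using assms(2)
proof (induction F)
  case empty
  then show ?case using D by auto
next
  case (insert m F)
  let ?q = "\<Prod>c\<in>F. [:-c, 1:] ^ k" and ?r = "[:-m, 1:] ^ k"
  from insert obtain a where a: "\<And>x. peval D ?q x = 0 \<Longrightarrow> x = (\<Sum>c\<in>F. peval D (a c) x)"
      "\<And>x c. peval D ?q x = 0 \<Longrightarrow> c \<in> F \<Longrightarrow> peval D ([:-c, 1:] ^ k) (peval D (a c) x) = 0" by metis
  have "coprime ?q ?r"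
    using insert.hyps by (auto intro!: prod_coprime_left coprime_linear_powers simp del: coprime_power_left_iff coprime_power_right_iff)
  then obtain u v where uv: "u * ?q + v * ?r = 1" by (rule bezout_poly)
  \<comment> \<open>By Bezout, u q projects to the kernel of r = (X - m)^k and v r to the kernel of
    q, where the induction hypothesis applies.\<close>
  define a' where "a' c = (if c = m then u * ?q else a c * (v * ?r))" for c
  show ?case
  proof (intro exI[of _ a'] allI impI)
    fix x assume "peval D (\<Prod>c\<in>insert m F. [:-c, 1:] ^ k) x = 0"
    then have x: "peval D (?r * ?q) x = 0" using insert by simp
    let ?z = "peval D (v * ?r) x"
    have "peval D ?q ?z = peval D (?r * ?q * v) x"
      using D by (simp only: peval_mult[symmetric] ac_simps)
    then have "peval D ?q ?z = 0" using peval_dvd[OF D _ x] by simp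
    note z = a[OF this]
    have "x = peval D (u * ?q) x + ?z" using uv D by (metis peval_1 peval_add)
    also have "?z = (\<Sum>c\<in>F. peval D (a' c) x)"
      using insert D by (subst z(1)) (auto intro!: sum.cong simp: a'_def peval_mult)
    finally have 1: "x = (\<Sum>c\<in>insert m F. peval D (a' c) x)"
      using insert by (simp add: a'_def)
    have "peval D ?r (peval D (u * ?q) x) = peval D (?r * ?q * u) x"
      using D by (simp only: peval_mult[symmetric] ac_simps)
    then have "peval D ?r (peval D (u * ?q) x) = 0" using peval_dvd[OF D _ x] by simp
    then show "x = (\<Sum>c\<in>insert m F. peval D (a' c) x) \<and>
        (\<forall>c\<in>insert m F. peval D ([:-c, 1:] ^ k) (peval D (a' c) x) = 0)"
      using 1 z(2) insert D by (auto simp: a'_def peval_mult)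
  qed
qed

lemma primary_decomposition:
  assumes D: "lin D"
  obtains F a where "finite F" "\<And>x. x = (\<Sum>c\<in>F. peval D (a c) x)"
    "\<And>x c. c \<in> F \<Longrightarrow> peval D (a c) x \<in> gen_eigenspace D c"
proof -
  obtain p where p: "p \<noteq> 0" "\<And>x. peval D p x = 0" using global_annihilator[OF D] by blast
  define F where "F = {z. poly p z = 0}"
  have F: "finite F" using p(1) by (simp add: F_def poly_roots_finite)
  \<comment> \<open>The common exponent \<open>degree p\<close> bounds the multiplicity of every
    root, so p divides \<open>?P\<close>.\<close>
  let ?P = "\<Prod>c\<in>F. [:-c, 1:] ^ degree p"
  have "(\<Prod>c\<in>F. [:-c, 1:] ^ order c p) dvd ?P"
    using p(1) by (intro prod_dvd_prod) (auto intro!: le_imp_power_dvd order_degree)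
  then have "smult (lead_coeff p) (\<Prod>c\<in>F. [:-c, 1:] ^ order c p) dvd ?P"
    using p(1) by (simp add: smult_dvd_iff)
  then have "p dvd ?P" using complex_poly_decompose[of p] by (simp add: F_def)
  then have "peval D ?P x = 0" for x using peval_dvd[OF D _ p(2)] by blast
  with primary_decomposition_aux[OF D F, of "degree p"] obtain a where
    "\<And>x. x = (\<Sum>c\<in>F. peval D (a c) x)"
    "\<And>x c. c \<in> F \<Longrightarrow> peval D ([:-c, 1:] ^ degree p) (peval D (a c) x) = 0" by metis
  then show ?thesis using that[OF F] unfolding gen_eigenspace_def by blast
qed

text \<open>Serves as an induction principle: a property that cuts out a subspace need only be
  checked on generalized eigenvectors.\<close>

lemma gen_eigenspaces_span:
  assumes D: "lin D" and U: "subspace U" "\<And>c. gen_eigenspace D c \<subseteq> U"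
  shows "x \<in> U"
proof -
  obtain F a where "finite F" "x = (\<Sum>c\<in>F. peval D (a c) x)"
    "\<And>c. c \<in> F \<Longrightarrow> peval D (a c) x \<in> gen_eigenspace D c"
    using primary_decomposition[OF D] by metis
  then show ?thesis using subspace_sum[OF U(1), of F "\<lambda>c. peval D (a c) x"] U(2) by auto
qed

lemma gen_eigenspaces_ext:
  assumes D: "lin D" and "lin A" "lin B" "\<And>c x. x \<in> gen_eigenspace D c \<Longrightarrow> A x = B x"
  shows "A = B"
proof
  fix x
  have "subspace {x. A x = B x}"
    using assms(2,3) by (auto simp: subspace_def lin_add lin_scale lin_zero)
  then show "A x = B x"
    using gen_eigenspaces_span[OF D, of "{x. A x = B x}" x] assms(4) by blast
qed

section \<open>Functional calculus and spectral projections\<close>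

lemma calc_poly_exists:
  assumes D: "lin D"
  shows "\<exists>p. \<forall>c. \<forall>x\<in>gen_eigenspace D c. peval D p x = scale (f c) x"
proof -
  obtain F a where F: "finite F" "\<And>x. x = (\<Sum>c\<in>F. peval D (a c) x)"
    "\<And>x c. c \<in> F \<Longrightarrow> peval D (a c) x \<in> gen_eigenspace D c"
    using primary_decomposition[OF D] by blast
  show ?thesis
  proof (intro exI[of _ "\<Sum>c\<in>F. smult (f c) (a c)"] allI ballI)
    fix c x assume x: "x \<in> gen_eigenspace D c"
    have z: "peval D (a d) x = 0" if "d \<in> F" "d \<noteq> c" for d
      using gen_eigenspace_disjoint[OF D that(2)] F(3)[OF that(1)] peval_gen_eigenspace[OF D x] by blast
    then have "peval D (\<Sum>c\<in>F. smult (f c) (a c)) x = (\<Sum>d\<in>F. scale (f c) (peval D (a d) x))"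
      using D z by (simp only: peval_sum peval_smult, intro sum.cong refl) (metis scale_zero_right)
    also have "\<dots> = scale (f c) x" using F(2)[of x] by (simp add: scale_sum_right[symmetric])
    finally show "peval D (\<Sum>c\<in>F. smult (f c) (a c)) x = scale (f c) x" .
  qed
qed

text \<open>This is f of the semisimple part of D: no derivatives of f enter on Jordan blocks, hence
  f may be any function. Being a polynomial in D, the map commutes with the commutant of D and
  preserves D-stable subspaces.\<close>

definition fcalc :: "('w \<Rightarrow> 'w) \<Rightarrow> (complex \<Rightarrow> complex) \<Rightarrow> 'w \<Rightarrow> 'w" where
  "fcalc D f = peval D (SOME p. \<forall>c. \<forall>x\<in>gen_eigenspace D c. peval D p x = scale (f c) x)"

lemma fcalc_eq: "lin D \<Longrightarrow> x \<in> gen_eigenspace D c \<Longrightarrow> fcalc D f x = scale (f c) x"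
  unfolding fcalc_def using someI_ex[OF calc_poly_exists, of D f] by blast

lemma lin_fcalc: "lin D \<Longrightarrow> lin (fcalc D f)"
  by (simp add: fcalc_def lin_peval)

lemma fcalc_commute: "lin D \<Longrightarrow> lin A \<Longrightarrow> (\<And>x. A (D x) = D (A x)) \<Longrightarrow> A (fcalc D f x) = fcalc D f (A x)"
  unfolding fcalc_def by (rule peval_commute)

lemma fcalc_stable: "lin D \<Longrightarrow> subspace U \<Longrightarrow> (\<And>x. x \<in> U \<Longrightarrow> D x \<in> U) \<Longrightarrow> x \<in> U \<Longrightarrow> fcalc D f x \<in> U"
  unfolding fcalc_def by (rule peval_stable)

lemma fcalc_unique:
  "lin D \<Longrightarrow> lin A \<Longrightarrow> (\<And>c x. x \<in> gen_eigenspace D c \<Longrightarrow> A x = scale (f c) x) \<Longrightarrow> A = fcalc D f"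
  by (rule gen_eigenspaces_ext[of D]) (auto simp: lin_fcalc fcalc_eq)

lemma fcalc_mult: "lin D \<Longrightarrow> fcalc D f (fcalc D g x) = fcalc D (\<lambda>c. f c * g c) x"
  by (rule fun_cong[of "\<lambda>x. fcalc D f (fcalc D g x)"], rule fcalc_unique)
    (auto simp: fcalc_eq lin_iff lin_add[OF lin_fcalc] lin_scale[OF lin_fcalc] mult.commute)

definition spectrum :: "('w \<Rightarrow> 'w) \<Rightarrow> complex set" where
  "spectrum D = {c. gen_eigenspace D c \<noteq> {0}}"

abbreviation spec_proj :: "('w \<Rightarrow> 'w) \<Rightarrow> complex \<Rightarrow> 'w \<Rightarrow> 'w" where
  "spec_proj D c \<equiv> fcalc D (\<lambda>d. if d = c then 1 else 0)"

lemma spectrumD: "lin D \<Longrightarrow> c \<in> spectrum D \<Longrightarrow> \<exists>x\<in>gen_eigenspace D c. x \<noteq> 0"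
  using subspace_0[OF subspace_gen_eigenspace] by (auto simp: spectrum_def)

lemma finite_spectrum:
  assumes D: "lin D"
  shows "finite (spectrum D)"
proof -
  obtain F a where F: "finite F" "\<And>x. x = (\<Sum>c\<in>F. peval D (a c) x)"
    "\<And>x c. c \<in> F \<Longrightarrow> peval D (a c) x \<in> gen_eigenspace D c"
    using primary_decomposition[OF D] by blast
  have "spectrum D \<subseteq> F"
  proof
    fix c assume "c \<in> spectrum D"
    then obtain x where x: "x \<in> gen_eigenspace D c" "x \<noteq> 0" using spectrumD[OF D] by blast
    show "c \<in> F"
    proof (rule ccontr)
      assume "c \<notin> F"
      then have "peval D (a d) x = 0" if "d \<in> F" for d
        using gen_eigenspace_disjoint[OF D, of d c] F(3)[OF that] peval_gen_eigenspace[OF D x(1)] that by blast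
      then have "x = 0" using F(2)[of x] by simp
      then show False using x by simp
    qed
  qed
  then show ?thesis using F(1) finite_subset by blast
qed

lemma fcalc_spec_proj:
  assumes D: "lin D"
  shows "fcalc D f x = (\<Sum>c\<in>spectrum D. scale (f c) (spec_proj D c x))"
proof (rule fun_cong[where x = x], rule sym, rule fcalc_unique[OF D])
  show "lin (\<lambda>x. \<Sum>c\<in>spectrum D. scale (f c) (spec_proj D c x))"
    using D by (intro lin_sumf lin_smul lin_fcalc)
  fix d x assume x: "x \<in> gen_eigenspace D d"
  show "(\<Sum>c\<in>spectrum D. scale (f c) (spec_proj D c x)) = scale (f d) x"
  proof (cases "d \<in> spectrum D")
    case True
    then show ?thesis using D x finite_spectrum[OF D]
      by (simp add: fcalc_eq if_distrib[of "\<lambda>a. scale a x"] if_distrib[of "scale (f _)"] cong: if_cong)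
  next
    case False
    then show ?thesis using x D by (auto simp: spectrum_def lin_zero[OF lin_fcalc])
  qed
qed

lemma spec_proj_in: "lin D \<Longrightarrow> spec_proj D c x \<in> gen_eigenspace D c"
proof -
  assume D: "lin D"
  have "gen_eigenspace D d \<subseteq> {x. spec_proj D c x \<in> gen_eigenspace D c}" for d
    using fcalc_eq[OF D, of _ d] subspace_0[OF subspace_gen_eigenspace[OF D]] by auto
  then show ?thesis
    using gen_eigenspaces_span[OF D subspace_preimage[OF lin_fcalc[OF D] subspace_gen_eigenspace[OF D]]]
    by blast
qed

lemma fcalc_one: "lin D \<Longrightarrow> fcalc D (\<lambda>c. 1) x = x"
  by (rule fun_cong[where x = x], rule sym, rule fcalc_unique) (auto intro: lin_id)

lemma spec_proj_sum: "lin D \<Longrightarrow> x = (\<Sum>c\<in>spectrum D. spec_proj D c x)"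
  using fcalc_spec_proj[of D "\<lambda>c. 1" x] by (simp add: fcalc_one)

section \<open>Nilpotent and semisimple parts\<close>

definition nilpotent :: "('w \<Rightarrow> 'w) \<Rightarrow> bool" where
  "nilpotent a \<longleftrightarrow> (\<exists>k. \<forall>x. (a ^^ k) x = 0)"

lemma funpow_zero_mono:
  assumes "lin a" "(a ^^ k) x = 0" "k \<le> n" shows "(a ^^ n) x = 0"
  by (metis assms comp_apply funpow_add lin_funpow lin_zero ordered_cancel_comm_monoid_diff_class.diff_add)

lemma nilpotent_local:
  assumes a: "lin a" and "\<And>x. \<exists>k. (a ^^ k) x = 0"
  shows "nilpotent a"
proof -
  obtain k where k: "\<And>x. (a ^^ k x) x = 0" using assms(2) by metis
  define K where "K = Max (insert 0 (k ` Basis))"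
  have "subspace {x. (a ^^ K) x \<in> {0}}"
    by (rule subspace_preimage) (simp_all add: a lin_funpow)
  moreover have "Basis \<subseteq> {x. (a ^^ K) x \<in> {0}}"
    using finite_Basis by (auto intro!: funpow_zero_mono[OF a k] simp: K_def)
  ultimately have "span Basis \<subseteq> {x. (a ^^ K) x \<in> {0}}" by (intro span_minimal)
  then show ?thesis by (auto simp: span_Basis nilpotent_def)
qed

abbreviation ss_part :: "('w \<Rightarrow> 'w) \<Rightarrow> 'w \<Rightarrow> 'w" where
  "ss_part D \<equiv> fcalc D (\<lambda>c. c)"

text \<open>On the generalized eigenspace for c the map coincides with D - c, which is locally
  nilpotent there.\<close>

lemma nilpotent_part:
  assumes D: "lin D"
  shows "nilpotent (D - ss_part D)"
proof (rule nilpotent_local)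
  let ?n = "D - ss_part D"
  show n: "lin ?n" using D by (intro lin_minus lin_fcalc)
  fix x
  let ?U = "{x. \<exists>k. (?n ^^ k) x = 0}"
  have "subspace ?U"
    unfolding subspace_def
  proof (intro conjI ballI allI)
    show "0 \<in> ?U" by (auto intro: exI[of _ 0])
    fix y z assume "y \<in> ?U" "z \<in> ?U"
    then obtain j k where "(?n ^^ j) y = 0" "(?n ^^ k) z = 0" by auto
    then have "(?n ^^ (j + k)) (y + z) = 0"
      using funpow_zero_mono[OF n, of _ _ "j + k"] lin_add[OF lin_funpow[OF n]] by simp
    then show "y + z \<in> ?U" by blast
  next
    fix c y assume "y \<in> ?U" then show "scale c y \<in> ?U"
      by (auto simp: lin_scale[OF lin_funpow[OF n]])
  qed
  moreover have "gen_eigenspace D c \<subseteq> ?U" for c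
  proof
    fix y assume y: "y \<in> gen_eigenspace D c"
    \<comment> \<open>Membership in the eigenspace is carried along because the two maps agree only
      there.\<close>
    have st: "((\<lambda>z. D z - scale c z) ^^ j) y \<in> gen_eigenspace D c \<and> (?n ^^ j) y = ((\<lambda>z. D z - scale c z) ^^ j) y" for j
    proof (induction j)
      case (Suc j)
      let ?y = "((\<lambda>z. D z - scale c z) ^^ j) y"
      have "peval D [:-c, 1:] ?y \<in> gen_eigenspace D c"
        using Suc by (intro peval_gen_eigenspace D) auto
      then show ?case using Suc D by (auto simp: peval_pCons lin_zero fcalc_eq)
    qed (use y in auto)
    then show "y \<in> ?U" using y gen_eigenspace_funpow[OF D] by auto
  qed
  ultimately show "\<exists>k. (?n ^^ k) x = 0"
    using gen_eigenspaces_span[OF D, of ?U x] by blast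
qed

text \<open>Replaces an existence statement about bases by an equation of linear maps, which can be
  tested on spanning sets. Conversely, if the equation holds, all generalized eigenvectors are
  eigenvectors, and a maximal independent set of these is a basis.\<close>

lemma diagonalizable_iff:
  assumes D: "lin D"
  shows "is_diagonalizable scale D \<longleftrightarrow> D = ss_part D"
proof
  assume "is_diagonalizable scale D"
  then obtain B where B: "span B = UNIV" "\<And>b. b \<in> B \<Longrightarrow> \<exists>c. D b = scale c b"
    by (auto simp: is_diagonalizable_def is_basis_def)
  have "subspace {x. D x = ss_part D x}"
    using D lin_fcalc[OF D] by (auto simp: subspace_def lin_add lin_scale lin_zero)
  moreover have "B \<subseteq> {x. D x = ss_part D x}"
  proof
    fix b assume "b \<in> B"
    then obtain c where c: "D b = scale c b" using B(2) by blast
    then show "b \<in> {x. D x = ss_part D x}"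
      using fcalc_eq[OF D eigenvector_gen_eigenspace[OF D c]] by simp
  qed
  ultimately have "span B \<subseteq> {x. D x = ss_part D x}" by (intro span_minimal)
  then show "D = ss_part D" using B(1) by auto
next
  assume eq: "D = ss_part D"
  let ?E = "{x. \<exists>c. D x = scale c x}"
  have E: "gen_eigenspace D c \<subseteq> ?E" for c
    using fcalc_eq[OF D, of _ c "\<lambda>c. c"] eq by auto
  obtain B where B: "B \<subseteq> ?E" "independent B" "?E \<subseteq> span B"
    using maximal_independent_subset[of ?E] by blast
  have "x \<in> span B" for x
    using gen_eigenspaces_span[OF D subspace_span subset_trans[OF E B(3)]] .
  then show "is_diagonalizable scale D"
    using B by (auto simp: is_diagonalizable_def is_basis_def)
qed

lemma diagonalizable_eigenspace:
  "lin D \<Longrightarrow> is_diagonalizable scale D \<Longrightarrow> x \<in> gen_eigenspace D c \<longleftrightarrow> D x = scale c x"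
  using diagonalizable_iff[of D] fcalc_eq[of D x c "\<lambda>c. c"] eigenvector_gen_eigenspace[of D x c] by auto

lemma diagonalizable_by_spanning:
  assumes D: "lin D" and A: "lin A" and "\<And>c x. x \<in> gen_eigenspace D c \<Longrightarrow> \<exists>d. A x = scale d x"
  shows "is_diagonalizable scale A"
proof -
  have "x \<in> {x. A x = ss_part A x}" for x
  proof (rule gen_eigenspaces_span[OF D])
    show "subspace {x. A x = ss_part A x}"
      using A lin_fcalc[OF A] by (auto simp: subspace_def lin_add lin_scale lin_zero)
    show "gen_eigenspace D c \<subseteq> {x. A x = ss_part A x}" for c
    proof
      fix x assume "x \<in> gen_eigenspace D c"
      then obtain d where d: "A x = scale d x" using assms(3) by blast
      then show "x \<in> {x. A x = ss_part A x}"
        using fcalc_eq[OF A eigenvector_gen_eigenspace[OF A d]] by simp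
    qed
  qed
  then show ?thesis using A by (auto simp: diagonalizable_iff)
qed

lemma diagonalizable_fcalc: "lin D \<Longrightarrow> is_diagonalizable scale (fcalc D f)"
  by (rule diagonalizable_by_spanning[of D]) (auto simp: lin_fcalc fcalc_eq)

end

section \<open>Traces\<close>

context complex_endo
begin

abbreviation tr :: "('w \<Rightarrow> 'w) \<Rightarrow> complex" where
  "tr \<equiv> lin_trace scale"

lemma is_basis_Basis: "is_basis scale Basis"
  by (simp add: is_basis_def independent_Basis span_Basis)

lemma tr_basis:
  "lin f \<Longrightarrow> is_basis scale B \<Longrightarrow> tr f = (\<Sum>b\<in>B. representation B (f b) b)"
  by (rule lin_trace_eq[OF fd_lie_algebra_trivial[OF vspace_axioms finite_dimensional_vector_space_axioms]])

lemma finite_is_basis: "is_basis scale B \<Longrightarrow> finite B"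
  by (simp add: finiteI_independent is_basis_def)

lemma tr_add: "lin f \<Longrightarrow> lin g \<Longrightarrow> tr (f + g) = tr f + tr g"
  by (simp add: tr_basis[OF _ is_basis_Basis] lin_plus representation_add independent_Basis
      span_Basis sum.distrib)

lemma tr_smul: "lin f \<Longrightarrow> tr (\<lambda>x. scale c (f x)) = c * tr f"
  by (simp add: tr_basis[OF _ is_basis_Basis] lin_smul representation_scale independent_Basis
      span_Basis sum_distrib_left)

lemma tr_zero: "tr 0 = 0" "tr (\<lambda>x. 0) = 0"
  using tr_smul[OF lin_0(1), of 0] by (simp_all add: zero_fun_def)

lemma tr_diff: "lin f \<Longrightarrow> lin g \<Longrightarrow> tr (f - g) = tr f - tr g"
  by (simp add: tr_basis[OF _ is_basis_Basis] lin_minus representation_diff independent_Basis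
      span_Basis sum_subtractf)

lemma tr_sum: "(\<And>i. i \<in> I \<Longrightarrow> lin (F i)) \<Longrightarrow> tr (\<lambda>x. \<Sum>i\<in>I. F i x) = (\<Sum>i\<in>I. tr (F i))"
proof (induction I rule: infinite_finite_induct)
  case (insert i I)
  have "(\<lambda>x. \<Sum>i\<in>insert i I. F i x) = F i + (\<lambda>x. \<Sum>i\<in>I. F i x)"
    using insert by (auto simp: plus_fun_def)
  then show ?case using insert by (simp add: tr_add lin_sumf)
qed (auto simp: tr_zero)

lemma tr_comm:
  assumes f: "lin f" and g: "lin g"
  shows "tr (f \<circ> g) = tr (g \<circ> f)"
proof -
  let ?r = "representation Basis"
  have expand: "?r (f (g b)) b = (\<Sum>c\<in>Basis. ?r (g b) c * ?r (f c) b)" if "lin f" for f g b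
  proof -
    have "g b = (\<Sum>c\<in>Basis. scale (?r (g b) c) c)"
      by (subst sum_representation_eq) (auto simp: independent_Basis span_Basis finite_Basis)
    then have "f (g b) = f (\<Sum>c\<in>Basis. scale (?r (g b) c) c)" by presburger
    also have "\<dots> = (\<Sum>c\<in>Basis. scale (?r (g b) c) (f c))"
      using that by (simp add: lin_sum lin_scale)
    finally show ?thesis
      by (simp add: representation_sum representation_scale independent_Basis span_Basis)
  qed
  have "tr (f \<circ> g) = (\<Sum>b\<in>Basis. \<Sum>c\<in>Basis. ?r (g b) c * ?r (f c) b)"
    by (simp add: tr_basis[OF lin_comp[OF f g] is_basis_Basis] expand[OF f])
  also have "\<dots> = (\<Sum>c\<in>Basis. \<Sum>b\<in>Basis. ?r (f c) b * ?r (g b) c)"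
    by (subst sum.swap) (simp add: mult.commute)
  also have "\<dots> = tr (g \<circ> f)"
    by (simp add: tr_basis[OF lin_comp[OF g f] is_basis_Basis] expand[OF g])
  finally show ?thesis .
qed

lemma tr_conj:
  assumes "lin f" "lin a" "lin b" "b \<circ> a = id"
  shows "tr (a \<circ> f \<circ> b) = tr f"
  using tr_comm[of "a \<circ> f" b] assms by (simp add: lin_comp o_assoc)

lemma projection_exists:
  assumes "subspace U"
  shows "\<exists>P. lin P \<and> (\<forall>x. P x \<in> U) \<and> (\<forall>x\<in>U. P x = x)"
proof -
  interpret pair: vector_space_pair scale scale by unfold_locales
  obtain B where B: "B \<subseteq> U" "independent B" "U \<subseteq> span B"
    by (rule maximal_independent_subset)
  then have U: "span B = U" by (simp add: assms span_subspace)
  obtain P where P: "lin P" "\<forall>x\<in>B. P x = id x" "range P = span (id ` B)"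
    using pair.linear_independent_extend_subspace[OF B(2)] by metis
  have "subspace {x. P x = x}"
    using P(1) by (auto simp: subspace_def lin_add lin_scale lin_zero)
  then have "span B \<subseteq> {x. P x = x}" using P(2) by (intro span_minimal) auto
  then show ?thesis using P U by (intro exI[of _ P]) auto
qed

text \<open>In a basis extending one of the range, the diagonal entries of P are 1 on the range part
  and 0 elsewhere, because P b lies in the span of the range part.\<close>

lemma tr_idempotent:
  assumes P: "lin P" "\<And>x. P (P x) = P x" and nz: "P z \<noteq> 0"
  shows "\<exists>m>0. tr P = of_nat m"
proof -
  obtain B where B: "B \<subseteq> range P" "independent B" "range P \<subseteq> span B"
    by (rule maximal_independent_subset)
  obtain C where C: "B \<subseteq> C" "independent C" "UNIV \<subseteq> span C"
    by (rule maximal_independent_subset_extend[OF subset_UNIV B(2)])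
  have basis: "is_basis scale C" using C by (auto simp: is_basis_def)
  have "representation C (P b) b = (if b \<in> B then 1 else 0)" if "b \<in> C" for b
  proof (cases "b \<in> B")
    case True
    then have "P b = b" using B(1) P(2) by force
    then show ?thesis using True that C by (simp add: representation_basis)
  next
    case False
    have "P b \<in> span B" using B by blast
    then have "representation C (P b) = representation B (P b)"
      using C by (intro representation_extend) auto
    then show ?thesis using False by (metis representation_ne_zero)
  qed
  then have "tr P = of_nat (card B)"
    using C(1) finite_is_basis[OF basis]
    by (simp add: tr_basis[OF P(1) basis] sum.If_cases Int_absorb1)
  moreover have "B \<noteq> {}"
  proof
    assume "B = {}"
    then have "P z \<in> {0}" using B(3) span_empty by blast
    then show False using nz by simp
  qed
  ultimately show ?thesis
    using finiteI_independent[OF B(2)] by (intro exI[of _ "card B"]) (simp add: card_gt_0_iff)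
qed

lemma subspace_range:
  assumes "lin f"
  shows "subspace (range f)"
proof -
  interpret f: Vector_Spaces.linear scale scale f by fact
  show ?thesis by (rule f.subspace_image) simp
qed

text \<open>a maps the range U j of its j-th power into U (j + 1). With projections Q j onto these
  ranges, cyclicity of the trace allows replacing a Q j by a Q (j + 1), until the range is
  zero.\<close>

lemma tr_nilpotent:
  assumes a: "lin a" "nilpotent a"
  shows "tr a = 0"
proof -
  obtain K where K: "\<And>x. (a ^^ K) x = 0" using a(2) by (auto simp: nilpotent_def)
  define U where "U j = range (a ^^ j)" for j
  have "subspace (U j)" for j
    unfolding U_def by (rule subspace_range[OF lin_funpow[OF a(1)]])
  then have "\<forall>j. \<exists>P. lin P \<and> (\<forall>x. P x \<in> U j) \<and> (\<forall>x\<in>U j. P x = x)"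
    using projection_exists by blast
  from choice[OF this] obtain Q where Q: "\<And>j. lin (Q j)" "\<And>j x. Q j x \<in> U j" "\<And>j x. x \<in> U j \<Longrightarrow> Q j x = x"
    by auto
  have sub: "U (Suc j) \<subseteq> U j" for j
    unfolding U_def by (auto simp: funpow_Suc_right simp del: funpow.simps)
  have "tr a = tr (a \<circ> Q j)" for j
  proof (induction j)
    case 0
    have "Q 0 = id" using Q(3)[of _ 0] by (auto simp: U_def)
    then show ?case by simp
  next
    case (Suc j)
    have "a (Q j x) \<in> U (Suc j)" for x
      using Q(2)[of j x] unfolding U_def by auto
    then have "a \<circ> Q j = Q (Suc j) \<circ> (a \<circ> Q j)" using Q(3) by (auto simp: fun_eq_iff)
    then have "tr (a \<circ> Q j) = tr ((a \<circ> Q j) \<circ> Q (Suc j))"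
      using tr_comm[of "Q (Suc j)" "a \<circ> Q j"] Q(1) a(1) by (simp add: lin_comp)
    also have "(a \<circ> Q j) \<circ> Q (Suc j) = a \<circ> Q (Suc j)"
    proof
      fix x
      have "Q (Suc j) x \<in> U j" using Q(2) sub by blast
      then show "((a \<circ> Q j) \<circ> Q (Suc j)) x = (a \<circ> Q (Suc j)) x" using Q(3) by simp
    qed
    finally show ?case using Suc by simp
  qed
  then have "tr a = tr (a \<circ> Q K)" .
  also have "a \<circ> Q K = (\<lambda>x. 0)"
    using Q(2)[of K] K a(1) by (auto simp: U_def lin_zero fun_eq_iff)
  finally show ?thesis by (simp add: tr_zero)
qed

lemma nilpotent_comp:
  assumes "lin a" "lin b" and comm: "\<And>x. a (b x) = b (a x)" and "nilpotent a"
  shows "nilpotent (a \<circ> b)"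
proof -
  have c: "b ((a ^^ k) x) = (a ^^ k) (b x)" for k x
    by (induction k) (simp_all add: comm[symmetric])
  have "((a \<circ> b) ^^ k) x = (a ^^ k) ((b ^^ k) x)" for k x
    by (induction k) (simp_all add: c)
  then show ?thesis using assms(4) by (auto simp: nilpotent_def)
qed

text \<open>The dimension of the generalized eigenspace, read off from the trace of the spectral
  projection. What matters later is that it is a positive integer.\<close>

definition alg_mult :: "('w \<Rightarrow> 'w) \<Rightarrow> complex \<Rightarrow> nat" where
  "alg_mult D c = (SOME m. m > 0 \<and> tr (spec_proj D c) = of_nat m)"

lemma alg_mult:
  assumes D: "lin D" and c: "c \<in> spectrum D"
  shows "alg_mult D c > 0 \<and> tr (spec_proj D c) = of_nat (alg_mult D c)"
proof -
  obtain x where x: "x \<in> gen_eigenspace D c" "x \<noteq> 0" using spectrumD[OF D c] by blast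
  have "\<exists>m>0. tr (spec_proj D c) = of_nat m"
  proof (rule tr_idempotent[OF lin_fcalc[OF D]])
    show "spec_proj D c (spec_proj D c y) = spec_proj D c y" for y
      using fcalc_eq[OF D spec_proj_in[OF D]] by simp
    show "spec_proj D c x \<noteq> 0" using fcalc_eq[OF D x(1)] x(2) by simp
  qed
  then show ?thesis unfolding alg_mult_def by (rule someI_ex)
qed

lemma tr_fcalc:
  assumes D: "lin D"
  shows "tr (fcalc D f) = (\<Sum>c\<in>spectrum D. f c * of_nat (alg_mult D c))"
proof -
  have "tr (fcalc D f) = tr (\<lambda>x. \<Sum>c\<in>spectrum D. scale (f c) (spec_proj D c x))"
    using fcalc_spec_proj[OF D, of f] by presburger
  also have "\<dots> = (\<Sum>c\<in>spectrum D. f c * of_nat (alg_mult D c))"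
    using D by (simp add: tr_sum lin_smul lin_fcalc tr_smul alg_mult)
  finally show ?thesis .
qed

lemma comp_minus_left: "lin a \<Longrightarrow> a \<circ> (b - c) = (a \<circ> b) - (a \<circ> c)"
  by (auto simp: fun_eq_iff lin_diff)

lemma comp_plus_left: "lin a \<Longrightarrow> a \<circ> (b + c) = (a \<circ> b) + (a \<circ> c)"
  by (auto simp: fun_eq_iff lin_add)

lemma comp_minus_right: "(b - c) \<circ> a = (b \<circ> a) - (c \<circ> a)"
  by (auto simp: fun_eq_iff)

lemma comp_plus_right: "(b + c) \<circ> a = (b \<circ> a) + (c \<circ> a)"
  by (auto simp: fun_eq_iff)

text \<open>D can be replaced by its semisimple part: the nilpotent part commutes with
  \<open>fcalc D f\<close>, so their product is nilpotent and has trace 0.\<close>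

lemma tr_comp_fcalc:
  assumes D: "lin D"
  shows "tr (D \<circ> fcalc D f) = (\<Sum>c\<in>spectrum D. c * f c * of_nat (alg_mult D c))"
proof -
  let ?F = "fcalc D f" and ?s = "ss_part D"
  note l = D lin_fcalc[OF D]
  have DF: "D (?F x) = ?F (D x)" for x using fcalc_commute[OF D D] by simp
  have sF: "?s (?F x) = ?F (?s x)" for x
    by (simp add: fcalc_mult D mult.commute)
  have "nilpotent ((D - ?s) \<circ> ?F)"
    using l by (intro nilpotent_comp nilpotent_part) (auto simp: lin_minus lin_diff DF sF)
  then have "tr ((D - ?s) \<circ> ?F) = 0"
    using l by (intro tr_nilpotent lin_comp lin_minus)
  then have "tr (D \<circ> ?F) = tr (?s \<circ> ?F)"
    using l by (simp add: comp_minus_right tr_diff lin_comp)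
  also have "?s \<circ> ?F = fcalc D (\<lambda>c. c * f c)" using fcalc_mult[OF D] by auto
  finally show ?thesis by (simp only: tr_fcalc[OF D])
qed

section \<open>Endomorphisms as a real vector space, and real functionals on it\<close>

definition rscale :: "real \<Rightarrow> ('w \<Rightarrow> 'w) \<Rightarrow> 'w \<Rightarrow> 'w" where
  "rscale r A = (\<lambda>x. scale (complex_of_real r) (A x))"

lemma rscale_apply [simp]: "rscale r A x = scale (complex_of_real r) (A x)"
  by (simp add: rscale_def)

lemma vector_space_rscale: "vector_space rscale"
  by unfold_locales (auto simp: fun_eq_iff scale_right_distrib scale_left_distrib)

lemma sum_fun_apply: "(\<Sum>i\<in>I. F i) x = (\<Sum>i\<in>I. F i x)"
  by (induction I rule: infinite_finite_induct) auto

text \<open>The matrix units and their multiples by i span all endomorphisms over the reals, which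
  bounds the independent subsets of \<open>h\<close>.\<close>

lemma finite_real_span:
  assumes "\<And>A. A \<in> h \<Longrightarrow> lin A"
  shows "\<exists>T\<subseteq>h. finite T \<and> h \<subseteq> module.span rscale T"
proof -
  interpret R: vector_space rscale by (rule vector_space_rscale)
  let ?r = "representation Basis"
  define E where "E c b b' = (\<lambda>x. scale (c * ?r x b) b')" for c b b'
  let ?S = "(\<lambda>(c, b, b'). E c b b') ` ({1, \<i>} \<times> Basis \<times> Basis)"
  have "A \<in> R.span ?S" if "lin A" for A
  proof -
    have key: "scale (u * z) y = scale (complex_of_real (Re z)) (scale (1 * u) y)
        + scale (complex_of_real (Im z)) (scale (\<i> * u) y)" for u z y
    proof -
      have "u * z = complex_of_real (Re z) * (1 * u) + complex_of_real (Im z) * (\<i> * u)"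
        by (simp add: complex_eq_iff)
      then show ?thesis by (simp only: scale_scale scale_left_distrib)
    qed
    have eq: "A = (\<Sum>b\<in>Basis. \<Sum>b'\<in>Basis.
        rscale (Re (?r (A b) b')) (E 1 b b') + rscale (Im (?r (A b) b')) (E \<i> b b'))"
    proof
      fix x
      have ex: "y = (\<Sum>b\<in>Basis. scale (?r y b) b)" for y
        by (subst sum_representation_eq) (auto simp: independent_Basis span_Basis finite_Basis)
      have "A x = A (\<Sum>b\<in>Basis. scale (?r x b) b)" using ex[of x] by presburger
      also have "\<dots> = (\<Sum>b\<in>Basis. scale (?r x b) (A b))"
        using that by (simp add: lin_sum lin_scale)
      also have "\<dots> = (\<Sum>b\<in>Basis. \<Sum>b'\<in>Basis. scale (?r x b * ?r (A b) b') b')"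
      proof (rule sum.cong[OF refl])
        fix b
        have "scale (?r x b) (A b) = scale (?r x b) (\<Sum>b'\<in>Basis. scale (?r (A b) b') b')"
          using ex[of "A b"] by presburger
        then show "scale (?r x b) (A b) = (\<Sum>b'\<in>Basis. scale (?r x b * ?r (A b) b') b')"
          by (simp add: scale_sum_right)
      qed
      also have "\<dots> = (\<Sum>b\<in>Basis. \<Sum>b'\<in>Basis.
        rscale (Re (?r (A b) b')) (E 1 b b') + rscale (Im (?r (A b) b')) (E \<i> b b')) x"
        unfolding sum_fun_apply plus_fun_apply rscale_apply E_def by (rule sum.cong[OF refl], rule sum.cong[OF refl], rule key)
      finally show "A x = (\<Sum>b\<in>Basis. \<Sum>b'\<in>Basis.
        rscale (Re (?r (A b) b')) (E 1 b b') + rscale (Im (?r (A b) b')) (E \<i> b b')) x" .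
    qed
    have mem: "(\<Sum>b\<in>Basis. \<Sum>b'\<in>Basis.
        rscale (Re (?r (A b) b')) (E 1 b b') + rscale (Im (?r (A b) b')) (E \<i> b b')) \<in> R.span ?S"
    proof (intro R.span_sum R.span_add)
      fix b b' assume "b \<in> Basis" "b' \<in> Basis"
      then have m: "E 1 b b' \<in> ?S" "E \<i> b b' \<in> ?S"
        by (auto intro: image_eqI[of _ _ "(1, b, b')"] image_eqI[of _ _ "(\<i>, b, b')"])
      show "rscale (Re (?r (A b) b')) (E 1 b b') \<in> R.span ?S"
        by (rule R.span_scale[OF R.span_base[OF m(1)]])
      show "rscale (Im (?r (A b) b')) (E \<i> b b') \<in> R.span ?S"
        by (rule R.span_scale[OF R.span_base[OF m(2)]])
    qed
    show ?thesis by (subst eq) (rule mem)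
  qed
  then have sub: "h \<subseteq> R.span ?S" using assms by blast
  obtain T where T: "T \<subseteq> h" "R.independent T" "h \<subseteq> R.span T"
    by (rule R.maximal_independent_subset)
  have "finite T"
    using R.independent_span_bound[of ?S T] T sub finite_Basis by blast
  then show ?thesis using T by blast
qed

end

text \<open>Induction on F: either l j is nonzero at some z in the common kernel of the others, and
  subtracting m z * l j reduces to them, or l j contributes nothing new. Linearity is required on
  the set X only, since the trace is additive only on linear maps.\<close>

lemma functional_in_span:
  fixes l :: "'i \<Rightarrow> 'x::ab_group_add \<Rightarrow> real" and sc :: "real \<Rightarrow> 'x \<Rightarrow> 'x"
  assumes "finite F"
    and X: "\<And>x y. x \<in> X \<Longrightarrow> y \<in> X \<Longrightarrow> x - y \<in> X" "\<And>c x. x \<in> X \<Longrightarrow> sc c x \<in> X"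
    and l: "\<And>i x y. x \<in> X \<Longrightarrow> y \<in> X \<Longrightarrow> l i (x - y) = l i x - l i y"
      "\<And>i c x. x \<in> X \<Longrightarrow> l i (sc c x) = c * l i x"
    and m: "\<And>x y. x \<in> X \<Longrightarrow> y \<in> X \<Longrightarrow> m (x - y) = m x - m y"
      "\<And>c x. x \<in> X \<Longrightarrow> m (sc c x) = c * m x"
    and ker: "\<And>x. x \<in> X \<Longrightarrow> (\<And>i. i \<in> F \<Longrightarrow> l i x = 0) \<Longrightarrow> m x = (0::real)"
  shows "\<exists>c. \<forall>x\<in>X. m x = (\<Sum>i\<in>F. c i * l i x)"
  using assms(1) m ker
proof (induction F arbitrary: m)
  case empty
  then show ?case by auto
next
  case (insert j F)
  show ?case
  proof (cases "\<exists>z\<in>X. (\<forall>i\<in>F. l i z = 0) \<and> l j z \<noteq> 0")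
    case True
    then obtain z0 where z0: "z0 \<in> X" "\<And>i. i \<in> F \<Longrightarrow> l i z0 = 0" "l j z0 \<noteq> 0" by blast
    define z where "z = sc (1 / l j z0) z0"
    have z: "z \<in> X" "\<And>i. i \<in> F \<Longrightarrow> l i z = 0" "l j z = 1"
      using z0 X(2) l(2) by (simp_all add: z_def)
    define m' where "m' x = m x - m z * l j x" for x
    have "\<exists>c. \<forall>x\<in>X. m' x = (\<Sum>i\<in>F. c i * l i x)"
    proof (rule insert.IH)
      fix x assume x: "x \<in> X" "\<And>i. i \<in> F \<Longrightarrow> l i x = 0"
      let ?y = "x - sc (l j x) z"
      have "?y \<in> X" using X x z by blast
      moreover have "l i ?y = 0" if "i \<in> insert j F" for i
        using that x z X(2) l by auto
      ultimately have "m ?y = 0" using insert.prems(3) by blast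
      then show "m' x = 0" using x z X(2) insert.prems(1,2) by (simp add: m'_def)
    qed (use insert.prems(1,2) l in \<open>simp_all add: m'_def right_diff_distrib\<close>)
    then obtain c where c: "\<And>x. x \<in> X \<Longrightarrow> m' x = (\<Sum>i\<in>F. c i * l i x)" by blast
    have "m x = (\<Sum>i\<in>insert j F. (if i = j then m z else c i) * l i x)" if "x \<in> X" for x
    proof -
      have "(\<Sum>i\<in>F. (if i = j then m z else c i) * l i x) = (\<Sum>i\<in>F. c i * l i x)"
        using insert.hyps by (intro sum.cong) auto
      then show ?thesis using c[OF that] insert.hyps by (simp add: m'_def)
    qed
    then show ?thesis by (intro exI[of _ "\<lambda>i. if i = j then m z else c i"]) blast
  next
    case False
    then have "\<exists>c. \<forall>x\<in>X. m x = (\<Sum>i\<in>F. c i * l i x)"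
    proof (intro insert.IH insert.prems(1,2))
      fix x assume "x \<in> X" "\<And>i. i \<in> F \<Longrightarrow> l i x = 0"
      then show "m x = 0" using False insert.prems(3)[of x] by auto
    qed
    then obtain c where c: "\<And>x. x \<in> X \<Longrightarrow> m x = (\<Sum>i\<in>F. c i * l i x)" by blast
    have "m x = (\<Sum>i\<in>insert j F. (if i = j then 0 else c i) * l i x)" if "x \<in> X" for x
    proof -
      have "(\<Sum>i\<in>F. (if i = j then 0 else c i) * l i x) = (\<Sum>i\<in>F. c i * l i x)"
        using insert.hyps by (intro sum.cong) auto
      then show ?thesis using c[OF that] insert.hyps by simp
    qed
    then show ?thesis by (intro exI[of _ "\<lambda>i. if i = j then 0 else c i"]) blast
  qed
qed

section \<open>Rational-valued functionals on the reals over the rationals\<close>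

definition rat_functional :: "(real \<Rightarrow> real) \<Rightarrow> bool" where
  "rat_functional \<phi> \<longleftrightarrow> (\<forall>x y. \<phi> (x + y) = \<phi> x + \<phi> y) \<and>
     (\<forall>q x. q \<in> \<rat> \<longrightarrow> \<phi> (q * x) = q * \<phi> x) \<and> (\<forall>x. \<phi> x \<in> \<rat>)"

text \<open>The reals are a vector space over the rationals, so values can be prescribed on any
  independent set.\<close>

lemma rat_functional_extend:
  fixes B :: "real set"
  assumes "module.independent (\<lambda>q x. of_rat q * x) B"
  shows "\<exists>\<phi>. rat_functional \<phi> \<and> (\<forall>x\<in>B. \<phi> x = of_rat (f x))"
proof -
  interpret p: vector_space_pair "\<lambda>q x. of_rat q * x :: real" "(*) :: rat \<Rightarrow> rat \<Rightarrow> rat"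
    by unfold_locales (auto simp: algebra_simps of_rat_add of_rat_mult)
  obtain g where g: "Vector_Spaces.linear (\<lambda>q x. of_rat q * x :: real) (*) g" "\<forall>x\<in>B. g x = f x"
    using p.linear_independent_extend[OF assms] by blast
  then interpret g: Vector_Spaces.linear "\<lambda>q x. of_rat q * x :: real" "(*)" g by simp
  show ?thesis
    using g(2) g.add g.scale
    by (intro exI[of _ "\<lambda>x. of_rat (g x)"])
      (auto simp: rat_functional_def of_rat_add of_rat_mult elim!: Rats_cases)
qed

lemma vector_space_rat: "vector_space (\<lambda>q x. of_rat q * x :: real)"
  by unfold_locales (auto simp: algebra_simps of_rat_add of_rat_mult)

lemma rat_functional_nonzero:
  assumes "a \<noteq> 0"
  shows "\<exists>\<phi>. rat_functional \<phi> \<and> \<phi> a = 1"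
proof -
  interpret vector_space "\<lambda>q x. of_rat q * x :: real" by (rule vector_space_rat)
  have "independent {a}" using assms by simp
  then show ?thesis using rat_functional_extend[of "{a}" "\<lambda>_. 1"] by auto
qed

text \<open>An irrational a is independent of 1 over the rationals. Such a functional vanishes on
  all rationals but sees a, and so detects irrational eigenvalues.\<close>

lemma rat_functional_irrational:
  assumes "a \<notin> \<rat>"
  shows "\<exists>\<phi>. rat_functional \<phi> \<and> \<phi> 1 = 0 \<and> \<phi> a = 1"
proof -
  interpret vector_space "\<lambda>q x. of_rat q * x :: real" by (rule vector_space_rat)
  have "a \<notin> span {1}" using assms by (auto simp: span_singleton)
  then have "independent {a, 1}" by (intro independent_insertI) (auto simp: independent_empty)
  moreover have "a \<noteq> 1" using assms by auto
  ultimately show ?thesis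
    using rat_functional_extend[of "{a, 1}" "\<lambda>x. if x = a then 1 else 0"] by auto
qed

lemma rat_functional_sum:
  assumes "rat_functional \<phi>"
  shows "\<phi> (\<Sum>i\<in>I. of_nat (m i) * a i * \<phi> (a i)) = (\<Sum>i\<in>I. of_nat (m i) * (\<phi> (a i))\<^sup>2)"
proof -
  have 0: "\<phi> 0 = 0" using assms by (metis add_cancel_right_left rat_functional_def)
  have "\<phi> (of_nat (m i) * a i * \<phi> (a i)) = of_nat (m i) * (\<phi> (a i))\<^sup>2" for i
  proof -
    have "of_nat (m i) * \<phi> (a i) \<in> \<rat>" using assms by (auto simp: rat_functional_def)
    then have "\<phi> ((of_nat (m i) * \<phi> (a i)) * a i) = (of_nat (m i) * \<phi> (a i)) * \<phi> (a i)"
      using assms unfolding rat_functional_def by blast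
    then show ?thesis by (simp add: ac_simps power2_eq_square)
  qed
  then show ?thesis
    using assms 0 by (induction I rule: infinite_finite_induct) (auto simp: rat_functional_def)
qed

text \<open>For \<open>\<phi>\<close> with rational values, applying \<open>\<phi>\<close> to the number \<open>\<Sum>m\<^sub>i a\<^sub>i \<phi>(a\<^sub>i)\<close> gives the positive
  definite expression \<open>\<Sum>m\<^sub>i \<phi>(a\<^sub>i)\<^sup>2\<close>.\<close>

lemma rat_functional_vanish:
  assumes "finite I" "\<And>i. i \<in> I \<Longrightarrow> m i > 0" and \<phi>: "rat_functional \<phi>"
    and "\<phi> (\<Sum>i\<in>I. of_nat (m i) * a i * \<phi> (a i)) = 0" "i \<in> I"
  shows "\<phi> (a i) = 0"
proof -
  have "(\<Sum>i\<in>I. of_nat (m i) * (\<phi> (a i))\<^sup>2) = 0" using assms(4) rat_functional_sum[OF \<phi>, of m a I] by simp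
  then have "of_nat (m i) * (\<phi> (a i))\<^sup>2 = 0"
    using assms(1,5) by (subst (asm) sum_nonneg_eq_0_iff) auto
  then show ?thesis using assms(2)[OF assms(5)] by simp
qed

section \<open>Flags, commutators and Engel's theorem\<close>

definition comm :: "('a \<Rightarrow> 'a) \<Rightarrow> ('a \<Rightarrow> 'a) \<Rightarrow> 'a \<Rightarrow> 'a::ab_group_add" where
  "comm a b = (\<lambda>x. a (b x) - b (a x))"

lemma comm_apply: "comm a b x = a (b x) - b (a x)"
  by (simp add: comm_def)

lemma comm_self [simp]: "comm a a = 0"
  by (auto simp: comm_apply)

lemma uminus_comm: "- comm a b = comm b a"
  by (auto simp: comm_apply fun_eq_iff)

context complex_endo
begin

lemma lin_comm: "lin a \<Longrightarrow> lin b \<Longrightarrow> lin (comm a b)"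
  using lin_minus[OF lin_comp[of a b] lin_comp[of b a]]
  by (simp add: comm_def comp_def fun_diff_def)

text \<open>The j-th term consists of the vectors killed by all products of j elements of s.\<close>

primrec flag :: "('w \<Rightarrow> 'w) set \<Rightarrow> nat \<Rightarrow> 'w set" where
  "flag s 0 = {0}"
| "flag s (Suc j) = {x. \<forall>a\<in>s. a x \<in> flag s j}"

lemma subspace_flag:
  assumes "\<forall>a\<in>s. lin a"
  shows "subspace (flag s j)"
proof (induction j)
  case (Suc j)
  have "flag s (Suc j) = \<Inter> ((\<lambda>a. {x. a x \<in> flag s j}) ` s)" by auto
  also have "subspace \<dots>" using Suc assms by (intro subspace_Int subspace_preimage) auto
  finally show ?case .
qed simp

lemma flag_Suc_mono:
  assumes "\<forall>a\<in>s. lin a"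
  shows "flag s j \<subseteq> flag s (Suc j)"
  by (induction j) (auto simp: lin_zero assms)

lemma flag_mono: "(\<forall>a\<in>s. lin a) \<Longrightarrow> i \<le> j \<Longrightarrow> flag s i \<subseteq> flag s j"
  by (rule lift_Suc_mono_le[of "flag s"]) (use flag_Suc_mono in auto)

lemma flag_lower': "(\<forall>a\<in>s. lin a) \<Longrightarrow> a \<in> s \<Longrightarrow> x \<in> flag s j \<Longrightarrow> a x \<in> flag s (j - 1)"
  by (cases j) (auto simp: lin_zero)

text \<open>a (b x) = b (a x) + [a, b] x, and both terms on the right lie in the previous term of
  the flag.\<close>

lemma flag_stable:
  assumes "\<forall>a\<in>s. lin a" "lin b" "\<forall>a\<in>s. comm a b \<in> s"
  shows "x \<in> flag s j \<Longrightarrow> b x \<in> flag s j"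
proof (induction j arbitrary: x)
  case (Suc j)
  have "a (b x) \<in> flag s j" if a: "a \<in> s" for a
  proof -
    have "b (a x) \<in> flag s j" using Suc a by simp
    moreover have "comm a b x \<in> flag s j" using Suc.prems assms(3) a by simp
    ultimately have "b (a x) + comm a b x \<in> flag s j"
      by (rule subspace_add[OF subspace_flag[OF assms(1)]])
    then show ?thesis by (simp add: comm_apply)
  qed
  then show ?case by simp
qed (use assms(2) in \<open>simp add: lin_zero\<close>)

text \<open>The conclusion of Engel's theorem for every nonzero quotient by a stable subspace U,
  phrased without quotients: some nonzero class modulo U is killed by s.\<close>

definition engel_set :: "('w \<Rightarrow> 'w) set \<Rightarrow> bool" where
  "engel_set s \<longleftrightarrow> (\<forall>U. subspace U \<longrightarrow> U \<noteq> UNIV \<longrightarrow> (\<forall>a\<in>s. \<forall>x\<in>U. a x \<in> U) \<longrightarrow>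
     (\<exists>x. x \<notin> U \<and> (\<forall>a\<in>s. a x \<in> U)))"

lemma engel_set_flag:
  assumes lin: "\<forall>a\<in>s. lin a" and "engel_set s"
  shows "\<exists>d. flag s d = UNIV"
proof (rule ccontr)
  assume no: "\<not> ?thesis"
  have "j \<le> dim (flag s j)" for j
  proof (induction j)
    case (Suc j)
    have st: "\<forall>a\<in>s. \<forall>x\<in>flag s j. a x \<in> flag s j"
      using flag_lower'[OF lin] flag_mono[OF lin, of "j - 1" j] by (metis diff_le_self subsetD)
    have "flag s j \<noteq> UNIV" using no by blast
    with assms(2) subspace_flag[OF lin] st
    obtain x where x: "x \<notin> flag s j" "\<forall>a\<in>s. a x \<in> flag s j"
      unfolding engel_set_def by (elim allE[of _ "flag s j"]) auto
    then have "flag s j \<subset> flag s (Suc j)" using flag_Suc_mono[OF lin, of j] by auto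
    moreover have "span (flag s i) = flag s i" for i
      using subspace_flag[OF lin, of i] unfolding span_eq_iff .
    ultimately have "dim (flag s j) < dim (flag s (Suc j))" by (intro dim_psubset) (simp only:)
    then show ?case using Suc by simp
  qed simp
  then have "Suc dimension \<le> dim (flag s (Suc dimension))" .
  also have "\<dots> \<le> dimension" by (rule dim_subset_UNIV)
  finally show False by simp
qed

text \<open>Bracketing with an element of s lowers the degree of w by one more step. The subtraction
  is truncated at 0, where the flag is \<open>{0}\<close>.\<close>

lemma comm_lowers_flag:
  assumes lin: "\<forall>a\<in>s. lin a" and a: "a \<in> s"
    and w: "lin w" "\<forall>i. \<forall>x\<in>flag s i. w x \<in> flag s (i + d - k)"
    and x: "x \<in> flag s i"
  shows "comm a w x \<in> flag s (i + d - Suc k)"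
proof -
  have "a (w x) \<in> flag s (i + d - k - 1)" using flag_lower'[OF lin a] w(2) x by blast
  moreover have "w (a x) \<in> flag s (i + d - Suc k)"
  proof (cases i)
    case 0
    then show ?thesis using x lin a w(1) subspace_0[OF subspace_flag[OF lin]] by (simp add: lin_zero)
  next
    case (Suc i')
    then have "a x \<in> flag s i'" using x a by simp
    then have "w (a x) \<in> flag s (i' + d - k)" using w(2) by blast
    then show ?thesis using Suc by simp
  qed
  ultimately show ?thesis
    by (simp add: comm_apply subspace_diff[OF subspace_flag[OF lin]])
qed

text \<open>The vectors sent into U by M form a w-stable space because w normalizes M. Starting from
  one of them outside U, the last iterate under w that is still outside U is sent into U by w as
  well.\<close>

lemma engel_set_insert:
  assumes M: "\<forall>a\<in>M. lin a" "engel_set M"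
    and w: "lin w" "nilpotent w" "\<forall>a\<in>M. comm a w \<in> M"
  shows "engel_set (M \<union> {w, - w})"
  unfolding engel_set_def
proof (intro allI impI)
  fix U assume U: "subspace U" "U \<noteq> UNIV" "\<forall>a\<in>M \<union> {w, - w}. \<forall>x\<in>U. a x \<in> U"
  let ?X = "{x. \<forall>a\<in>M. a x \<in> U}"
  obtain x where x: "x \<notin> U" "x \<in> ?X" using M(2) U unfolding engel_set_def by blast
  obtain K where K: "(w ^^ K) x = 0" using w(2) by (auto simp: nilpotent_def)
  have X: "(w ^^ j) x \<in> ?X" for j
  proof (induction j)
    case (Suc j)
    let ?y = "(w ^^ j) x"
    have "a (w ?y) \<in> U" if a: "a \<in> M" for a
    proof -
      have "w (a ?y) + comm a w ?y \<in> U"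
        using Suc a U(3) w(3) by (intro subspace_add[OF U(1)]) auto
      then show ?thesis by (simp add: comm_apply)
    qed
    then show ?case by simp
  qed (use x in simp)
  define k where "k = (LEAST k. (w ^^ k) x \<in> U)"
  have k: "(w ^^ k) x \<in> U"
    unfolding k_def by (rule LeastI[of _ K]) (simp add: K subspace_0[OF U(1)])
  then obtain j where j: "k = Suc j" using x by (cases k) auto
  have "(w ^^ j) x \<notin> U" using not_less_Least[of j "\<lambda>k. (w ^^ k) x \<in> U"] j by (simp add: k_def)
  moreover have "w ((w ^^ j) x) \<in> U" using k j by simp
  ultimately show "\<exists>x. x \<notin> U \<and> (\<forall>a\<in>M \<union> {w, - w}. a x \<in> U)"
    using X[of j] U(1) by (intro exI[of _ "(w ^^ j) x"]) (auto simp: subspace_neg)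
qed

text \<open>The spaces \<open>X s\<close> of vectors sent into U shrink along the chain, so one of
  smallest dimension is contained in all of them.\<close>

lemma engel_set_chain:
  assumes "C \<noteq> {}" and chain: "\<And>s t. s \<in> C \<Longrightarrow> t \<in> C \<Longrightarrow> s \<subseteq> t \<or> t \<subseteq> s"
    and C: "\<forall>s\<in>C. \<forall>a\<in>s. lin a" "\<forall>s\<in>C. engel_set s"
  shows "engel_set (\<Union>C)"
  unfolding engel_set_def
proof (intro allI impI)
  fix U assume U: "subspace U" "U \<noteq> UNIV" "\<forall>a\<in>\<Union>C. \<forall>x\<in>U. a x \<in> U"
  define X where "X s = {x. \<forall>a\<in>s. a x \<in> U}" for s :: "('w \<Rightarrow> 'w) set"
  have sub: "subspace (X s)" if "s \<in> C" for s
  proof -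
    have "X s = \<Inter> ((\<lambda>a. {x. a x \<in> U}) ` s)" by (auto simp: X_def)
    also have "subspace \<dots>" using C(1) that U(1) by (intro subspace_Int subspace_preimage) auto
    finally show ?thesis .
  qed
  obtain s where s: "s \<in> C" "\<And>t. t \<in> C \<Longrightarrow> dim (X s) \<le> dim (X t)"
    using ex_has_least_nat[of "\<lambda>s. s \<in> C" _ "\<lambda>s. dim (X s)"] assms(1) by blast
  obtain x where x: "x \<notin> U" "x \<in> X s"
    using C(2) U s(1) unfolding engel_set_def X_def by blast
  have "x \<in> X t" if t: "t \<in> C" for t
  proof -
    consider "t \<subseteq> s" | "s \<subseteq> t" using chain s(1) t by blast
    then show ?thesis
    proof cases
      case 1
      then show ?thesis using x by (auto simp: X_def)
    next
      case 2
      then have "X t \<subseteq> X s" by (auto simp: X_def)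
      then have "X t = X s" using subspace_dim_equal[OF sub[OF t] sub[OF s(1)]] s(2)[OF t] by blast
      then show ?thesis using x by simp
    qed
  qed
  then show "\<exists>x. x \<notin> U \<and> (\<forall>a\<in>\<Union>C. a x \<in> U)" using x by (auto simp: X_def)
qed

text \<open>Jacobson's form of Engel's theorem: a maximal engel subset \<open>M\<close> acts nilpotently by commutators,
  so if it were proper it could be enlarged by an element normalizing it.\<close>

theorem engel:
  assumes r: "\<And>a. a \<in> r \<Longrightarrow> lin a" "\<And>a. a \<in> r \<Longrightarrow> nilpotent a"
    "\<And>a b. a \<in> r \<Longrightarrow> b \<in> r \<Longrightarrow> comm a b \<in> r" "\<And>a. a \<in> r \<Longrightarrow> - a \<in> r" "0 \<in> r"
  shows "\<exists>d. flag r d = UNIV"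
proof -
  define \<A> where "\<A> = {s. s \<subseteq> r \<and> 0 \<in> s \<and> (\<forall>a\<in>s. - a \<in> s) \<and> (\<forall>a\<in>s. \<forall>b\<in>s. comm a b \<in> s) \<and> engel_set s}"
  have "{0} \<in> \<A>"
    using r(5) by (auto simp: \<A>_def engel_set_def subspace_0)
  moreover have "\<Union>C \<in> \<A>" if C: "C \<noteq> {}" "subset.chain \<A> C" for C
  proof -
    have sub: "C \<subseteq> \<A>" and ch: "\<And>s t. s \<in> C \<Longrightarrow> t \<in> C \<Longrightarrow> s \<subseteq> t \<or> t \<subseteq> s"
      using C(2) by (auto simp: subset_chain_def)
    have "engel_set (\<Union>C)"
    proof (rule engel_set_chain[OF C(1) ch])
      show "\<forall>s\<in>C. \<forall>a\<in>s. lin a" using sub r(1) unfolding \<A>_def by blast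
      show "\<forall>s\<in>C. engel_set s" using sub unfolding \<A>_def by blast
    qed
    moreover have "comm a b \<in> \<Union>C" if ab: "a \<in> \<Union>C" "b \<in> \<Union>C" for a b
    proof -
      obtain s t where st: "s \<in> C" "t \<in> C" "a \<in> s" "b \<in> t" using ab by auto
      then have "s \<union> t \<in> C" using ch[of s t] by (auto simp: sup.absorb1 sup.absorb2)
      moreover have "comm a b \<in> s \<union> t"
        using calculation sub st by (auto simp: \<A>_def)
      ultimately show ?thesis by blast
    qed
    ultimately show ?thesis using sub C(1) unfolding \<A>_def by blast
  qed
  ultimately obtain M where M: "M \<in> \<A>" and max: "\<And>X. X \<in> \<A> \<Longrightarrow> M \<subseteq> X \<Longrightarrow> X = M"
    using subset_Zorn_nonempty[of \<A>] by blast
  have Mlin: "\<forall>a\<in>M. lin a" and Me: "engel_set M" and Mr: "M \<subseteq> r" and M0: "0 \<in> M"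
    and Mn: "\<And>a. a \<in> M \<Longrightarrow> - a \<in> M" and Mc: "\<And>a b. a \<in> M \<Longrightarrow> b \<in> M \<Longrightarrow> comm a b \<in> M"
    using M r(1) by (auto simp: \<A>_def)
  obtain d where d: "flag M d = UNIV" using engel_set_flag[OF Mlin Me] by blast
  have "M = r"
  proof (rule ccontr)
    assume "M \<noteq> r"
    have "\<exists>w\<in>r - M. \<forall>a\<in>M. comm a w \<in> M"
    proof (rule ccontr)
      assume no: "\<not> ?thesis"
      \<comment> \<open>If every w outside M can be bracketed with M to something outside M again,
        repeating this gives elements outside M that lower the flag of M arbitrarily far.\<close>
      have "\<exists>w\<in>r - M. \<forall>i. \<forall>x\<in>flag M i. w x \<in> flag M (i + d - k)" for k
      proof (induction k)
        case 0
        have "flag M (i + d) = UNIV" for i using flag_mono[OF Mlin, of d "i + d"] d by auto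
        then show ?case using \<open>M \<noteq> r\<close> Mr by auto
      next
        case (Suc k)
        then obtain w where w: "w \<in> r" "w \<notin> M" "\<forall>i. \<forall>x\<in>flag M i. w x \<in> flag M (i + d - k)" by blast
        then obtain a where a: "a \<in> M" "comm a w \<notin> M" using no by blast
        have "comm a w \<in> r - M" using a w(1) r(3) Mr by blast
        moreover have "\<forall>i. \<forall>x\<in>flag M i. comm a w x \<in> flag M (i + d - Suc k)"
          using comm_lowers_flag[OF Mlin a(1) r(1)[OF w(1)] w(3)] by blast
        ultimately show ?case by blast
      qed
      \<comment> \<open>Every x lies in the term of index d, and d + d - 2 * d = 0, so w vanishes
        although 0 belongs to M.\<close>
      from this[of "2 * d"] obtain w where w: "w \<notin> M" "\<forall>i. \<forall>x\<in>flag M i. w x \<in> flag M (i + d - 2 * d)"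
        by blast
      have "w x = 0" for x using w(2)[rule_format, of x d] d by simp
      then have "w = 0" by (simp add: fun_eq_iff)
      then show False using w(1) M0 by simp
    qed
    then obtain w where w: "w \<in> r" "w \<notin> M" "\<forall>a\<in>M. comm a w \<in> M" by blast
    have lw: "lin w" using r(1) w(1) .
    have cn: "comm a (- w) = - comm a w" "comm (- w) a = comm a w" "comm w a = - comm a w" if "lin a" for a
      using that by (auto simp: comm_apply fun_eq_iff lin_neg)
    have c0: "comm w (- w) = 0" "comm (- w) w = 0" "comm (- w) (- w) = 0"
      using lw by (auto simp: comm_apply fun_eq_iff lin_neg)
    \<comment> \<open>The negative of w is added too because members of \<A> are closed under
      negation; this also covers comm w a = - comm a w.\<close>
    have "M \<union> {w, - w} \<in> \<A>"
      unfolding \<A>_def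
    proof (intro CollectI conjI ballI)
      show "engel_set (M \<union> {w, - w})"
        by (rule engel_set_insert[OF Mlin Me lw r(2)[OF w(1)] w(3)])
      fix a b assume "a \<in> M \<union> {w, - w}" "b \<in> M \<union> {w, - w}"
      then show "comm a b \<in> M \<union> {w, - w}"
        using Mc w(3) Mn cn Mlin c0 M0 by auto
    qed (use Mr w(1) r(4) M0 Mn in auto)
    from max[OF this] show False using w(2) by blast
  qed
  then show ?thesis using d by blast
qed

section \<open>Splitting off the commutant of a diagonalizable endomorphism\<close>

text \<open>\<open>comm T\<close> multiplies the block of D from the d-eigenspace to the
  c-eigenspace of T by c - d. The blocks with c \<noteq> d are removed one value of c - d at a time
  by adding elements \<open>comm T E\<close>; what remains commutes with T.\<close>

lemma ad_decomposition:
  assumes T: "lin T" "is_diagonalizable scale T"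
    and M: "\<And>A. A \<in> M \<Longrightarrow> lin A" "\<And>A B. A \<in> M \<Longrightarrow> B \<in> M \<Longrightarrow> A + B \<in> M"
      "\<And>c A. A \<in> M \<Longrightarrow> rscale c A \<in> M" "\<And>A. A \<in> M \<Longrightarrow> comm T A \<in> M"
    and D: "D \<in> M"
  shows "\<exists>A\<in>M. \<exists>E\<in>M. D = A + comm T E \<and> comm T A = 0"
proof -
  let ?P = "spec_proj T"
  have TP: "T (?P c x) = scale c (?P c x)" for c x
    using diagonalizable_eigenspace[OF T] spec_proj_in[OF T(1)] by blast
  have PT: "?P c (T x) = scale c (?P c x)" for c x
    using fcalc_commute[OF T(1) T(1) refl] TP by metis
  have PcommP: "?P c (comm T A (?P d x)) = scale (c - d) (?P c (A (?P d x)))" if "lin A" for c d A x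
    using that T(1) by (simp add: comm_apply lin_diff[OF lin_fcalc] TP lin_scale PT
        lin_scale[OF lin_fcalc] scale_left_diff_distrib)
  have step: "\<exists>E\<in>M. \<forall>c d x. c - d \<in> F \<longrightarrow> ?P c ((D + comm T E) (?P d x)) = 0"
    if "finite F" "0 \<notin> F" for F
    using that
  proof (induction F)
    case empty
    show ?case using M(3)[OF D] by auto
  next
    case (insert a F)
    then obtain E where E: "E \<in> M" "\<And>c d x. c - d \<in> F \<Longrightarrow> ?P c ((D + comm T E) (?P d x)) = 0" by auto
    let ?Y = "D + comm T E"
    have Y: "?Y \<in> M" by (intro M(2,4) D E(1))
    \<comment> \<open>1 + u z + v z^2 = (z - a)(z - cnj a) / |a|^2. It vanishes at a, has real
      coefficients since M is only a real space, and has constant term 1, so applying it at z =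
      \<open>comm T\<close> changes \<open>?Y\<close> only by values of
      \<open>comm T\<close>.\<close>
    define u v where "u = - (2 * Re a / (cmod a)\<^sup>2)" and "v = 1 / (cmod a)\<^sup>2"
    define E' where "E' = E + (rscale u ?Y + rscale v (comm T ?Y))"
    have E': "E' \<in> M" unfolding E'_def by (intro M(2-4) Y E(1))
    have lY: "lin ?Y" "lin E" "lin (comm T ?Y)" using Y E(1) M(1,4) by simp_all
    have eq: "(D + comm T E') x = ?Y x + (scale (complex_of_real u) (comm T ?Y x)
        + scale (complex_of_real v) (comm T (comm T ?Y) x))" for x
    proof -
      have "comm T (A + (rscale u B + rscale v C)) x = comm T A x +
        (scale (complex_of_real u) (comm T B x) + scale (complex_of_real v) (comm T C x))" for A B C
        using T(1) by (simp add: comm_apply lin_add lin_scale scale_right_diff_distrib)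
      from this[of E ?Y "comm T ?Y"] show ?thesis by (simp only: E'_def plus_fun_apply add.assoc)
    qed
    have "?P c ((D + comm T E') (?P d x)) = 0" if cd: "c - d \<in> insert a F" for c d x
    proof -
      let ?z = "c - d"
      have "?P c ((D + comm T E') (?P d x)) =
          scale (1 + complex_of_real u * ?z + complex_of_real v * ?z * ?z) (?P c (?Y (?P d x)))"
        unfolding eq using lY T(1)
        by (simp only: lin_add[OF lin_fcalc[OF T(1)]] lin_scale[OF lin_fcalc[OF T(1)]] PcommP
            scale_left_distrib scale_scale scale_one mult.assoc add.assoc)
      also have "\<dots> = 0"
      proof (cases "?z = a")
        case True
        have a0: "a \<noteq> 0" using insert.prems by auto
        have n: "complex_of_real ((cmod a)\<^sup>2) = a * cnj a" by (rule complex_norm_square)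
        have "complex_of_real (2 * Re a) = a + cnj a" by (simp add: complex_add_cnj)
        then have "1 + complex_of_real u * a + complex_of_real v * a * a = 0"
          unfolding u_def v_def of_real_minus of_real_divide n of_real_1 using a0 by (simp add: field_simps)
        then show ?thesis using True by simp
      next
        case False
        then show ?thesis using cd E(2) by simp
      qed
      finally show ?thesis .
    qed
    then show ?case using E' by blast
  qed
  \<comment> \<open>The difference 0 is left out: the diagonal blocks form the part commuting with
    T.\<close>
  let ?F = "(\<lambda>(c, d). c - d) ` (spectrum T \<times> spectrum T) - {0}"
  have "finite ?F" using finite_spectrum[OF T(1)] by blast
  then obtain E where E: "E \<in> M" "\<And>c d x. c - d \<in> ?F \<Longrightarrow> ?P c ((D + comm T E) (?P d x)) = 0"
    using step[of ?F] by auto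
  define A where "A = D + comm T E"
  have A: "A \<in> M" unfolding A_def by (intro M(2,4) D E(1))
  have "T \<circ> A = A \<circ> T"
  proof (rule gen_eigenspaces_ext[OF T(1)])
    fix d x assume x: "x \<in> gen_eigenspace T d"
    have Px: "?P d x = x" using fcalc_eq[OF T(1) x] by simp
    have Tx: "T x = scale d x" using x diagonalizable_eigenspace[OF T] by blast
    have "?P c (A x) = 0" if c: "c \<in> spectrum T" "c \<noteq> d" for c
    proof (cases "x = 0")
      case True
      then show ?thesis using lin_zero[OF M(1)[OF A]] lin_zero[OF lin_fcalc[OF T(1)]] by simp
    next
      case False
      then have "d \<in> spectrum T" using x by (auto simp: spectrum_def)
      then have "c - d \<in> ?F" using c by force
      from E(2)[OF this, of x] show ?thesis unfolding A_def Px .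
    qed
    then have "(\<Sum>c\<in>spectrum T. ?P c (A x)) = (\<Sum>c\<in>spectrum T. if c = d then ?P d (A x) else 0)"
      by (intro sum.cong) auto
    then have "A x = (\<Sum>c\<in>spectrum T. if c = d then ?P d (A x) else 0)"
      using spec_proj_sum[OF T(1), of "A x"] by simp
    also have "\<dots> \<in> gen_eigenspace T d"
      using spec_proj_in[OF T(1)] subspace_0[OF subspace_gen_eigenspace[OF T(1)]]
      by (intro subspace_sum subspace_gen_eigenspace T(1)) auto
    finally have "T (A x) = scale d (A x)" using diagonalizable_eigenspace[OF T] by blast
    then show "(T \<circ> A) x = (A \<circ> T) x" using Tx lin_scale[OF M(1)[OF A]] by simp
  qed (use T M(1)[OF A] in \<open>auto intro: lin_comp\<close>)
  then have "comm T A = 0" by (auto simp: comm_apply fun_eq_iff)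
  moreover have "D = A + comm T (rscale (-1) E)"
    using T(1) by (auto simp: A_def fun_eq_iff comm_apply lin_neg)
  ultimately show ?thesis using A M(3)[OF E(1), of "-1"] by blast
qed

text \<open>N induces a diagonalizable map modulo U, so (N - c)^2 x in U forces (N - c) x into U. In
  terms of spectral components of y: the one at c is 0, and the one at d \<noteq> c is recovered
  from that of (N - c) y on division by d - c.\<close>

lemma diagonalizable_on_quotient:
  assumes N: "lin N" "is_diagonalizable scale N"
    and U: "subspace U" "\<And>x. x \<in> U \<Longrightarrow> N x \<in> U"
    and y: "y = N x - scale c x" and z: "N y - scale c y \<in> U"
  shows "y \<in> U"
proof -
  let ?P = "spec_proj N"
  note lP = lin_fcalc[OF N(1)]
  have PN: "?P d (N x) = scale d (?P d x)" for d x
    using fcalc_commute[OF N(1) N(1) refl] diagonalizable_eigenspace[OF N] spec_proj_in[OF N(1)] by metis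
  have P: "?P d (N x - scale c x) = scale (d - c) (?P d x)" for d x
    by (simp add: lin_diff[OF lP] lin_scale[OF lP] PN scale_left_diff_distrib)
  have "?P d y \<in> U" for d
  proof (cases "d = c")
    case True
    then show ?thesis using P[of d x] subspace_0[OF U(1)] by (simp add: y)
  next
    case False
    have "?P d (N y - scale c y) \<in> U" by (rule fcalc_stable[OF N(1) U z])
    then have "scale (d - c) (?P d y) \<in> U" by (simp add: P)
    then have "scale (1 / (d - c)) (scale (d - c) (?P d y)) \<in> U" by (rule subspace_scale[OF U(1)])
    then show ?thesis using False by simp
  qed
  then have "(\<Sum>d\<in>spectrum N. ?P d y) \<in> U" by (intro subspace_sum[OF U(1)])
  then show ?thesis using spec_proj_sum[OF N(1), of y] by simp
qed

lemma diagonalizable_conj: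
  assumes N: "lin N" "is_diagonalizable scale N" and p: "lin p" "bij p"
  shows "is_diagonalizable scale (p \<circ> N \<circ> inv p)"
proof -
  let ?A = "p \<circ> N \<circ> inv p"
  have A: "lin ?A" using N p by (intro lin_comp lin_inv)
  have ip: "inv p (p y) = y" for y using p(2) by (simp add: bij_is_inj)
  have "y \<in> {y. ?A (p y) = ss_part ?A (p y)}" for y
  proof (rule gen_eigenspaces_span[OF N(1)])
    show "subspace {y. ?A (p y) = ss_part ?A (p y)}"
      using lin_fcalc[OF A] A p(1) unfolding subspace_def mem_Collect_eq
      by (simp only: lin_add lin_scale lin_zero simp_thms) simp
    fix c
    show "gen_eigenspace N c \<subseteq> {y. ?A (p y) = ss_part ?A (p y)}"
    proof
      fix y assume "y \<in> gen_eigenspace N c"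
      then have "N y = scale c y" using diagonalizable_eigenspace[OF N] by blast
      then have e: "?A (p y) = scale c (p y)" using p(1) by (simp add: ip lin_scale)
      show "y \<in> {y. ?A (p y) = ss_part ?A (p y)}"
        using fcalc_eq[OF A eigenvector_gen_eigenspace[OF A e], of "\<lambda>c. c"] e by (simp only: mem_Collect_eq)
    qed
  qed
  then have "?A (p (inv p x)) = ss_part ?A (p (inv p x))" for x by blast
  then have "?A x = ss_part ?A x" for x using p(2) by (metis bij_inv_eq_iff)
  then show ?thesis using diagonalizable_iff[OF A] by blast
qed

end

section \<open>Exponentials of nilpotent endomorphisms\<close>

context vspace
begin

text \<open>The exponential series cut off at K. Once E^K = 0 it equals exp E, and by
  \<open>nexp_cut\<close> a later cutoff gives the same map.\<close>

definition nexp :: "nat \<Rightarrow> ('v \<Rightarrow> 'v) \<Rightarrow> 'v \<Rightarrow> 'v" where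
  "nexp K E x = (\<Sum>k<K. scale (inverse (fact k)) ((E ^^ k) x))"

lemma lin_nexp: "lin E \<Longrightarrow> lin (nexp K E)"
  unfolding nexp_def[abs_def] by (intro lin_sumf lin_smul lin_funpow)

lemma funpow_nilpotent_ge:
  fixes E :: "'v \<Rightarrow> 'v"
  shows "\<forall>x. (E ^^ K) x = 0 \<Longrightarrow> K \<le> n \<Longrightarrow> (E ^^ n) x = 0"
  using funpow_add[of K "n - K" E] by (simp add: fun_eq_iff)

lemma nexp_cut:
  assumes "\<forall>x. (E ^^ K) x = 0" "K \<le> L"
  shows "nexp L E x = nexp K E x"
  unfolding nexp_def using assms(2)
  by (intro sum.mono_neutral_right) (auto simp: funpow_nilpotent_ge[OF assms(1)])

end

text \<open>Cauchy product: i + j \<ge> 2 K forces i \<ge> K or j \<ge> K, so the diagonals below 2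
  K cover the square and F vanishes at all their other points.\<close>

lemma sum_square_diagonals:
  fixes F :: "nat \<Rightarrow> nat \<Rightarrow> 'a::comm_monoid_add"
  assumes "\<And>i j. K \<le> i \<or> K \<le> j \<Longrightarrow> F i j = 0"
  shows "(\<Sum>i<K. \<Sum>j<K. F i j) = (\<Sum>n<2 * K. \<Sum>i\<le>n. F i (n - i))"
proof -
  have "(\<Sum>n<2 * K. \<Sum>i\<le>n. F i (n - i)) = (\<Sum>(i, j)\<in>{(i, j). i + j < 2 * K}. F i j)"
    by (rule sum.triangle_reindex[symmetric])
  also have "\<dots> = (\<Sum>(i, j)\<in>{..<K} \<times> {..<K}. F i j)"
  proof (rule sum.mono_neutral_right)
    have "{(i, j). i + j < 2 * K} \<subseteq> {..<2 * K} \<times> {..<2 * K}" by auto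
    then show "finite {(i, j). i + j < 2 * K}" by (rule finite_subset) simp
    show "\<forall>p\<in>{(i, j). i + j < 2 * K} - {..<K} \<times> {..<K}. (case p of (i, j) \<Rightarrow> F i j) = 0"
      using assms by auto (metis not_less)+
  next
    show "{..<K} \<times> {..<K} \<subseteq> {(i, j). i + j < 2 * K}" by auto
  qed
  finally show ?thesis by (simp add: sum.cartesian_product)
qed

text \<open>Divided powers turn the binomial coefficients into factors 1/(i! j!). The induction step
  multiplies by n + 1 and splits it as i + (n + 1 - i) over the two kinds of terms.\<close>

lemma leibniz:
  fixes m :: "'a \<Rightarrow> 'b \<Rightarrow> 'c::ab_group_add" and scale :: "'d::field_char_0 \<Rightarrow> 'c \<Rightarrow> 'c"
  assumes "vspace scale" and E3: "\<And>x y. E3 (x + y) = E3 x + E3 y" "\<And>c x. E3 (scale c x) = scale c (E3 x)"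
    and m: "\<And>x y. E3 (m x y) = m (E1 x) y + m x (E2 y)"
  shows "scale (inverse (fact n)) ((E3 ^^ n) (m x y)) =
    (\<Sum>i\<le>n. scale (inverse (fact i) * inverse (fact (n - i))) (m ((E1 ^^ i) x) ((E2 ^^ (n - i)) y)))"
proof (induction n)
  case 0
  interpret vspace scale by fact
  show ?case by simp
next
  case (Suc n)
  interpret vspace scale by fact
  let ?f = "\<lambda>i j. scale (inverse (fact i) * inverse (fact j)) (m ((E1 ^^ i) x) ((E2 ^^ j) y))"
  have lin: "lin E3" using E3 by (intro linI)
  have inv_fact: "of_nat (Suc k) * inverse (fact (Suc k)) = (inverse (fact k) :: 'd)" for k
    by (simp add: field_simps del: of_nat_Suc)
  have 1: "E3 (?f i j) = scale (of_nat (Suc i)) (?f (Suc i) j) + scale (of_nat (Suc j)) (?f i (Suc j))" for i j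
  proof -
    have a: "inverse (fact i) * inverse (fact j) = of_nat (Suc i) * (inverse (fact (Suc i)) * inverse (fact j) :: 'd)"
      by (subst inv_fact[symmetric, of i]) (simp only: mult.assoc)
    have b: "inverse (fact i) * inverse (fact j) = of_nat (Suc j) * (inverse (fact i) * inverse (fact (Suc j)) :: 'd)"
      by (subst inv_fact[symmetric, of j]) (simp only: mult.left_commute)
    have "E3 (?f i j) = scale (inverse (fact i) * inverse (fact j)) (m ((E1 ^^ Suc i) x) ((E2 ^^ j) y))
        + scale (inverse (fact i) * inverse (fact j)) (m ((E1 ^^ i) x) ((E2 ^^ Suc j) y))"
      by (simp only: E3 m scale_right_distrib funpow.simps comp_apply)
    then show ?thesis by (simp only: scale_scale a[symmetric] b[symmetric])
  qed
  have "scale (of_nat (Suc n)) (scale (inverse (fact (Suc n))) ((E3 ^^ Suc n) (m x y))) =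
      E3 (scale (inverse (fact n)) ((E3 ^^ n) (m x y)))"
    by (simp only: E3 scale_scale inv_fact funpow.simps comp_apply)
  also have "\<dots> = (\<Sum>i\<le>n. E3 (?f i (n - i)))" by (simp only: Suc lin_sum[OF lin])
  also have "\<dots> = (\<Sum>i\<le>n. scale (of_nat (Suc i)) (?f (Suc i) (n - i)))
      + (\<Sum>i\<le>n. scale (of_nat (Suc n - i)) (?f i (Suc n - i)))"
    by (simp only: 1 sum.distrib) (simp add: Suc_diff_le del: of_nat_Suc)
  also have "(\<Sum>i\<le>n. scale (of_nat (Suc i)) (?f (Suc i) (n - i))) = (\<Sum>i\<le>Suc n. scale (of_nat i) (?f i (Suc n - i)))"
    by (subst sum.atMost_Suc_shift) simp
  also have "(\<Sum>i\<le>n. scale (of_nat (Suc n - i)) (?f i (Suc n - i))) = (\<Sum>i\<le>Suc n. scale (of_nat (Suc n - i)) (?f i (Suc n - i)))"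
    by simp
  also have "(\<Sum>i\<le>Suc n. scale (of_nat i) (?f i (Suc n - i))) + \<dots> = (\<Sum>i\<le>Suc n. scale (of_nat (Suc n)) (?f i (Suc n - i)))"
    by (simp only: sum.distrib[symmetric] scale_left_distrib[symmetric] of_nat_add[symmetric])
      (rule sum.cong, auto)
  also have "\<dots> = scale (of_nat (Suc n)) (\<Sum>i\<le>Suc n. ?f i (Suc n - i))" by (simp only: scale_sum_right)
  finally show ?case
    by (simp only: scale_cancel_left of_nat_eq_0_iff nat.distinct simp_thms)
qed


text \<open>Three separate maps cover both later uses: the bracket with one derivation in all
  places, and the form, where E3 is multiplication by the conformal constant. The cutoff 2 K on the
  left is where all mixed terms have vanished.\<close>

lemma nexp_bilinear:
  fixes s1 :: "'k::field_char_0 \<Rightarrow> 'a::ab_group_add \<Rightarrow> 'a" and s2 :: "'k \<Rightarrow> 'b::ab_group_add \<Rightarrow> 'b"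
    and s3 :: "'k \<Rightarrow> 'c::ab_group_add \<Rightarrow> 'c"
  assumes m: "\<And>y. Vector_Spaces.linear s1 s3 (\<lambda>x. m x y)" "\<And>x. Vector_Spaces.linear s2 s3 (\<lambda>y. m x y)"
    and E3: "Vector_Spaces.linear s3 s3 E3" "\<And>x y. E3 (m x y) = m (E1 x) y + m x (E2 y)"
    and nil: "\<forall>x. (E1 ^^ K) x = 0" "\<forall>y. (E2 ^^ K) y = 0"
  shows "vspace.nexp s3 (2 * K) E3 (m x y) = m (vspace.nexp s1 K E1 x) (vspace.nexp s2 K E2 y)"
proof -
  interpret l: Vector_Spaces.linear s1 s3 "\<lambda>u. m u v" for v by (rule m(1))
  interpret r: Vector_Spaces.linear s2 s3 "\<lambda>v. m u v" for u by (rule m(2))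
  interpret e: Vector_Spaces.linear s3 s3 E3 by (rule E3(1))
  interpret a: vspace s1 by unfold_locales
  interpret b: vspace s2 by unfold_locales
  interpret c: vspace s3 by unfold_locales
  let ?F = "\<lambda>i j. s3 (inverse (fact i) * inverse (fact j)) (m ((E1 ^^ i) x) ((E2 ^^ j) y))"
  have z: "m 0 v = 0" "m u 0 = 0" for u v using l.zero r.zero by auto
  have "c.nexp (2 * K) E3 (m x y) = (\<Sum>n<2 * K. \<Sum>i\<le>n. ?F i (n - i))"
    unfolding c.nexp_def
    by (intro sum.cong refl leibniz[where m = m and ?E1.0 = E1 and ?E2.0 = E2, OF c.vspace_axioms] e.add e.scale E3(2))
  also have "\<dots> = (\<Sum>i<K. \<Sum>j<K. ?F i j)"
    using nil by (intro sum_square_diagonals[symmetric])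
      (auto simp: a.funpow_nilpotent_ge[of K E1] b.funpow_nilpotent_ge[of K E2] z)
  also have "\<dots> = m (a.nexp K E1 x) (b.nexp K E2 y)"
    by (simp only: a.nexp_def l.sum l.scale) (simp add: b.nexp_def r.sum r.scale l.vs2.scale_sum_right)
  finally show ?thesis .
qed

context vspace
begin

lemma funpow_uminus: "lin E \<Longrightarrow> ((- E) ^^ j) x = scale ((-1) ^ j) ((E ^^ j) x)"
  by (induction j) (auto simp: lin_scale)

lemma nexp_inverse:
  assumes E: "lin E" "\<forall>x. (E ^^ K) x = 0"
  shows "nexp K E (nexp K (- E) x) = x"
\<comment> \<open>For K = 0 the assumption says that the identity is zero, so the space is trivial.
  Otherwise the diagonal sums are (1 - 1)^n / n!, of which only n = 0 survives.\<close>
proof (cases "K = 0")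
  case True
  then have "\<And>y :: 'v. y = 0" using E(2) by simp
  then show ?thesis by metis
next
  case False
  let ?F = "\<lambda>i j. scale (inverse (fact i) * (inverse (fact j) * (-1) ^ j)) ((E ^^ (i + j)) x)"
  have "nexp K E (nexp K (- E) x) = (\<Sum>i<K. \<Sum>j<K. ?F i j)"
    using E(1) by (simp add: nexp_def funpow_uminus lin_sum[OF lin_funpow] lin_scale[OF lin_funpow]
        scale_sum_right funpow_add)
  also have "\<dots> = (\<Sum>n<2 * K. \<Sum>i\<le>n. ?F i (n - i))"
    using funpow_nilpotent_ge[OF E(2)] by (intro sum_square_diagonals) auto
  also have "\<dots> = (\<Sum>n<2 * K. if n = 0 then x else 0)"
  proof (rule sum.cong[OF refl])
    fix n
    have c: "inverse (fact i) * (inverse (fact (n - i)) * (-1) ^ (n - i)) =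
        inverse (fact n) * (of_nat (n choose i) * 1 ^ i * (-1) ^ (n - i) :: 'k)" if "i \<le> n" for i
      using binomial_fact[OF that, where 'a = 'k] by (simp add: field_simps)
    have "(\<Sum>i\<le>n. ?F i (n - i)) =
        scale (\<Sum>i\<le>n. inverse (fact i) * (inverse (fact (n - i)) * (-1) ^ (n - i))) ((E ^^ n) x)"
      by (simp add: scale_sum_left)
    also have "(\<Sum>i\<le>n. inverse (fact i) * (inverse (fact (n - i)) * (-1) ^ (n - i))) =
        inverse (fact n) * (1 + -1 :: 'k) ^ n"
      unfolding binomial_ring sum_distrib_left using c by (intro sum.cong) auto
    finally show "(\<Sum>i\<le>n. ?F i (n - i)) = (if n = 0 then x else 0)" by (simp add: power_0_left)
  qed
  also have "\<dots> = x" using False by simp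
  finally show ?thesis .
qed

lemma nexp_inverse':
  assumes E: "lin E" "\<forall>x. (E ^^ K) x = 0"
  shows "nexp K (- E) (nexp K E x) = x"
  using nexp_inverse[of "- E" K x] assms by (simp add: lin_uminus funpow_uminus)

lemma bij_nexp: "lin E \<Longrightarrow> \<forall>x. (E ^^ K) x = 0 \<Longrightarrow> bij (nexp K E)"
  using nexp_inverse nexp_inverse' by (intro o_bij[of "nexp K (- E)"]) (auto simp: fun_eq_iff)

lemma inv_nexp: "lin E \<Longrightarrow> \<forall>x. (E ^^ K) x = 0 \<Longrightarrow> inv (nexp K E) = nexp K (- E)"
  using nexp_inverse nexp_inverse' by (intro inv_unique_comp) (auto simp: fun_eq_iff)

end

section \<open>Lie algebras of endomorphisms closed under functional calculus\<close>

text \<open>\<open>h\<close> is only a real subspace: for a real Lie algebra it will consist of complexified maps, which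
  are preserved by \<open>fcalc\<close> only for functions commuting with conjugation. The additive functions \<open>f\<close>
  allowed in \<open>h_fcalc\<close> need not be linear; this replaces the algebraicity of \<open>h\<close>.\<close>

locale algebraic_pair = complex_endo +
  fixes h H :: "('a \<Rightarrow> 'a) set"
  assumes h_lin: "A \<in> h \<Longrightarrow> lin A"
    and h_0: "0 \<in> h"
    and h_add: "A \<in> h \<Longrightarrow> B \<in> h \<Longrightarrow> A + B \<in> h"
    and h_rscale: "A \<in> h \<Longrightarrow> rscale c A \<in> h"
    and h_comm: "A \<in> h \<Longrightarrow> B \<in> h \<Longrightarrow> comm A B \<in> h"
    and h_fcalc: "A \<in> h \<Longrightarrow> (\<And>x y. f (x + y) = f x + f y) \<Longrightarrow> (\<And>x. f (cnj x) = cnj (f x)) \<Longrightarrow> fcalc A f \<in> h"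
    and H_lin: "p \<in> H \<Longrightarrow> lin p"
    and H_bij: "p \<in> H \<Longrightarrow> bij p"
    and H_id: "id \<in> H"
    and H_comp: "p \<in> H \<Longrightarrow> q \<in> H \<Longrightarrow> p \<circ> q \<in> H"
    and H_conj: "p \<in> H \<Longrightarrow> A \<in> h \<Longrightarrow> p \<circ> A \<circ> inv p \<in> h"
    and H_conj_inv: "p \<in> H \<Longrightarrow> A \<in> h \<Longrightarrow> inv p \<circ> A \<circ> p \<in> h"
    and H_nexp: "A \<in> h \<Longrightarrow> \<forall>x. (A ^^ K) x = 0 \<Longrightarrow> nexp K A \<in> H"
begin

section \<open>The trace form and its radical\<close>

lemma h_uminus: "A \<in> h \<Longrightarrow> - A \<in> h"
  using h_rscale[of A "-1"] by (simp add: rscale_def fun_Compl_def)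

lemma h_diff: "A \<in> h \<Longrightarrow> B \<in> h \<Longrightarrow> A - B \<in> h"
  using h_add[of A "- B"] h_uminus[of B] by simp

text \<open>The real part makes this a real bilinear form on the real space \<open>h\<close>,
  whichever the ground field is.\<close>

definition \<beta> :: "('a \<Rightarrow> 'a) \<Rightarrow> ('a \<Rightarrow> 'a) \<Rightarrow> real" where
  "\<beta> A B = Re (tr (A \<circ> B))"

lemma \<beta>_sym: "lin A \<Longrightarrow> lin B \<Longrightarrow> \<beta> A B = \<beta> B A"
  by (simp add: \<beta>_def tr_comm)

lemma \<beta>_add: "lin A \<Longrightarrow> lin B \<Longrightarrow> lin C \<Longrightarrow> \<beta> (A + B) C = \<beta> A C + \<beta> B C"
  by (simp add: \<beta>_def comp_plus_right tr_add lin_comp)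

lemma \<beta>_diff: "lin A \<Longrightarrow> lin B \<Longrightarrow> lin C \<Longrightarrow> \<beta> (A - B) C = \<beta> A C - \<beta> B C"
  by (simp add: \<beta>_def comp_minus_right tr_diff lin_comp)

lemma Re_tr_rscale: "lin A \<Longrightarrow> Re (tr (rscale c A)) = c * Re (tr A)"
  by (simp add: rscale_def tr_smul)

lemma lin_rscale: "lin A \<Longrightarrow> lin (rscale c A)"
  by (simp add: rscale_def lin_smul)

lemma \<beta>_rscale: "lin A \<Longrightarrow> lin C \<Longrightarrow> \<beta> (rscale c A) C = c * \<beta> A C"
  using Re_tr_rscale[OF lin_comp[of A C], of c] by (simp add: \<beta>_def rscale_def comp_def)

lemma \<beta>_diff_right: "lin A \<Longrightarrow> lin B \<Longrightarrow> lin C \<Longrightarrow> \<beta> C (A - B) = \<beta> C A - \<beta> C B"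
  by (simp add: \<beta>_sym[of C] \<beta>_diff lin_minus)

lemma \<beta>_rscale_right: "lin A \<Longrightarrow> lin C \<Longrightarrow> \<beta> C (rscale c A) = c * \<beta> C A"
  by (simp add: \<beta>_sym[of C] \<beta>_rscale lin_rscale)

lemma comm_eq: "comm A B = (A \<circ> B) - (B \<circ> A)"
  by (auto simp: comm_apply fun_eq_iff)

lemma tr_commutator: "lin A \<Longrightarrow> lin B \<Longrightarrow> tr (comm A B) = 0"
  by (simp add: comm_eq tr_diff lin_comp tr_comm[of A B])

lemma tr_comm_assoc:
  assumes "lin A" "lin B" "lin C"
  shows "tr (comm A B \<circ> C) = tr (A \<circ> comm B C)"
proof -
  have "tr (comm A B \<circ> C) = tr (A \<circ> (B \<circ> C)) - tr (B \<circ> (A \<circ> C))"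
    unfolding comm_eq comp_minus_right using assms by (subst tr_diff) (simp_all add: lin_comp o_assoc)
  also have "tr (B \<circ> (A \<circ> C)) = tr (A \<circ> (C \<circ> B))"
    using tr_comm[of B "A \<circ> C"] assms by (simp add: lin_comp o_assoc)
  also have "tr (A \<circ> (B \<circ> C)) - tr (A \<circ> (C \<circ> B)) = tr (A \<circ> comm B C)"
    unfolding comm_eq comp_minus_left[OF assms(1)] using assms by (subst tr_diff) (simp_all add: lin_comp)
  finally show ?thesis .
qed

lemma \<beta>_invariant: "lin A \<Longrightarrow> lin B \<Longrightarrow> lin C \<Longrightarrow> \<beta> (comm A B) C = \<beta> A (comm B C)"
  by (simp add: \<beta>_def tr_comm_assoc)

lemma h_fcalc_Re: "A \<in> h \<Longrightarrow> rat_functional \<phi> \<Longrightarrow> fcalc A (\<lambda>c. of_real (\<phi> (Re c))) \<in> h"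
  by (rule h_fcalc) (auto simp: rat_functional_def)

text \<open>Since \<phi> is odd, the factor i is what makes the function commute with conjugation;
  it also causes the minus sign in \<open>\<beta>_fcalc_Im\<close>.\<close>

lemma h_fcalc_Im:
  assumes A: "A \<in> h" and p: "rat_functional \<phi>"
  shows "fcalc A (\<lambda>c. \<i> * of_real (\<phi> (Im c))) \<in> h"
proof (rule h_fcalc[OF A])
  have add: "\<phi> (x + y) = \<phi> x + \<phi> y" for x y using p by (simp add: rat_functional_def)
  have "\<phi> (- x) = - \<phi> x" for x using add[of x "- x"] add[of 0 0] by simp
  then show "\<i> * of_real (\<phi> (Im (cnj x))) = cnj (\<i> * of_real (\<phi> (Im x)))" for x by simp
qed (use p in \<open>auto simp: rat_functional_def algebra_simps\<close>)

lemma \<beta>_fcalc_Re: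
  "lin A \<Longrightarrow> \<beta> A (fcalc A (\<lambda>c. of_real (\<phi> (Re c)))) =
     (\<Sum>c\<in>spectrum A. of_nat (alg_mult A c) * Re c * \<phi> (Re c))"
  by (simp add: \<beta>_def tr_comp_fcalc ac_simps)

lemma \<beta>_fcalc_Im:
  "lin A \<Longrightarrow> \<beta> A (fcalc A (\<lambda>c. \<i> * of_real (\<phi> (Im c)))) =
     - (\<Sum>c\<in>spectrum A. of_nat (alg_mult A c) * Im c * \<phi> (Im c))"
  by (simp add: \<beta>_def tr_comp_fcalc sum_negf[symmetric] ac_simps)

lemma rat_functional_0: "rat_functional \<phi> \<Longrightarrow> \<phi> 0 = 0"
  unfolding rat_functional_def by (metis add_cancel_right_left)

text \<open>The first claim asks only that \<phi> kill the value of the form: in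
  \<open>pre_einstein_rational\<close> that value is merely known to be rational.\<close>

lemma spectrum_vanish:
  assumes A: "A \<in> h" and c: "c \<in> spectrum A" and p: "rat_functional \<phi>"
  shows "\<phi> (\<beta> A (fcalc A (\<lambda>c. of_real (\<phi> (Re c))))) = 0 \<Longrightarrow> \<phi> (Re c) = 0"
    and "\<beta> A (fcalc A (\<lambda>c. \<i> * of_real (\<phi> (Im c)))) = 0 \<Longrightarrow> \<phi> (Im c) = 0"
proof -
  note l = h_lin[OF A]
  have pos: "\<And>c. c \<in> spectrum A \<Longrightarrow> 0 < alg_mult A c" using alg_mult[OF l] by blast
  show "\<phi> (Re c) = 0" if "\<phi> (\<beta> A (fcalc A (\<lambda>c. of_real (\<phi> (Re c))))) = 0"
    using that rat_functional_vanish[of "spectrum A" "alg_mult A" \<phi> Re c, OF finite_spectrum[OF l] pos p] c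
    by (simp add: \<beta>_fcalc_Re[OF l])
  show "\<phi> (Im c) = 0" if "\<beta> A (fcalc A (\<lambda>c. \<i> * of_real (\<phi> (Im c)))) = 0"
    using that rat_functional_vanish[of "spectrum A" "alg_mult A" \<phi> Im c, OF finite_spectrum[OF l] pos p] c
    by (simp add: \<beta>_fcalc_Im[OF l] rat_functional_0[OF p])
qed

definition rad :: "('a \<Rightarrow> 'a) set" where
  "rad = {A \<in> h. \<forall>B\<in>h. \<beta> A B = 0}"

lemma rad_h: "A \<in> rad \<Longrightarrow> A \<in> h"
  by (simp add: rad_def)

lemma rad_lin: "\<forall>A\<in>rad. lin A"
  using h_lin rad_h by blast

lemma rad_nilpotent:
  assumes A: "A \<in> rad"
  shows "nilpotent A"
proof -
  have Ah: "A \<in> h" and l: "lin A" using A rad_h h_lin by blast+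
  have z: "\<beta> A B = 0" if "B \<in> h" for B using A that by (simp add: rad_def)
  have "c = 0" if c: "c \<in> spectrum A" for c
  proof (rule complex_eqI)
    have "Re c = 0"
    proof (rule ccontr)
      assume "Re c \<noteq> 0"
      then obtain \<phi> where p: "rat_functional \<phi>" "\<phi> (Re c) = 1" using rat_functional_nonzero by blast
      then show False
        using spectrum_vanish(1)[OF Ah c p(1)] z[OF h_fcalc_Re[OF Ah p(1)]] rat_functional_0[OF p(1)] by simp
    qed
    then show "Re c = Re 0" by simp
    have "Im c = 0"
    proof (rule ccontr)
      assume "Im c \<noteq> 0"
      then obtain \<phi> where p: "rat_functional \<phi>" "\<phi> (Im c) = 1" using rat_functional_nonzero by blast
      then show False
        using spectrum_vanish(2)[OF Ah c p(1)] z[OF h_fcalc_Im[OF Ah p(1)]] by simp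
    qed
    then show "Im c = Im 0" by simp
  qed
  then have "ss_part A x = 0" for x
    using fcalc_spec_proj[OF l, of "\<lambda>c. c" x] by (simp add: sum.neutral)
  then have "A - ss_part A = A" by (auto simp: fun_eq_iff)
  then show ?thesis using nilpotent_part[OF l] by simp
qed

lemma rad_comm: "A \<in> rad \<Longrightarrow> B \<in> h \<Longrightarrow> comm A B \<in> rad"
  by (auto simp: rad_def h_comm \<beta>_invariant h_lin)

lemma rad_add: "A \<in> rad \<Longrightarrow> B \<in> rad \<Longrightarrow> A + B \<in> rad"
  by (auto simp: rad_def h_add \<beta>_add h_lin)

lemma rad_rscale: "A \<in> rad \<Longrightarrow> rscale c A \<in> rad"
  by (auto simp: rad_def h_rscale \<beta>_rscale h_lin)

lemma rad_uminus: "A \<in> rad \<Longrightarrow> - A \<in> rad"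
  using rad_rscale[of A "-1"] by (simp add: rscale_def fun_Compl_def)

lemma rad_comm': "A \<in> rad \<Longrightarrow> B \<in> h \<Longrightarrow> comm B A \<in> rad"
  using rad_uminus[OF rad_comm] by (simp add: uminus_comm)

lemma rad_0: "0 \<in> rad"
proof -
  have "0 \<circ> B = (0 :: 'a \<Rightarrow> 'a)" for B :: "'a \<Rightarrow> 'a" by (auto simp: fun_eq_iff)
  then show ?thesis using h_0 by (simp add: rad_def \<beta>_def tr_zero)
qed

abbreviation "V \<equiv> flag rad"

lemma V_full: "\<exists>d. V d = UNIV"
  using rad_lin rad_nilpotent rad_comm rad_uminus rad_0 rad_h by (intro engel) auto

lemma V_subspace: "subspace (V j)"
  using subspace_flag[OF rad_lin] .

lemma V_stable: "A \<in> h \<Longrightarrow> x \<in> V j \<Longrightarrow> A x \<in> V j"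
  using flag_stable[OF rad_lin] h_lin rad_comm by blast

lemma V_mono: "i \<le> j \<Longrightarrow> x \<in> V i \<Longrightarrow> x \<in> V j"
  using flag_mono[OF rad_lin, of i j] by blast

lemmas V_add = subspace_add[OF V_subspace] and V_diff = subspace_diff[OF V_subspace]

text \<open>On each quotient of V (i + 1) by V i the maps n and B commute, so (n B)^K acts there as
  n^K B^K = 0. Hence (n B)^K lowers the flag by one step, and its d-th power is 0.\<close>

lemma tr_nilpotent_mod_rad:
  assumes n: "n \<in> h" "nilpotent n" and B: "B \<in> h" "comm n B \<in> rad"
  shows "tr (n \<circ> B) = 0"
proof (rule tr_nilpotent)
  show ln: "lin (n \<circ> B)" using n(1) B(1) by (simp add: lin_comp h_lin)
  obtain K where K: "\<And>x. (n ^^ K) x = 0" using n(2) by (auto simp: nilpotent_def)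
  obtain d where d: "V d = UNIV" using V_full by blast
  have st: "(B ^^ j) x \<in> V i" if "x \<in> V i" for i j x
    using that by (induction j) (auto simp: V_stable[OF B(1)])
  have st': "(n ^^ j) x \<in> V i" if "x \<in> V i" for i j x
    using that by (induction j) (auto simp: V_stable[OF n(1)])
  have 1: "B ((n ^^ j) y) - (n ^^ j) (B y) \<in> V i" if y: "y \<in> V (Suc i)" for i j y
  proof (induction j)
    case (Suc j)
    let ?u = "(n ^^ j) y"
    have "n (B ?u - (n ^^ j) (B y)) \<in> V i" using V_stable[OF n(1) Suc] .
    moreover have "comm n B ?u \<in> V i" using st'[OF y] B(2) by simp
    ultimately have "n (B ?u - (n ^^ j) (B y)) - comm n B ?u \<in> V i" by (rule V_diff)
    then show ?case using n(1) by (simp add: comm_apply lin_diff[OF h_lin])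
  qed (use subspace_0[OF V_subspace] in auto)
  define m where "m = n \<circ> B"
  have ms: "(m ^^ Suc j) x = n (B ((m ^^ j) x))" for j x by (simp add: m_def)
  have 2: "(m ^^ j) x - (n ^^ j) ((B ^^ j) x) \<in> V i" if x: "x \<in> V (Suc i)" for i j x
  proof (induction j)
    case (Suc j)
    let ?f = "(m ^^ j) x - (n ^^ j) ((B ^^ j) x)"
    have "n (B ?f) \<in> V i" by (rule V_stable[OF n(1) V_stable[OF B(1) Suc]])
    moreover have "n (B ((n ^^ j) ((B ^^ j) x)) - (n ^^ j) (B ((B ^^ j) x))) \<in> V i"
      using 1[OF st[OF x]] by (rule V_stable[OF n(1)])
    ultimately have "n (B ?f) + n (B ((n ^^ j) ((B ^^ j) x)) - (n ^^ j) (B ((B ^^ j) x))) \<in> V i"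
      by (rule V_add)
    moreover have "(n ^^ Suc j) ((B ^^ Suc j) x) = n ((n ^^ j) (B ((B ^^ j) x)))" by simp
    ultimately show ?case unfolding ms using n(1) B(1) by (simp add: lin_diff[OF h_lin])
  qed (use subspace_0[OF V_subspace] in auto)
  have 3: "(m ^^ K) x \<in> V i" if "x \<in> V (Suc i)" for i x
    using 2[OF that, of K] by (simp add: K)
  have "((m ^^ K) ^^ i) x \<in> V (d - i)" if "i \<le> d" for i x
    using that
  proof (induction i)
    case (Suc i)
    then have "d - i = Suc (d - Suc i)" by simp
    then show ?case using 3[of "((m ^^ K) ^^ i) x" "d - Suc i"] Suc by simp
  qed (simp add: d)
  from this[of d] have "(m ^^ (K * d)) x = 0" for x by (simp add: funpow_mult)
  then show "nilpotent (n \<circ> B)" unfolding m_def by (auto simp: nilpotent_def)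
qed

section \<open>Semisimple solutions: existence and rationality\<close>

definition pre_einstein :: "('a \<Rightarrow> 'a) set" where
  "pre_einstein = {N \<in> h. is_diagonalizable scale N \<and> (\<forall>B\<in>h. \<beta> N B = Re (tr B))}"

text \<open>The trace form may be degenerate on \<open>h\<close>, but a B orthogonal to a finite
  spanning set lies in \<open>rad\<close>, where the trace vanishes too. So the trace is a
  combination of the functionals \<open>\<beta> A\<close>.\<close>

lemma trace_functional_represented: "\<exists>N\<in>h. \<forall>B\<in>h. \<beta> N B = Re (tr B)"
proof -
  interpret R: vector_space rscale by (rule vector_space_rscale)
  obtain T where T: "T \<subseteq> h" "finite T" "h \<subseteq> R.span T" using finite_real_span[of h] h_lin by blast
  \<comment> \<open>The default 0 outside \<open>h\<close> is there because
    \<open>functional_in_span\<close> wants linearity for every index, not just those in T.\<close>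
  have "\<exists>c. \<forall>B\<in>h. Re (tr B) = (\<Sum>A\<in>T. c A * (if A \<in> h then \<beta> A B else 0))"
  proof (rule functional_in_span[of T h rscale, OF T(2)])
    fix B assume B: "B \<in> h" and z: "\<And>A. A \<in> T \<Longrightarrow> (if A \<in> h then \<beta> A B else 0) = 0"
    note lB = h_lin[OF B]
    have "R.span T \<subseteq> {A. lin A \<and> \<beta> A B = 0}"
    proof (rule R.span_minimal)
      show "T \<subseteq> {A. lin A \<and> \<beta> A B = 0}" using z T(1) h_lin by fastforce
      have "0 \<circ> B = (0 :: 'a \<Rightarrow> 'a)" by (auto simp: fun_eq_iff)
      then have "\<beta> 0 B = 0" by (simp add: \<beta>_def tr_zero)
      then show "R.subspace {A. lin A \<and> \<beta> A B = 0}"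
        using lB by (auto simp: R.subspace_def lin_0 lin_plus lin_rscale \<beta>_add \<beta>_rscale)
    qed
    then have "\<beta> A B = 0" if "A \<in> h" for A using T(3) that by blast
    then have "B \<in> rad" using B \<beta>_sym[OF lB] h_lin by (simp add: rad_def)
    then show "Re (tr B) = 0" using tr_nilpotent[OF lB rad_nilpotent] by simp
  qed (auto simp: h_diff h_rscale tr_diff h_lin \<beta>_diff_right \<beta>_rscale_right Re_tr_rscale)
  then obtain c where "\<forall>B\<in>h. Re (tr B) = (\<Sum>A\<in>T. c A * (if A \<in> h then \<beta> A B else 0))" by blast
  moreover have "(\<Sum>A\<in>T. c A * (if A \<in> h then \<beta> A B else 0)) = (\<Sum>A\<in>T. c A * \<beta> A B)" for B
    using T(1) by (intro sum.cong) auto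
  ultimately have c: "\<And>B. B \<in> h \<Longrightarrow> Re (tr B) = (\<Sum>A\<in>T. c A * \<beta> A B)" by simp
  have "\<exists>N\<in>h. \<forall>B\<in>h. \<beta> N B = (\<Sum>A\<in>T'. c A * \<beta> A B)" if "T' \<subseteq> T" for T'
    using finite_subset[OF that T(2)] that
  proof (induction T' rule: finite_induct)
    case empty
    have "\<beta> 0 B = 0" if "B \<in> h" for B using rad_0 that unfolding rad_def by blast
    then show ?case using h_0 by (intro bexI[of _ 0]) (simp_all del: zero_fun_apply)
  next
    case (insert A T')
    then obtain N where N: "N \<in> h" "\<forall>B\<in>h. \<beta> N B = (\<Sum>A\<in>T'. c A * \<beta> A B)" by auto
    have A: "A \<in> h" using insert T(1) by blast
    show ?case
      using N A insert.hyps
      by (intro bexI[of _ "rscale (c A) A + N"]) (auto simp: h_add h_rscale \<beta>_add \<beta>_rscale h_lin lin_rscale simp del: plus_fun_apply rscale_apply)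
  qed
  from this[of T] show ?thesis using c by auto
qed

lemma pre_einstein_exists: "pre_einstein \<noteq> {}"
proof -
  obtain N where N: "N \<in> h" "\<And>B. B \<in> h \<Longrightarrow> \<beta> N B = Re (tr B)"
    using trace_functional_represented by blast
  note l = h_lin[OF N(1)]
  define s n where "s = ss_part N" and "n = N - s"
  have s: "s \<in> h" "is_diagonalizable scale s"
    unfolding s_def using diagonalizable_fcalc[OF l] h_fcalc[OF N(1), of "\<lambda>c. c"] by auto
  have n: "n \<in> h" "nilpotent n" unfolding n_def using h_diff[OF N(1) s(1)] nilpotent_part[OF l] s_def by auto
  note ls = h_lin[OF s(1)] and lnn = h_lin[OF n(1)]
  have sN: "s (N x) = N (s x)" for x unfolding s_def by (rule fcalc_commute[OF l l refl, symmetric])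
  have ns: "comm n s = 0" by (auto simp: n_def comm_apply fun_eq_iff sN lin_diff[OF ls])
  have zero: "Re (tr (n \<circ> B)) = 0" if B: "B \<in> h" for B
  proof -
    \<comment> \<open>Only the part of B commuting with s can contribute, for tr(n [s, E]) =
      tr([n, s] E) = 0.\<close>
    have "\<exists>A\<in>h. \<exists>E\<in>h. B = A + comm s E \<and> comm s A = 0"
      by (rule ad_decomposition[OF ls s(2)]) (auto simp: h_lin h_add h_rscale h_comm[OF s(1)] B)
    then obtain B0 E where BE: "B0 \<in> h" "E \<in> h" "B = B0 + comm s E" "comm s B0 = 0" by blast
    note lB0 = h_lin[OF BE(1)] and lE = h_lin[OF BE(2)]
    \<comment> \<open>For C in h, \<beta>([N, B0], C) = \<beta>(N, [B0, C]) = Re tr [B0, C] = 0. As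
      B0 commutes with s, this bracket is the one with n.\<close>
    have "comm N B0 \<in> rad"
      unfolding rad_def using N h_comm[OF N(1) BE(1)]
      by (auto simp: \<beta>_invariant l lB0 h_lin h_comm[OF BE(1)] tr_commutator)
    moreover have "comm n B0 = comm N B0 - comm s B0"
      using lB0 by (auto simp: n_def comm_apply fun_eq_iff lin_diff)
    ultimately have "comm n B0 \<in> rad" using BE(4) by simp
    then have "tr (n \<circ> B0) = 0" by (rule tr_nilpotent_mod_rad[OF n BE(1)])
    moreover have "tr (n \<circ> comm s E) = 0"
    proof -
      have "0 \<circ> E = (0 :: 'a \<Rightarrow> 'a)" by (auto simp: fun_eq_iff)
      then show ?thesis using tr_comm_assoc[OF lnn ls lE] ns by (simp add: tr_zero)
    qed
    ultimately show ?thesis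
      using lnn lB0 lE ls by (simp add: BE(3) comp_plus_left tr_add lin_comp lin_comm)
  qed
  have "\<beta> s B = Re (tr B)" if B: "B \<in> h" for B
  proof -
    have "N = s + n" by (simp add: n_def)
    then have "\<beta> N B = \<beta> s B + \<beta> n B" using \<beta>_add[OF ls lnn h_lin[OF B]] by simp
    then show ?thesis using N(2)[OF B] zero[OF B] by (simp add: \<beta>_def)
  qed
  then show ?thesis using s by (auto simp: pre_einstein_def)
qed

lemma pre_einstein_rational:
  assumes N: "N \<in> pre_einstein" and c: "N x = scale c x" "x \<noteq> 0"
  shows "c \<in> \<rat>"
proof -
  have Nh: "N \<in> h" and \<beta>N: "\<And>B. B \<in> h \<Longrightarrow> \<beta> N B = Re (tr B)" using N by (auto simp: pre_einstein_def)
  note l = h_lin[OF Nh]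
  have sp: "c \<in> spectrum N"
    using eigenvector_gen_eigenspace[OF l c(1)] c(2) by (auto simp: spectrum_def)
  have "Im c = 0"
  proof (rule ccontr)
    assume "Im c \<noteq> 0"
    then obtain \<phi> where p: "rat_functional \<phi>" "\<phi> (Im c) = 1" using rat_functional_nonzero by blast
    \<comment> \<open>Here the form is the real part of a trace with purely imaginary value.\<close>
    have "\<beta> N (fcalc N (\<lambda>c. \<i> * of_real (\<phi> (Im c)))) = 0"
      unfolding \<beta>N[OF h_fcalc_Im[OF Nh p(1)]] tr_fcalc[OF l] by simp
    then show False using spectrum_vanish(2)[OF Nh sp p(1)] p(2) by simp
  qed
  moreover have "Re c \<in> \<rat>"
  proof (rule ccontr)
    assume "Re c \<notin> \<rat>"
    then obtain \<phi> where p: "rat_functional \<phi>" "\<phi> 1 = 0" "\<phi> (Re c) = 1"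
      using rat_functional_irrational by blast
    \<comment> \<open>The trace is a sum of integers times rational values of \<phi>, hence
      rational, and \<phi> 1 = 0 makes \<phi> kill it.\<close>
    have "\<beta> N (fcalc N (\<lambda>c. of_real (\<phi> (Re c)))) = (\<Sum>c\<in>spectrum N. \<phi> (Re c) * of_nat (alg_mult N c))"
      unfolding \<beta>N[OF h_fcalc_Re[OF Nh p(1)]] tr_fcalc[OF l] by simp
    also have "\<dots> \<in> \<rat>" using p(1) by (intro Rats_sum) (auto simp: rat_functional_def)
    finally have "\<phi> (\<beta> N (fcalc N (\<lambda>c. of_real (\<phi> (Re c)))) * 1) = 0"
      using p(1,2) unfolding rat_functional_def by (metis mult_zero_right)
    then show False using spectrum_vanish(1)[OF Nh sp p(1)] p(3) by simp
  qed
  ultimately have "c = of_real (Re c)" by (simp add: complex_eq_iff)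
  moreover obtain a b where "Re c = of_int a / of_int b"
    using \<open>Re c \<in> \<rat>\<close> by (auto elim: Rats_cases')
  ultimately have "c = of_int a / of_int b" by simp
  then show ?thesis by simp
qed

lemma pre_einstein_conj:
  assumes N: "N \<in> pre_einstein" and p: "p \<in> H"
  shows "p \<circ> N \<circ> inv p \<in> pre_einstein"
proof -
  have Nh: "N \<in> h" "is_diagonalizable scale N" and \<beta>N: "\<And>B. B \<in> h \<Longrightarrow> \<beta> N B = Re (tr B)"
    using N by (auto simp: pre_einstein_def)
  have lp: "lin p" "lin (inv p)" using H_lin[OF p] lin_inv[OF H_lin[OF p] H_bij[OF p]] by auto
  have i: "inv p \<circ> p = id" "p \<circ> inv p = id" using H_bij[OF p] by (auto simp: bij_is_inj bij_is_surj surj_iff[symmetric])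
  note l = h_lin[OF Nh(1)]
  have "\<beta> (p \<circ> N \<circ> inv p) B = Re (tr B)" if B: "B \<in> h" for B
  proof -
    have "tr (p \<circ> N \<circ> inv p \<circ> B) = tr (inv p \<circ> B \<circ> (p \<circ> N))"
      using tr_comm[of "p \<circ> N" "inv p \<circ> B"] lp l h_lin[OF B] by (simp add: lin_comp o_assoc)
    also have "\<dots> = tr ((inv p \<circ> B \<circ> p) \<circ> N)" by (simp add: o_assoc)
    also have "\<dots> = tr (N \<circ> (inv p \<circ> B \<circ> p))"
      using lp l h_lin[OF B] by (intro tr_comm lin_comp)
    finally have "\<beta> (p \<circ> N \<circ> inv p) B = \<beta> N (inv p \<circ> B \<circ> p)" by (simp add: \<beta>_def)
    also have "\<dots> = Re (tr (inv p \<circ> B \<circ> p))" by (rule \<beta>N[OF H_conj_inv[OF p B]])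
    finally show ?thesis using tr_conj[OF h_lin[OF B] lp(2,1) i(2)] by simp
  qed
  then show ?thesis
    using H_conj[OF p Nh(1)] diagonalizable_conj[OF l Nh(2) lp(1) H_bij[OF p]]
    by (simp add: pre_einstein_def)
qed

section \<open>Conjugacy of two solutions\<close>

lemma pre_einstein_diff: "N \<in> pre_einstein \<Longrightarrow> N' \<in> pre_einstein \<Longrightarrow> N' - N \<in> rad"
  by (auto simp: pre_einstein_def rad_def h_diff \<beta>_diff h_lin)

text \<open>With N' = N + A + [N, E], conjugation by exp E gives N' + [E, N'] + ... = N + A up to
  maps lowering the flag by k + 1 steps; the two commutators of E and N cancel.\<close>

lemma conj_step:
  assumes N: "N \<in> pre_einstein" "N' \<in> pre_einstein" and k: "k \<ge> 1"
    and D: "\<forall>j. \<forall>x\<in>V (j + k). (N' - N) x \<in> V j"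
  shows "\<exists>p\<in>H. \<forall>j. \<forall>x\<in>V (j + Suc k). ((p \<circ> N' \<circ> inv p) - N) x \<in> V j"
proof -
  have Nh: "N \<in> h" "N' \<in> h" and Nd: "is_diagonalizable scale N" using N by (auto simp: pre_einstein_def)
  note l = h_lin[OF Nh(1)] and l' = h_lin[OF Nh(2)]
  \<comment> \<open>The part of \<open>rad\<close> lowering the flag by k steps. It is stable under
    bracketing with N, so the decomposition of N' - N stays inside it.\<close>
  let ?M = "{A \<in> rad. \<forall>j. \<forall>x\<in>V (j + k). A x \<in> V j}"
  have "\<exists>A\<in>?M. \<exists>E\<in>?M. N' - N = A + comm N E \<and> comm N A = 0"
  proof (rule ad_decomposition[OF l Nd])
    show "lin A" if "A \<in> ?M" for A using that rad_lin by blast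
    show "A + B \<in> ?M" if "A \<in> ?M" "B \<in> ?M" for A B using that by (auto simp: rad_add V_add)
    show "rscale c A \<in> ?M" if "A \<in> ?M" for c A
      using that by (auto simp: rad_rscale subspace_scale[OF V_subspace])
    show "comm N A \<in> ?M" if "A \<in> ?M" for A
      using that by (auto simp: rad_comm' Nh comm_apply V_diff V_stable)
    show "N' - N \<in> ?M" using pre_einstein_diff[OF N] D by blast
  qed
  then obtain A E where A: "A \<in> rad" "\<forall>j. \<forall>x\<in>V (j + k). A x \<in> V j"
    and E: "E \<in> rad" "\<forall>j. \<forall>x\<in>V (j + k). E x \<in> V j"
    and AE: "N' - N = A + comm N E" "comm N A = 0" by blast
  have A': "A x \<in> V (Suc j)" and E': "E x \<in> V (Suc j)" and D': "(N' - N) x \<in> V (Suc j)"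
    if "x \<in> V (j + Suc k)" for x j
    using A(2)[rule_format, of x "Suc j"] E(2)[rule_format, of x "Suc j"] D[rule_format, of x "Suc j"] that
    by (simp_all del: flag.simps)
  have lA: "lin A" and lE: "lin E" using A(1) E(1) rad_lin by blast+
  have rl: "B x \<in> V (j - 1)" if "B \<in> rad" "x \<in> V j" for B x j using flag_lower'[OF rad_lin] that by blast
  have V0: "0 \<in> V j" for j by (rule subspace_0[OF V_subspace])
  have E2: "E x \<in> V j" if x: "x \<in> V (Suc j)" for x j using E(1) x by simp
  have E2': "E x \<in> V j" if x: "x \<in> V j" for x j using V_stable[OF rad_h[OF E(1)] x] .
  obtain K0 where K0: "\<And>x. (E ^^ K0) x = 0" using rad_nilpotent[OF E(1)] by (auto simp: nilpotent_def)
  \<comment> \<open>The two extra terms guarantee that x and E x can be split off the series in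
    \<open>first\<close>, even for K0 = 0.\<close>
  define K where "K = K0 + 2"
  have K: "\<forall>x. (E ^^ K) x = 0" using funpow_nilpotent_ge[of K0 E K] K0 by (auto simp: K_def)
  define p where "p = nexp K E"
  have p: "p \<in> H" unfolding p_def by (rule H_nexp[OF rad_h[OF E(1)] K])
  note lp = H_lin[OF p] and bp = H_bij[OF p]
  have ip: "inv p = nexp K (- E)" unfolding p_def by (rule inv_nexp[OF lE K])
  have V_nexp: "nexp K B x \<in> V j" if "B \<in> h" "x \<in> V j" for B x j
  proof -
    have "(B ^^ i) x \<in> V j" for i using that by (induction i) (auto simp: V_stable)
    then show ?thesis unfolding nexp_def by (intro subspace_sum[OF V_subspace] subspace_scale[OF V_subspace])
  qed
  have first: "p x - x - E x \<in> V j" if x: "x \<in> V (j + Suc k)" for x j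
  proof -
    have "E x \<in> V (Suc j)" using E'[OF x] .
    then have "E (E x) \<in> V j" using E2 by blast
    then have Ei: "(E ^^ (i + 2)) x \<in> V j" for i
      by (induction i) (auto simp: E2')
    have "p x = (\<Sum>i<Suc (Suc K0). scale (inverse (fact i)) ((E ^^ i) x))" by (simp add: p_def nexp_def K_def)
    also have "\<dots> = x + (E x + (\<Sum>i<K0. scale (inverse (fact (i + 2))) ((E ^^ (i + 2)) x)))"
      by (simp only: sum.lessThan_Suc_shift) (simp add: numeral_2_eq_2 del: fact_Suc)
    finally have "p x - x - E x = (\<Sum>i<K0. scale (inverse (fact (i + 2))) ((E ^^ (i + 2)) x))" by simp
    then show ?thesis
      using Ei by (simp only:) (intro subspace_sum[OF V_subspace] subspace_scale[OF V_subspace])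
  qed
  define Y where "Y = (p \<circ> N' \<circ> inv p) - N"
  have Yr: "Y \<in> rad" unfolding Y_def by (rule pre_einstein_diff[OF N(1) pre_einstein_conj[OF N(2) p]])
  have lead: "Y x - A x \<in> V j" if x: "x \<in> V (j + Suc k)" for x j
  proof -
    \<comment> \<open>Written in z, the conjugate at x is p (N' z), so only p has to be expanded; of
      its inverse only the stability of the flag is used.\<close>
    define z where "z = inv p x"
    have z: "z \<in> V (j + Suc k)" unfolding z_def ip by (rule V_nexp[OF h_uminus[OF rad_h[OF E(1)]] x])
    have pz: "p z = x" using bp by (simp add: z_def bij_is_surj surj_f_inv_f)
    have Ez: "E z \<in> V (Suc j)" using E'[OF z] .
    have "x - z = (p z - z - E z) + E z" using pz by simp
    also have "\<dots> \<in> V (Suc j)" using V_mono[OF _ first[OF z], of "Suc j"] Ez by (intro V_add) auto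
    finally have m: "A (x - z) \<in> V j" using A(1) by simp
    have t1: "A z - A x \<in> V j"
      using subspace_neg[OF V_subspace m] by (simp add: lin_diff[OF lA])
    let ?a = "p (N' z) - N' z - E (N' z)" and ?b = "N (p z - z - E z)"
    have t2: "?a \<in> V j" by (rule first[OF V_stable[OF Nh(2) z]])
    have t3: "?b \<in> V j" by (rule V_stable[OF Nh(1) first[OF z]])
    have "N' z - N z = A z + (N (E z) - E (N z))"
      using fun_cong[OF AE(1), of z] by (simp add: comm_apply)
    then have Dz: "N' z = N z + A z + (N (E z) - E (N z))" by (simp add: algebra_simps)
    have Yx: "Y x = p (N' z) - N x" by (simp add: Y_def z_def)
    have b: "?b = N x - N z - N (E z)" by (simp add: lin_diff[OF l] pz)
    have e: "E (N' z - N z) = E (N' z) - E (N z)" by (rule lin_diff[OF lE])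
    \<comment> \<open>Regroups Y x - A x into four differences in V j: the remainders of p at N' z
      and, under N, at z; E applied to (N' - N) z; and A (z - x).\<close>
    have alg: "w = nz + az + (nez - enz) \<Longrightarrow>
        u - nx - ax = (u - w - v) - (nx - nz - nez) + (v - enz) + (az - ax)"
      for u v w nx ax nz az nez enz :: 'a
      by (simp add: algebra_simps)
    have t4: "E (N' z - N z) \<in> V j" using E2[OF D'[OF z]] by simp
    have "Y x - A x = ?a - ?b + E (N' z - N z) + (A z - A x)"
      unfolding Yx b e by (rule alg[OF Dz])
    also have "\<dots> \<in> V j" by (intro V_add V_diff t1 t2 t3 t4)
    finally show ?thesis .
  qed
  \<comment> \<open>A x is again an eigenvector of N for c, so modulo V j the conjugate minus c
    sends x to A x and A x to 0. Being diagonalizable, it has no such Jordan block, and Y x lies in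
    V j.\<close>
  have eig: "Y x \<in> V j" if x: "x \<in> V (j + Suc k)" and c: "N x = scale c x" for x j c
  proof -
    let ?N = "p \<circ> N' \<circ> inv p"
    have Np: "?N \<in> pre_einstein" by (rule pre_einstein_conj[OF N(2) p])
    have Nph: "?N \<in> h" "is_diagonalizable scale ?N" using Np by (auto simp: pre_einstein_def)
    note lN = h_lin[OF Nph(1)]
    have NY: "?N u = N u + Y u" for u by (simp add: Y_def)
    have Y1: "Y x = ?N x - scale c x" using NY[of x] c by simp
    let ?f = "Y x - A x"
    have f: "?f \<in> V j" by (rule lead[OF x])
    have "N (A x) = A (N x)" using fun_cong[OF AE(2), of x] by (simp add: comm_apply)
    then have NA: "N (A x) = scale c (A x)" using c lA by (simp add: lin_scale)
    have YA: "Y (A x) \<in> V j" using A'[OF x] Yr by simp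
    have "?N (Y x) - scale c (Y x) = Y (A x) + (?N ?f - scale c ?f)"
      using NY[of "A x"] NA lN by (simp only: lin_diff scale_right_diff_distrib) simp
    also have "\<dots> \<in> V j"
      by (intro V_add V_diff YA V_stable[OF Nph(1) f] subspace_scale[OF V_subspace] f)
    finally have "?N (Y x) - scale c (Y x) \<in> V j" .
    then show ?thesis
      using diagonalizable_on_quotient[OF lN Nph(2) V_subspace V_stable[OF Nph(1)] Y1] by blast
  qed
  have "Y x \<in> V j" if x: "x \<in> V (j + Suc k)" for x j
  proof -
    have lY: "lin Y" using Yr rad_lin by blast
    \<comment> \<open>The eigencomponents of x stay in its term of the flag, because that term is
      N-stable.\<close>
    have "Y (spec_proj N c x) \<in> V j" for c
    proof (rule eig)
      show "spec_proj N c x \<in> V (j + Suc k)"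
        using fcalc_stable[OF l V_subspace _ x] V_stable[OF Nh(1)] by blast
      show "N (spec_proj N c x) = scale c (spec_proj N c x)"
        using diagonalizable_eigenspace[OF l Nd] spec_proj_in[OF l] by blast
    qed
    then have "(\<Sum>c\<in>spectrum N. Y (spec_proj N c x)) \<in> V j" by (intro subspace_sum[OF V_subspace])
    then show ?thesis using spec_proj_sum[OF l, of x] lin_sum[OF lY] by metis
  qed
  then show ?thesis using p unfolding Y_def by blast
qed

lemma pre_einstein_conjugate:
  assumes N: "N \<in> pre_einstein" "N' \<in> pre_einstein"
  shows "\<exists>p\<in>H. N = p \<circ> N' \<circ> inv p"
proof -
  obtain d where d: "V d = UNIV" using V_full by blast
  have "\<exists>p\<in>H. \<forall>j. \<forall>x\<in>V (j + Suc k). ((p \<circ> N' \<circ> inv p) - N) x \<in> V j" for k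
  proof (induction k)
    case 0
    have "N' - N \<in> rad" by (rule pre_einstein_diff[OF N])
    then show ?case by (intro bexI[OF _ H_id]) auto
  next
    case (Suc k)
    then obtain p where p: "p \<in> H" "\<forall>j. \<forall>x\<in>V (j + Suc k). ((p \<circ> N' \<circ> inv p) - N) x \<in> V j" by blast
    obtain q where q: "q \<in> H"
      "\<forall>j. \<forall>x\<in>V (j + Suc (Suc k)). ((q \<circ> (p \<circ> N' \<circ> inv p) \<circ> inv q) - N) x \<in> V j"
      using conj_step[OF N(1) pre_einstein_conj[OF N(2) p(1)] _ p(2)] by auto
    have eq: "q \<circ> (p \<circ> N' \<circ> inv p) \<circ> inv q = (q \<circ> p) \<circ> N' \<circ> inv (q \<circ> p)"
      by (simp add: o_inv_distrib[OF H_bij[OF q(1)] H_bij[OF p(1)]] o_assoc)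
    show ?case using q(2)[unfolded eq] H_comp[OF q(1) p(1)] by blast
  qed
  from this[of d] obtain p where p: "p \<in> H" "\<forall>j. \<forall>x\<in>V (j + Suc d). ((p \<circ> N' \<circ> inv p) - N) x \<in> V j" by blast
  \<comment> \<open>With j = 0 the difference sends the whole space into V 0 = {0}.\<close>
  have "V (Suc d) = UNIV" using flag_Suc_mono[OF rad_lin, of d] d by auto
  then have "((p \<circ> N' \<circ> inv p) - N) x = 0" for x using p(2)[rule_format, of x 0] by simp
  then have "N = p \<circ> N' \<circ> inv p" by (simp add: fun_eq_iff)
  then show ?thesis using p(1) by blast
qed

end

lemma funpow_times: "((\<lambda>t. l * t) ^^ k) t = l ^ k * (t::'k::comm_monoid_mult)"
  by (induction k) (auto simp: mult.assoc)

section \<open>Conformal derivations and conformal automorphisms\<close>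

locale metric_algebra = vspace scale
  for scale :: "'k::field_char_0 \<Rightarrow> 'v::ab_group_add \<Rightarrow> 'v" +
  fixes bracket :: "'v \<Rightarrow> 'v \<Rightarrow> 'v" and g :: "'v \<Rightarrow> 'v \<Rightarrow> 'k"
  assumes bracket_lin: "\<And>y. lin (\<lambda>x. bracket x y)" "\<And>x. lin (\<lambda>y. bracket x y)"
    and form_linear: "\<And>y. Vector_Spaces.linear scale (*) (\<lambda>x. g x y)"
      "\<And>x. Vector_Spaces.linear scale (*) (\<lambda>y. g x y)"
begin

lemma bracket_simps:
  "bracket (x + x') y = bracket x y + bracket x' y" "bracket x (y + y') = bracket x y + bracket x y'"
  "bracket (x - x') y = bracket x y - bracket x' y" "bracket x (y - y') = bracket x y - bracket x y'"
  "bracket (scale c x) y = scale c (bracket x y)" "bracket x (scale c y) = scale c (bracket x y)"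
  "bracket 0 y = 0" "bracket x 0 = 0"
  using lin_add[OF bracket_lin(1)] lin_add[OF bracket_lin(2)] lin_diff[OF bracket_lin(1)]
    lin_diff[OF bracket_lin(2)] lin_scale[OF bracket_lin(1)] lin_scale[OF bracket_lin(2)]
    lin_zero[OF bracket_lin(1)] lin_zero[OF bracket_lin(2)] by blast+

lemma form_simps:
  "g (x + x') y = g x y + g x' y" "g x (y + y') = g x y + g x y'"
  "g (scale c x) y = c * g x y" "g x (scale c y) = c * g x y"
  using form_linear by (simp_all add: Vector_Spaces.linear_iff)

lemma form_simps':
  "g 0 y = 0" "g x 0 = 0" "g (- x) y = - g x y" "g x (- y) = - g x y"
  "g (x - x') y = g x y - g x' y" "g x (y - y') = g x y - g x y'"
proof -
  show 1: "g 0 y = 0" "g x 0 = 0" for x y using form_simps(3)[of 0 0 y] form_simps(4)[of x 0 0] by simp_all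
  show 2: "g (- x) y = - g x y" "g x (- y) = - g x y" for x y
    using form_simps(3)[of "-1" x y] form_simps(4)[of x "-1" y] by simp_all
  show "g (x - x') y = g x y - g x' y" "g x (y - y') = g x y - g x y'"
    using form_simps(1)[of x "- x'" y] form_simps(2)[of x y "- y'"] by (simp_all add: 2)
qed

definition alg :: "('v \<Rightarrow> 'v) set" where
  "alg = conf_algebra scale g \<inter> lie_derivations scale bracket"

definition grp :: "('v \<Rightarrow> 'v) set" where
  "grp = conf_group scale g \<inter> lie_automorphisms scale bracket"

lemma alg_iff: "A \<in> alg \<longleftrightarrow> lin A \<and> (\<exists>l. \<forall>x y. g (A x) y + g x (A y) = l * g x y) \<and>
    (\<forall>x y. A (bracket x y) = bracket (A x) y + bracket x (A y))"
  by (auto simp: alg_def conf_algebra_def lie_derivations_def)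

lemma grp_iff: "p \<in> grp \<longleftrightarrow> lin p \<and> bij p \<and> (\<exists>l. \<forall>x y. g (p x) (p y) = l * g x y) \<and>
    (\<forall>x y. p (bracket x y) = bracket (p x) (p y))"
  by (auto simp: grp_def conf_group_def lie_automorphisms_def)

lemma alg_lin: "A \<in> alg \<Longrightarrow> lin A"
  by (simp add: alg_iff)

lemma alg_0: "0 \<in> alg"
  by (auto simp: alg_iff lin_0 form_simps' bracket_simps intro: exI[of _ 0])

lemma alg_add:
  assumes "A \<in> alg" "B \<in> alg"
  shows "A + B \<in> alg"
proof -
  from assms obtain k l where "\<And>x y. g (A x) y + g x (A y) = k * g x y" "\<And>x y. g (B x) y + g x (B y) = l * g x y"
    unfolding alg_iff by auto
  then have "g ((A + B) x) y + g x ((A + B) y) = (k + l) * g x y" for x y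
    by (simp add: form_simps distrib_right) (metis add.assoc add.commute)
  then show ?thesis using assms by (auto simp: alg_iff lin_plus bracket_simps simp del: plus_fun_apply) (simp add: algebra_simps bracket_simps)
qed

lemma alg_smul:
  assumes "A \<in> alg"
  shows "(\<lambda>x. scale c (A x)) \<in> alg"
proof -
  from assms obtain k where k: "\<And>x y. g (A x) y + g x (A y) = k * g x y"
    unfolding alg_iff by auto
  then have "g (scale c (A x)) y + g x (scale c (A y)) = (c * k) * g x y" for x y
    by (simp add: form_simps distrib_left[symmetric] mult.assoc)
  then show ?thesis using assms by (auto simp: alg_iff lin_smul bracket_simps scale_right_distrib)
qed

lemma alg_comm:
  assumes "A \<in> alg" "B \<in> alg"
  shows "comm A B \<in> alg"
proof -
  from assms obtain k l where kl: "\<And>x y. g (A x) y = k * g x y - g x (A y)" "\<And>x y. g (B x) y = l * g x y - g x (B y)"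
    unfolding alg_iff by (metis add_diff_cancel_right')
  have lin: "lin A" "lin B" using assms by (simp_all add: alg_lin)
  have "lin (comm A B)"
    using lin by (auto simp: comm_def lin_iff scale_right_diff_distrib)
  moreover have "g (comm A B x) y + g x (comm A B y) = 0 * g x y" for x y
    by (simp add: comm_apply form_simps' kl algebra_simps)
  moreover have "comm A B (bracket x y) = bracket (comm A B x) y + bracket x (comm A B y)" for x y
    using assms lin by (simp add: comm_apply alg_iff bracket_simps lin_add)
  ultimately show ?thesis unfolding alg_iff by blast
qed

lemma grp_id: "id \<in> grp"
  by (auto simp: grp_iff lin_id intro: exI[of _ 1])

lemma grp_comp:
  assumes "p \<in> grp" "q \<in> grp"
  shows "p \<circ> q \<in> grp"
proof -
  from assms obtain k l where "\<And>x y. g (p x) (p y) = k * g x y" "\<And>x y. g (q x) (q y) = l * g x y"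
    unfolding grp_iff by auto
  then have "g ((p \<circ> q) x) ((p \<circ> q) y) = (k * l) * g x y" for x y by simp
  then show ?thesis using assms unfolding grp_iff by (auto intro: lin_comp bij_comp)
qed

lemma grp_inv:
  assumes "p \<in> grp"
  shows "inv p \<in> grp"
proof -
  from assms obtain k where k: "\<And>x y. g (p x) (p y) = k * g x y" and p: "lin p" "bij p"
    "\<And>x y. p (bracket x y) = bracket (p x) (p y)"
    unfolding grp_iff by auto
  have pi: "p (inv p x) = x" "inv p (p x) = x" for x using p(2) by (simp_all add: bij_is_inj bij_is_surj surj_f_inv_f)
  have eq: "g x y = k * g (inv p x) (inv p y)" for x y using k[of "inv p x" "inv p y"] by (simp add: pi)
  have "g (inv p x) (inv p y) = inverse k * g x y" for x y
  \<comment> \<open>A factor k = 0 forces the form to vanish, and then inverse 0 = 0 is a valid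
    factor as well.\<close>
  proof (cases "k = 0")
    case True
    then show ?thesis using eq by (metis mult_zero_left mult_zero_right)
  next
    case False
    then show ?thesis by (subst eq) simp
  qed
  moreover have "inv p (bracket x y) = bracket (inv p x) (inv p y)" for x y
    using p(3)[of "inv p x" "inv p y"] pi by metis
  ultimately show ?thesis using p unfolding grp_iff by (auto intro: lin_inv bij_imp_bij_inv)
qed

lemma grp_conj:
  assumes "p \<in> grp" "A \<in> alg"
  shows "p \<circ> A \<circ> inv p \<in> alg"
proof -
  from assms(1) obtain k where k: "\<And>x y. g (p x) (p y) = k * g x y" and p: "lin p" "bij p"
    "\<And>x y. p (bracket x y) = bracket (p x) (p y)"
    unfolding grp_iff by auto
  from assms(2) obtain l where l: "\<And>x y. g (A x) y + g x (A y) = l * g x y" and A: "lin A"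
    "\<And>x y. A (bracket x y) = bracket (A x) y + bracket x (A y)"
    unfolding alg_iff by auto
  have pi: "p (inv p x) = x" "inv p (p x) = x" for x using p(2) by (simp_all add: bij_is_inj bij_is_surj surj_f_inv_f)
  let ?B = "p \<circ> A \<circ> inv p"
  have "g (?B (p x)) (p y) + g (p x) (?B (p y)) = l * g (p x) (p y)" for x y
    using l[of x y] by (simp add: k pi distrib_left[symmetric])
  then have "g (?B x) y + g x (?B y) = l * g x y" for x y by (metis pi(1))
  moreover have "?B (bracket (p x) (p y)) = bracket (?B (p x)) (p y) + bracket (p x) (?B (p y))" for x y
    by (simp add: p(3)[symmetric] pi A(2) lin_add[OF p(1)])
  then have "?B (bracket x y) = bracket (?B x) y + bracket x (?B y)" for x y by (metis pi(1))
  moreover have "lin ?B" using A(1) p by (intro lin_comp lin_inv)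
  ultimately show ?thesis unfolding alg_iff by blast
qed

lemma grp_conj_inv:
  assumes "p \<in> grp" "A \<in> alg"
  shows "inv p \<circ> A \<circ> p \<in> alg"
proof -
  have "bij p" using assms(1) by (simp add: grp_iff)
  then show ?thesis using grp_conj[OF grp_inv[OF assms(1)] assms(2)] by (simp add: inv_inv_eq)
qed

lemma grp_nexp:
  assumes A: "A \<in> alg" and K: "\<forall>x. (A ^^ K) x = 0"
  shows "nexp K A \<in> grp"
proof -
  from A obtain l where l: "\<And>x y. g (A x) y + g x (A y) = l * g x y" and lin: "lin A"
    and der: "\<And>x y. A (bracket x y) = bracket (A x) y + bracket x (A y)"
    unfolding alg_iff by auto
  interpret f: vspace "(*) :: 'k \<Rightarrow> 'k \<Rightarrow> 'k" by unfold_locales (auto simp: algebra_simps)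
  have "nexp (2 * K) A (bracket x y) = bracket (nexp K A x) (nexp K A y)" for x y
    by (rule nexp_bilinear[where m = bracket and ?E1.0 = A and ?E2.0 = A])
      (use bracket_lin lin der K in auto)
  then have "nexp K A (bracket x y) = bracket (nexp K A x) (nexp K A y)" for x y
    using nexp_cut[OF K, of "2 * K" "bracket x y"] by simp
  \<comment> \<open>The form is treated as a bilinear map to the scalars, on which A corresponds to
    multiplication by l; the conformal factor is thus the truncated series of exp l.\<close>
  moreover have "g (nexp K A x) (nexp K A y) = (\<Sum>k<2 * K. inverse (fact k) * l ^ k) * g x y" for x y
  proof -
    have "f.lin (\<lambda>t. l * t)"
    proof (rule f.linI)
      show "l * (t + u) = l * t + l * u" "l * (c * t) = c * (l * t)" for t u c
        by (rule distrib_left, rule mult.left_commute)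
    qed
    then have "f.nexp (2 * K) (\<lambda>t. l * t) (g x y) = g (nexp K A x) (nexp K A y)"
      by (intro nexp_bilinear[where m = g and ?E1.0 = A and ?E2.0 = A] form_linear K l[symmetric])
    then show ?thesis unfolding f.nexp_def funpow_times sum_distrib_right mult.assoc by (rule sym)
  qed
  ultimately show ?thesis
    unfolding grp_iff using lin_nexp[OF lin] bij_nexp[OF lin K] by blast
qed

end

lemma metric_algebraI:
  fixes scale :: "'k::field_char_0 \<Rightarrow> 'v::ab_group_add \<Rightarrow> 'v"
  assumes "fd_lie_algebra scale bracket" "is_metric scale g"
  shows "metric_algebra scale bracket g"
proof -
  interpret fd_lie_algebra scale bracket by fact
  show ?thesis
  proof (intro metric_algebra.intro metric_algebra_axioms.intro vspace.intro)
    show "Vector_Spaces.linear scale (*) (\<lambda>x. g x y)" for y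
      using assms(2) unfolding is_metric_def by blast
    show "Vector_Spaces.linear scale (*) (\<lambda>y. g x y)" for x
      using assms(2) unfolding is_metric_def by blast
  qed (rule vector_space_axioms bracket_linear_left bracket_linear_right)+
qed

section \<open>Functions of conformal derivations\<close>

text \<open>The power i + j of E expands into terms m (A^p x) (B^q y) with p + q = i + j, so p \<ge>
  i or q \<ge> j in each. It is applied to D shifted by a + b, a and b.\<close>

lemma leibniz_nilpotent:
  fixes m :: "'a::zero \<Rightarrow> 'b::zero \<Rightarrow> 'c::ab_group_add"
  assumes E: "\<And>x y. E (x + y) = E x + E y" and m: "\<And>x y. E (m x y) = m (A x) y + m x (B y)"
    "\<And>y. m 0 y = 0" "\<And>x. m x 0 = 0" and "(A ^^ i) x = 0" "(B ^^ j) y = 0"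
  shows "(E ^^ (i + j)) (m x y) = 0"
  using assms(5,6)
proof (induction "i + j" arbitrary: i j x y)
  case 0
  then show ?case using m by simp
next
  case (Suc n)
  have E0: "E 0 = 0" using E[of 0 0] by simp
  have Ez: "(E ^^ k) 0 = 0" for k by (induction k) (auto simp: E0)
  have Ea: "(E ^^ k) (u + v) = (E ^^ k) u + (E ^^ k) v" for k u v by (induction k) (auto simp: E)
  show ?case
  proof (cases "i = 0 \<or> j = 0")
    case True
    then have "m x y = 0" using Suc.prems m by auto
    then show ?thesis by (simp add: Ez)
  next
    case False
    then obtain i' j' where ij: "i = Suc i'" "j = Suc j'" by (metis not0_implies_Suc)
    have "(E ^^ (i' + j)) (m (A x) y) = 0"
      using Suc.hyps(2) Suc.prems ij by (intro Suc.hyps(1)) (auto simp: funpow_swap1)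
    moreover have "(E ^^ (i + j')) (m x (B y)) = 0"
      using Suc.hyps(2) Suc.prems ij by (intro Suc.hyps(1)) (auto simp: funpow_swap1)
    moreover have "(E ^^ (i + j)) (m x y) = (E ^^ (i' + j)) (m (A x) y) + (E ^^ (i + j')) (m x (B y))"
      using ij by (simp add: funpow_swap1 m(1) Ea E)
    ultimately show ?thesis by simp
  qed
qed

context complex_endo
begin

text \<open>m sends the generalized eigenspaces for a and b into the one for a + b, where f (a + b)
  = f a + f b is the claim.\<close>

lemma fcalc_bilinear:
  assumes D: "lin D" and f: "\<And>x y. f (x + y) = f x + f y"
    and m: "\<And>y. lin (\<lambda>x. m x y)" "\<And>x. lin (\<lambda>y. m x y)"
    and der: "\<And>x y. D (m x y) = m (D x) y + m x (D y)"
  shows "fcalc D f (m x y) = m (fcalc D f x) y + m x (fcalc D f y)"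
proof -
  let ?F = "fcalc D f"
  note lF = lin_fcalc[OF D]
  note ms = lin_add[OF m(1)] lin_add[OF m(2)] lin_scale[OF m(1)] lin_scale[OF m(2)]
    lin_zero[OF m(1)] lin_zero[OF m(2)] lin_diff[OF m(1)] lin_diff[OF m(2)]
  have gen: "?F (m x y) = m (?F x) y + m x (?F y)"
    if x: "x \<in> gen_eigenspace D a" and y: "y \<in> gen_eigenspace D b" for a b x y
  proof -
    obtain i j where ij: "((\<lambda>z. D z - scale a z) ^^ i) x = 0" "((\<lambda>z. D z - scale b z) ^^ j) y = 0"
      using x y gen_eigenspace_funpow[OF D] by blast
    have "((\<lambda>z. D z - scale (a + b) z) ^^ (i + j)) (m x y) = 0"
    proof (rule leibniz_nilpotent[OF _ _ _ _ ij])
      show "D (m x y) - scale (a + b) (m x y) = m (D x - scale a x) y + m x (D y - scale b y)" for x y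
        by (simp only: der ms scale_left_distrib) (simp add: algebra_simps)
    qed (simp_all add: ms lin_add[OF D] scale_right_distrib)
    then have "m x y \<in> gen_eigenspace D (a + b)" using gen_eigenspace_funpow[OF D] by blast
    then show ?thesis using fcalc_eq[OF D] x y by (simp add: f ms scale_left_distrib)
  qed
  have 1: "x \<in> {x. ?F (m x y) = m (?F x) y + m x (?F y)}" if y: "y \<in> gen_eigenspace D b" for x y b
  proof (rule gen_eigenspaces_span[OF D])
    show "subspace {x. ?F (m x y) = m (?F x) y + m x (?F y)}"
      unfolding subspace_def
      by (auto simp: ms lin_add[OF lF] lin_scale[OF lF] lin_zero[OF lF] scale_right_distrib)
  qed (use gen y in blast)
  have "y \<in> {y. ?F (m x y) = m (?F x) y + m x (?F y)}"
  proof (rule gen_eigenspaces_span[OF D])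
    show "subspace {y. ?F (m x y) = m (?F x) y + m x (?F y)}"
      unfolding subspace_def
      by (auto simp: ms lin_add[OF lF] lin_scale[OF lF] lin_zero[OF lF] scale_right_distrib)
  qed (use 1 in blast)
  then show ?thesis by simp
qed

text \<open>Generalized eigenspaces for a and b are orthogonal unless a + b = l, since a power of l
  - (a + b) kills g x y. Hence f l appears as the new conformal constant.\<close>

lemma fcalc_form:
  assumes D: "lin D" and f: "\<And>x y. f (x + y) = f x + f y"
    and g: "\<And>y. Vector_Spaces.linear scale (*) (\<lambda>x. g x y)" "\<And>x. Vector_Spaces.linear scale (*) (\<lambda>y. g x y)"
    and conf: "\<And>x y. g (D x) y + g x (D y) = l * g x y"
  shows "g (fcalc D f x) y + g x (fcalc D f y) = f l * g x y"
proof -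
  let ?F = "fcalc D f"
  note lF = lin_fcalc[OF D]
  \<comment> \<open>The zero bracket is a dummy that gives access to the rules for bilinear
    forms.\<close>
  interpret metric_algebra scale "\<lambda>_ _. 0" g
    by (intro metric_algebra.intro metric_algebra_axioms.intro vspace_axioms lin_0 g)
  have gen: "g (?F x) y + g x (?F y) = f l * g x y"
    if x: "x \<in> gen_eigenspace D a" and y: "y \<in> gen_eigenspace D b" for a b x y
  proof -
    obtain i j where ij: "((\<lambda>z. D z - scale a z) ^^ i) x = 0" "((\<lambda>z. D z - scale b z) ^^ j) y = 0"
      using x y gen_eigenspace_funpow[OF D] by blast
    have "((\<lambda>t. (l - (a + b)) * t) ^^ (i + j)) (g x y) = 0"
    proof (rule leibniz_nilpotent[OF _ _ _ _ ij])
      show "(l - (a + b)) * g x y = g (D x - scale a x) y + g x (D y - scale b y)" for x y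
        using conf[of x y] by (simp add: form_simps form_simps' algebra_simps)
    qed (simp_all add: form_simps' algebra_simps)
    then have "l = a + b \<or> g x y = 0" unfolding funpow_times by auto
    then show ?thesis using fcalc_eq[OF D] x y by (auto simp: f form_simps algebra_simps)
  qed
  have 1: "x \<in> {x. g (?F x) y + g x (?F y) = f l * g x y}" if y: "y \<in> gen_eigenspace D b" for x y b
  proof (rule gen_eigenspaces_span[OF D])
    have "c * a + c * b = f l * (c * d)" if "a + b = f l * d" for a b c d
      using that by (metis distrib_left mult.left_commute)
    moreover have "a + a' + (b + b') = f l * (d + d')" if "a + b = f l * d" "a' + b' = f l * d'" for a a' b b' d d'
      using that by (simp add: algebra_simps)
    ultimately show "subspace {x. g (?F x) y + g x (?F y) = f l * g x y}"
      unfolding subspace_def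
      by (simp add: form_simps form_simps' lin_add[OF lF] lin_scale[OF lF] lin_zero[OF lF])
  qed (use gen y in blast)
  have "y \<in> {y. g (?F x) y + g x (?F y) = f l * g x y}"
  proof (rule gen_eigenspaces_span[OF D])
    have "c * a + c * b = f l * (c * d)" if "a + b = f l * d" for a b c d
      using that by (metis distrib_left mult.left_commute)
    moreover have "a + a' + (b + b') = f l * (d + d')" if "a + b = f l * d" "a' + b' = f l * d'" for a a' b b' d d'
      using that by (simp add: algebra_simps)
    ultimately show "subspace {y. g (?F x) y + g x (?F y) = f l * g x y}"
      unfolding subspace_def
      by (simp add: form_simps form_simps' lin_add[OF lF] lin_scale[OF lF] lin_zero[OF lF])
  qed (use 1 in blast)
  then show ?thesis by simp
qed

end

lemma fd_lie_algebra_basis: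
  assumes "fd_lie_algebra scale bracket"
  obtains B where "finite_dimensional_vector_space scale B"
proof -
  interpret fd_lie_algebra scale bracket by fact
  obtain S where S: "finite S" "span S = UNIV" using finite_dimensional by blast
  obtain B where B: "B \<subseteq> S" "independent B" "S \<subseteq> span B" by (rule maximal_independent_subset)
  have "span S \<subseteq> span B" using B(3) by (intro span_minimal) auto
  then have "finite_dimensional_vector_space scale B"
    using S B finite_subset by unfold_locales auto
  then show ?thesis by (rule that)
qed

section \<open>The complex case\<close>

lemma algebraic_pair_complex:
  fixes scale :: "complex \<Rightarrow> 'w::ab_group_add \<Rightarrow> 'w"
  assumes "metric_algebra scale bracket g" "finite_dimensional_vector_space scale B"
  shows "algebraic_pair scale B (metric_algebra.alg scale bracket g) (metric_algebra.grp scale bracket g)"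
proof -
  interpret metric_algebra scale bracket g by fact
  interpret finite_dimensional_vector_space scale B by fact
  interpret complex_endo scale B by unfold_locales
  show ?thesis
  proof (intro algebraic_pair.intro algebraic_pair_axioms.intro complex_endo_axioms)
    show "rscale c A \<in> alg" if "A \<in> alg" for c A
      unfolding rscale_def using that by (rule alg_smul)
    show "fcalc A f \<in> alg" if A: "A \<in> alg" and f: "\<And>x y. f (x + y) = f x + f y" for A f
    proof -
      from A obtain l where l: "\<And>x y. g (A x) y + g x (A y) = l * g x y" and lin: "lin A"
        and der: "\<And>x y. A (bracket x y) = bracket (A x) y + bracket x (A y)"
        unfolding alg_iff by auto
      have "g (fcalc A f x) y + g x (fcalc A f y) = f l * g x y" for x y
        by (rule fcalc_form[OF lin f form_linear l])
      moreover have "fcalc A f (bracket x y) = bracket (fcalc A f x) y + bracket x (fcalc A f y)" for x y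
        by (rule fcalc_bilinear[OF lin f bracket_lin der])
      ultimately show ?thesis using lin_fcalc[OF lin] unfolding alg_iff by blast
    qed
  qed (simp_all add: alg_lin alg_0 alg_add alg_comm grp_id grp_comp grp_conj grp_conj_inv grp_nexp, auto simp: grp_iff)
qed

lemma pre_einstein_complex:
  fixes scale :: "complex \<Rightarrow> 'w::ab_group_add \<Rightarrow> 'w"
  assumes L: "fd_lie_algebra scale bracket" "is_metric scale g"
  defines "S \<equiv> {N \<in> conf_algebra scale g \<inter> lie_derivations scale bracket.
                  is_diagonalizable scale N \<and>
                  (\<forall>\<psi> \<in> conf_algebra scale g \<inter> lie_derivations scale bracket.
                     lin_trace scale (N \<circ> \<psi>) = lin_trace scale \<psi>)}"
  shows "S \<noteq> {} \<and>
          (\<forall>N\<in>S. \<forall>N'\<in>S. \<exists>\<phi> \<in> conf_group scale g \<inter> lie_automorphisms scale bracket.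
             N' = \<phi> \<circ> N \<circ> inv \<phi>) \<and>
          (\<forall>N\<in>S. \<forall>c. eigenvalue_of scale N c \<longrightarrow> c \<in> \<rat>)"
proof -
  interpret metric_algebra scale bracket g by (rule metric_algebraI[OF L])
  obtain B where "finite_dimensional_vector_space scale B" by (rule fd_lie_algebra_basis[OF L(1)])
  then interpret algebraic_pair scale B alg grp
    by (rule algebraic_pair_complex[OF metric_algebra_axioms])
  have eq: "(\<forall>\<psi>\<in>alg. tr (N \<circ> \<psi>) = tr \<psi>) \<longleftrightarrow> (\<forall>\<psi>\<in>alg. \<beta> N \<psi> = Re (tr \<psi>))" if N: "N \<in> alg" for N
  proof
    assume r: "\<forall>\<psi>\<in>alg. \<beta> N \<psi> = Re (tr \<psi>)"
    show "\<forall>\<psi>\<in>alg. tr (N \<circ> \<psi>) = tr \<psi>"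
    proof
      fix \<psi> assume p: "\<psi> \<in> alg"
      \<comment> \<open>Testing with i \<psi> as well recovers the imaginary part of the trace
        identity from the real form.\<close>
      let ?\<chi> = "\<lambda>x. scale \<i> (\<psi> x)"
      have "N \<circ> ?\<chi> = (\<lambda>x. scale \<i> ((N \<circ> \<psi>) x))" using alg_lin[OF N] by (auto simp: lin_scale)
      then have "tr (N \<circ> ?\<chi>) = \<i> * tr (N \<circ> \<psi>)"
        using tr_smul[OF lin_comp[OF alg_lin[OF N] alg_lin[OF p]]] by presburger
      moreover have "tr ?\<chi> = \<i> * tr \<psi>" by (rule tr_smul[OF alg_lin[OF p]])
      moreover have "\<beta> N ?\<chi> = Re (tr ?\<chi>)" using r alg_smul[OF p] by blast
      ultimately have "Im (tr (N \<circ> \<psi>)) = Im (tr \<psi>)" by (simp add: \<beta>_def)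
      moreover have "Re (tr (N \<circ> \<psi>)) = Re (tr \<psi>)" using r p by (simp add: \<beta>_def)
      ultimately show "tr (N \<circ> \<psi>) = tr \<psi>" by (simp add: complex_eq_iff)
    qed
  qed (simp add: \<beta>_def)
  have S: "S = pre_einstein"
    unfolding S_def pre_einstein_def alg_def[symmetric] using eq by blast
  show ?thesis
    unfolding S grp_def[symmetric] eigenvalue_of_def
    using pre_einstein_exists pre_einstein_conjugate pre_einstein_rational by blast
qed

section \<open>The real case\<close>

locale real_metric_algebra = metric_algebra scale bracket g + finite_dimensional_vector_space scale Basis
  for scale :: "real \<Rightarrow> 'v::ab_group_add \<Rightarrow> 'v" and bracket g Basis
begin

abbreviation "sC \<equiv> complexify scale"
abbreviation "BC \<equiv> (\<lambda>b. (b, 0::'v)) ` Basis"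

lemma sC_simps: "sC c (x, y) = (scale (Re c) x - scale (Im c) y, scale (Re c) y + scale (Im c) x)"
  by (simp add: complexify_def)

lemma sum_BC: "(\<Sum>b\<in>BC. sC (u b) b) = (\<Sum>b\<in>Basis. scale (Re (u (b, 0))) b, \<Sum>b\<in>Basis. scale (Im (u (b, 0))) b)"
  by (simp add: sum.reindex inj_on_def sC_simps sum_prod)

lemma representation_sum: "(\<Sum>b\<in>Basis. scale (representation Basis x b) b) = x"
  by (rule sum_representation_eq) (auto simp: independent_Basis span_Basis finite_Basis)

lemma finite_dimensional_complexification: "finite_dimensional_vector_space sC BC"
proof -
  interpret C: vector_space sC by (rule vector_space_complexify[OF vector_space_axioms])
  have "C.independent BC"
  proof (rule ccontr)
    assume "\<not> C.independent BC"
    then obtain u v where u: "v \<in> BC" "u v \<noteq> 0" "(\<Sum>v\<in>BC. sC (u v) v) = 0"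
      using C.dependent_finite[of BC] finite_Basis by auto
    then obtain b where b: "b \<in> Basis" "v = (b, 0)" by blast
    have "(\<Sum>b\<in>Basis. scale (Re (u (b, 0))) b) = 0" "(\<Sum>b\<in>Basis. scale (Im (u (b, 0))) b) = 0"
      using u(3) unfolding sum_BC by (simp_all add: zero_prod_def)
    then have "Re (u v) = 0" "Im (u v) = 0"
      using independentD[OF independent_Basis finite_Basis subset_refl _ b(1), of "\<lambda>b. Re (u (b, 0))"]
        independentD[OF independent_Basis finite_Basis subset_refl _ b(1), of "\<lambda>b. Im (u (b, 0))"] b(2) by auto
    then show False using u(2) by (simp add: complex_eq_iff)
  qed
  moreover have "C.span BC = UNIV"
  proof -
    have "p \<in> C.span BC" for p
    proof -
      obtain x y where p: "p = (x, y)" by fastforce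
      define u where "u q = Complex (representation Basis x (fst q)) (representation Basis y (fst q))" for q :: "'v \<times> 'v"
      have "p = (\<Sum>b\<in>BC. sC (u b) b)" unfolding sum_BC p by (simp add: u_def representation_sum)
      moreover have "\<dots> \<in> C.span BC" by (intro C.span_sum C.span_scale C.span_base)
      ultimately show ?thesis by simp
    qed
    then show ?thesis by blast
  qed
  ultimately show ?thesis using finite_Basis by unfold_locales auto
qed

sublocale C: finite_dimensional_vector_space sC BC
  by (rule finite_dimensional_complexification)

sublocale CE: complex_endo sC BC
  by unfold_locales

lemma lin_complexify: "lin f \<longleftrightarrow> CE.lin (map_prod f f)"
proof
  assume "lin f"
  then show "CE.lin (map_prod f f)"
    by (intro CE.linI) (auto simp: sC_simps lin_add lin_scale lin_diff)
next
  assume C: "CE.lin (map_prod f f)"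
  have f0: "f 0 = 0" using CE.lin_zero[OF C] by (simp add: zero_prod_def)
  show "lin f"
  proof (rule linI)
    show "f (x + y) = f x + f y" for x y
      using CE.lin_add[OF C, of "(x, 0)" "(y, 0)"] by simp
    show "f (scale c x) = scale c (f x)" for c x
      using CE.lin_scale[OF C, of "complex_of_real c" "(x, 0)"] by (simp add: sC_simps f0)
  qed
qed

text \<open>In the basis of vectors (b, 0) the complexified map has the same matrix as f.\<close>

lemma tr_complexify:
  assumes f: "lin f"
  shows "CE.tr (map_prod f f) = complex_of_real (lin_trace scale f)"
proof -
  have B: "is_basis scale Basis" by (simp add: is_basis_def independent_Basis span_Basis)
  have "C.representation BC (f b, 0) (b, 0) = complex_of_real (representation Basis (f b) b)" if b: "b \<in> Basis" for b
  proof -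
    have "(f b, 0) = (\<Sum>c\<in>Basis. sC (complex_of_real (representation Basis (f b) c)) (c, 0))"
      by (simp add: sC_simps sum_prod representation_sum)
    then have "C.representation BC (f b, 0) (b, 0) =
        (\<Sum>c\<in>Basis. complex_of_real (representation Basis (f b) c) * C.representation BC (c, 0) (b, 0))"
      by (simp add: C.representation_sum C.representation_scale C.independent_Basis C.span_Basis)
    also have "\<dots> = (\<Sum>c\<in>Basis. if c = b then complex_of_real (representation Basis (f b) b) else 0)"
      using b by (intro sum.cong refl) (auto simp: C.representation_basis C.independent_Basis)
    finally show ?thesis using b finite_Basis by simp
  qed
  then have "(\<Sum>p\<in>BC. C.representation BC (map_prod f f p) p) = (\<Sum>b\<in>Basis. complex_of_real (representation Basis (f b) b))"
    using lin_zero[OF f] by (simp add: sum.reindex inj_on_def)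
  then show ?thesis
    using lin_trace_eq[OF fd_lie_algebra_trivial[OF vspace_axioms finite_dimensional_vector_space_axioms] f B]
      CE.tr_basis[OF _ CE.is_basis_Basis, of "map_prod f f"] f lin_complexify
    by simp
qed

text \<open>The complex bilinear extension of the bracket, with (x, y) standing for x + i y.\<close>

definition bracketC :: "'v \<times> 'v \<Rightarrow> 'v \<times> 'v \<Rightarrow> 'v \<times> 'v" where
  "bracketC p q = (bracket (fst p) (fst q) - bracket (snd p) (snd q), bracket (fst p) (snd q) + bracket (snd p) (fst q))"

text \<open>Extended bilinearly rather than as a Hermitian form, so that \<open>fcalc_form\<close>
  applies.\<close>

definition gC :: "'v \<times> 'v \<Rightarrow> 'v \<times> 'v \<Rightarrow> complex" where
  "gC p q = Complex (g (fst p) (fst q) - g (snd p) (snd q)) (g (fst p) (snd q) + g (snd p) (fst q))"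

lemma bracketC_lin: "CE.lin (\<lambda>p. bracketC p q)" "CE.lin (\<lambda>q. bracketC p q)"
  by (auto intro!: CE.linI simp: bracketC_def complexify_def bracket_simps scale_right_distrib
      scale_right_diff_distrib)

lemma gC_linear: "Vector_Spaces.linear sC (*) (\<lambda>p. gC p q)" "Vector_Spaces.linear sC (*) (\<lambda>q. gC p q)"
proof -
  have v: "vector_space ((*) :: complex \<Rightarrow> complex \<Rightarrow> complex)"
    by unfold_locales (auto simp: algebra_simps)
  show "Vector_Spaces.linear sC (*) (\<lambda>p. gC p q)" "Vector_Spaces.linear sC (*) (\<lambda>q. gC p q)"
    unfolding Vector_Spaces.linear_iff
    using C.vector_space_axioms v
    by (auto simp: gC_def complexify_def form_simps form_simps' complex_eq_iff algebra_simps)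
qed

lemma neg_self_zero: "x = - x \<Longrightarrow> x = (0::'v)"
proof -
  assume "x = - x"
  then have "x + x = 0" by (metis add.right_inverse)
  then have "scale 2 x = 0" using scale_left_distrib[of 1 1 x] by simp
  then show ?thesis by simp
qed

text \<open>Complexified maps are the complex linear maps commuting with the conjugation \<sigma>.
  As \<sigma> exchanges the generalized eigenspaces for c and cnj c, conjugating the calculus by
  \<sigma> again acts as f c on the space for c, and uniqueness applies.\<close>

lemma fcalc_complexified:
  assumes a: "lin a" and f: "\<And>x y. f (x + y) = f x + f y" "\<And>x. f (cnj x) = cnj (f x)"
  shows "\<exists>b. lin b \<and> CE.fcalc (map_prod a a) f = map_prod b b"
proof -
  let ?A = "map_prod a a"
  have A: "CE.lin ?A" using a lin_complexify by blast
  let ?F = "CE.fcalc ?A f"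
  note lF = CE.lin_fcalc[OF A]
  define \<sigma> :: "'v \<times> 'v \<Rightarrow> 'v \<times> 'v" where "\<sigma> p = (fst p, - snd p)" for p
  have s: "\<sigma> (\<sigma> p) = p" "\<sigma> (p + q) = \<sigma> p + \<sigma> q" "\<sigma> (p - q) = \<sigma> p - \<sigma> q"
    "\<sigma> (sC c p) = sC (cnj c) (\<sigma> p)" "\<sigma> 0 = 0" for p q c
    by (simp_all add: \<sigma>_def complexify_def zero_prod_def)
  have sA: "?A (\<sigma> p) = \<sigma> (?A p)" for p by (cases p) (simp add: \<sigma>_def lin_neg[OF a])
  have sG: "\<sigma> p \<in> CE.gen_eigenspace ?A (cnj c)" if p: "p \<in> CE.gen_eigenspace ?A c" for p c
  proof -
    have "((\<lambda>q. ?A q - sC (cnj c) q) ^^ k) (\<sigma> p) = \<sigma> (((\<lambda>q. ?A q - sC c q) ^^ k) p)" for k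
      by (induction k) (simp_all add: sA s)
    moreover obtain k where "((\<lambda>q. ?A q - sC c q) ^^ k) p = 0"
      using p CE.gen_eigenspace_funpow[OF A] by blast
    ultimately have "((\<lambda>q. ?A q - sC (cnj c) q) ^^ k) (\<sigma> p) = 0" by (simp only: s(5))
    then show ?thesis using CE.gen_eigenspace_funpow[OF A] by blast
  qed
  have "\<sigma> \<circ> ?F \<circ> \<sigma> = ?F"
  proof (rule CE.fcalc_unique[OF A])
    show "CE.lin (\<sigma> \<circ> ?F \<circ> \<sigma>)"
      by (rule CE.linI) (simp_all add: s CE.lin_add[OF lF] CE.lin_scale[OF lF])
    show "(\<sigma> \<circ> ?F \<circ> \<sigma>) p = sC (f c) p" if "p \<in> CE.gen_eigenspace ?A c" for c p
      using CE.fcalc_eq[OF A sG[OF that], of f] by (simp add: s f(2))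
  qed
  then have "\<sigma> (?F (\<sigma> p)) = ?F p" for p by (metis comp_apply)
  then have sF: "?F (\<sigma> p) = \<sigma> (?F p)" for p by (metis s(1))
  define b where "b x = fst (?F (x, 0))" for x
  have F0: "?F (x, 0) = (b x, 0)" for x
  proof -
    have "?F (x, 0) = \<sigma> (?F (x, 0))" using sF[of "(x, 0)"] by (simp add: \<sigma>_def)
    then have "snd (?F (x, 0)) = 0" by (intro neg_self_zero) (metis \<sigma>_def snd_conv)
    then show ?thesis by (simp add: b_def prod_eq_iff)
  qed
  have "?F = map_prod b b"
  proof
    fix p :: "'v \<times> 'v"
    obtain x y where p: "p = (x, y)" by fastforce
    then have "p = (x, 0) + sC \<i> (y, 0)" by (simp add: sC_simps)
    then have "?F p = ?F (x, 0) + sC \<i> (?F (y, 0))"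
      by (simp only: CE.lin_add[OF lF] CE.lin_scale[OF lF])
    then show "?F p = map_prod b b p" by (simp add: F0 sC_simps p)
  qed
  then show ?thesis using lF lin_complexify by metis
qed

lemma alg_fcalc:
  assumes a: "a \<in> alg" and f: "\<And>x y. f (x + y) = f x + f y" "\<And>x. f (cnj x) = cnj (f x)"
  shows "\<exists>b\<in>alg. CE.fcalc (map_prod a a) f = map_prod b b"
proof -
  from a obtain l where l: "\<And>x y. g (a x) y + g x (a y) = l * g x y" and lin: "lin a"
    and der: "\<And>x y. a (bracket x y) = bracket (a x) y + bracket x (a y)"
    unfolding alg_iff by auto
  let ?A = "map_prod a a"
  have A: "CE.lin ?A" using lin lin_complexify by blast
  obtain b where b: "lin b" "CE.fcalc ?A f = map_prod b b" using fcalc_complexified[OF lin f] by blast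
  have "gC (?A p) q + gC p (?A q) = complex_of_real l * gC p q" for p q
    by (cases p; cases q) (simp add: gC_def complex_eq_iff right_diff_distrib distrib_left l[symmetric])
  then have "gC (CE.fcalc ?A f p) q + gC p (CE.fcalc ?A f q) = f (complex_of_real l) * gC p q" for p q
    by (intro CE.fcalc_form[OF A f(1) gC_linear])
  \<comment> \<open>Restriction to real vectors: comparing real parts produces a real conformal
    constant.\<close>
  from this[of "(x, 0)" "(y, 0)" for x y] have "g (b x) y + g x (b y) = Re (f (complex_of_real l)) * g x y" for x y
    unfolding b(2) by (simp add: gC_def complex_eq_iff form_simps' lin_zero[OF b(1)])
  moreover
  have "?A (bracketC p q) = bracketC (?A p) q + bracketC p (?A q)" for p q
    by (cases p; cases q) (simp add: bracketC_def der lin_diff[OF lin] lin_add[OF lin])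
  then have "CE.fcalc ?A f (bracketC p q) = bracketC (CE.fcalc ?A f p) q + bracketC p (CE.fcalc ?A f q)" for p q
    by (intro CE.fcalc_bilinear[OF A f(1) bracketC_lin])
  from this[of "(x, 0)" "(y, 0)" for x y] have "b (bracket x y) = bracket (b x) y + bracket x (b y)" for x y
    unfolding b(2) by (simp add: bracketC_def bracket_simps lin_zero[OF b(1)])
  ultimately have "b \<in> alg" using b(1) unfolding alg_iff by blast
  then show ?thesis using b(2) by blast
qed

definition algC where "algC = (\<lambda>a. map_prod a a) ` alg"
definition grpC where "grpC = (\<lambda>p. map_prod p p) ` grp"

lemma inv_map_prod: "bij p \<Longrightarrow> inv (map_prod p p) = map_prod (inv p) (inv p)"
  by (rule inv_unique_comp) (auto simp: fun_eq_iff bij_is_inj bij_is_surj surj_f_inv_f)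

lemma funpow_map_prod:
  fixes a :: "'v \<Rightarrow> 'v"
  shows "(map_prod a a ^^ k) = map_prod (a ^^ k) (a ^^ k)"
  by (induction k) (auto simp: fun_eq_iff)

lemma nexp_map_prod: "CE.nexp K (map_prod a a) = map_prod (nexp K a) (nexp K a)"
proof
  fix p :: "'v \<times> 'v"
  have "inverse (fact k) = complex_of_real (inverse (fact k))" for k by simp
  then show "CE.nexp K (map_prod a a) p = map_prod (nexp K a) (nexp K a) p"
    by (cases p) (simp add: CE.nexp_def nexp_def funpow_map_prod sC_simps sum_prod del: of_real_inverse of_real_fact)
qed

sublocale AP: algebraic_pair sC BC algC grpC
proof (intro algebraic_pair.intro algebraic_pair_axioms.intro CE.complex_endo_axioms)
  fix A assume "A \<in> algC"
  then obtain a where a: "a \<in> alg" "A = map_prod a a" unfolding algC_def by blast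
  show "CE.lin A" using a alg_lin lin_complexify by simp
  show "CE.rscale c A \<in> algC" for c
  proof -
    have "CE.rscale c A = map_prod (\<lambda>x. scale c (a x)) (\<lambda>x. scale c (a x))"
      using a by (auto simp: CE.rscale_def sC_simps fun_eq_iff)
    then show ?thesis unfolding algC_def using alg_smul[OF a(1)] by blast
  qed
  show "CE.fcalc A f \<in> algC" if "\<And>x y. f (x + y) = f x + f y" "\<And>x. f (cnj x) = cnj (f x)" for f
    using alg_fcalc[OF a(1) that] a(2) unfolding algC_def by auto
  show "CE.nexp K A \<in> grpC" if K: "\<forall>x. (A ^^ K) x = 0" for K
  proof -
    have "(a ^^ K) x = 0" for x
      using K[rule_format, of "(x, 0)"] a(2) by (simp add: funpow_map_prod zero_prod_def)
    then show ?thesis using grp_nexp[OF a(1)] a(2) nexp_map_prod unfolding grpC_def by auto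
  qed
next
  fix A B assume "A \<in> algC" "B \<in> algC"
  then obtain a b where ab: "a \<in> alg" "A = map_prod a a" "b \<in> alg" "B = map_prod b b"
    unfolding algC_def by blast
  have "A + B = map_prod (a + b) (a + b)" "comm A B = map_prod (comm a b) (comm a b)"
    using ab by (auto simp: fun_eq_iff comm_def)
  then show "A + B \<in> algC" "comm A B \<in> algC"
    unfolding algC_def using alg_add[OF ab(1,3)] alg_comm[OF ab(1,3)] by blast+
next
  have "(0 :: 'v \<times> 'v \<Rightarrow> 'v \<times> 'v) = map_prod 0 0" by (auto simp: fun_eq_iff zero_prod_def)
  then show "0 \<in> algC" unfolding algC_def using alg_0 by blast
  have "(id :: 'v \<times> 'v \<Rightarrow> 'v \<times> 'v) = map_prod id id" by (simp add: map_prod.id)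
  then show "id \<in> grpC" unfolding grpC_def using grp_id by blast
next
  fix P assume "P \<in> grpC"
  then obtain p where p: "p \<in> grp" "P = map_prod p p" unfolding grpC_def by blast
  have b: "bij p" "lin p" using p(1) by (simp_all add: grp_iff)
  show "CE.lin P" using p b lin_complexify by simp
  show "bij P" using b(1) p(2) by (simp add: bij_def prod.inj_map map_prod_surj)
  show "P \<circ> Q \<in> grpC" if "Q \<in> grpC" for Q
  proof -
    obtain q where q: "q \<in> grp" "Q = map_prod q q" using \<open>Q \<in> grpC\<close> unfolding grpC_def by blast
    then have "P \<circ> Q = map_prod (p \<circ> q) (p \<circ> q)" using p by (simp add: map_prod_compose)
    then show ?thesis unfolding grpC_def using grp_comp[OF p(1) q(1)] by blast
  qed
  fix A assume "A \<in> algC"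
  then obtain a where a: "a \<in> alg" "A = map_prod a a" unfolding algC_def by blast
  have "P \<circ> A \<circ> inv P = map_prod (p \<circ> a \<circ> inv p) (p \<circ> a \<circ> inv p)"
    "inv P \<circ> A \<circ> P = map_prod (inv p \<circ> a \<circ> p) (inv p \<circ> a \<circ> p)"
    unfolding a(2) p(2) inv_map_prod[OF b(1)] by (simp_all add: map_prod_compose)
  then show "P \<circ> A \<circ> inv P \<in> algC" "inv P \<circ> A \<circ> P \<in> algC"
    unfolding algC_def using grp_conj[OF p(1) a(1)] grp_conj_inv[OF p(1) a(1)] by blast+
qed

text \<open>Complexified maps have real traces equal to the original ones, so the real form
  expresses the whole trace condition.\<close>

lemma pre_einstein_iff:
  "map_prod N N \<in> AP.pre_einstein \<longleftrightarrow> N \<in> alg \<and> is_diagonalizable sC (map_prod N N) \<and>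
     (\<forall>\<psi>\<in>alg. lin_trace scale (N \<circ> \<psi>) = lin_trace scale \<psi>)"
proof -
  have "map_prod N N = map_prod M M \<Longrightarrow> N = M" for M by (auto simp: fun_eq_iff)
  then have "map_prod N N \<in> algC \<longleftrightarrow> N \<in> alg" unfolding algC_def by blast
  moreover have "AP.\<beta> (map_prod N N) (map_prod \<psi> \<psi>) = lin_trace scale (N \<circ> \<psi>)"
    "Re (CE.tr (map_prod \<psi> \<psi>)) = lin_trace scale \<psi>" if "N \<in> alg" "\<psi> \<in> alg" for \<psi>
    using that by (simp_all add: AP.\<beta>_def map_prod_compose[symmetric] tr_complexify alg_lin lin_comp)
  moreover have "(\<forall>B\<in>algC. AP.\<beta> M B = Re (CE.tr B)) \<longleftrightarrow>
      (\<forall>\<psi>\<in>alg. AP.\<beta> M (map_prod \<psi> \<psi>) = Re (CE.tr (map_prod \<psi> \<psi>)))" for M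
    unfolding algC_def by blast
  ultimately show ?thesis unfolding AP.pre_einstein_def by auto
qed

end

lemma pre_einstein_real:
  fixes scale :: "real \<Rightarrow> 'v::ab_group_add \<Rightarrow> 'v"
  assumes L: "fd_lie_algebra scale bracket" "is_metric scale g"
  defines "S \<equiv> {N \<in> conf_algebra scale g \<inter> lie_derivations scale bracket.
                  is_diagonalizable (complexify scale) (map_prod N N) \<and>
                  (\<forall>\<psi> \<in> conf_algebra scale g \<inter> lie_derivations scale bracket.
                     lin_trace scale (N \<circ> \<psi>) = lin_trace scale \<psi>)}"
  shows "S \<noteq> {} \<and>
          (\<forall>N\<in>S. \<forall>N'\<in>S. \<exists>\<phi> \<in> conf_group scale g \<inter> lie_automorphisms scale bracket.
             N' = \<phi> \<circ> N \<circ> inv \<phi>) \<and>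
          (\<forall>N\<in>S. \<forall>c. eigenvalue_of (complexify scale) (map_prod N N) c \<longrightarrow> c \<in> \<rat>)"
proof -
  interpret metric_algebra scale bracket g by (rule metric_algebraI[OF L])
  obtain B where B: "finite_dimensional_vector_space scale B" by (rule fd_lie_algebra_basis[OF L(1)])
  interpret real_metric_algebra scale bracket g B
    by (intro real_metric_algebra.intro metric_algebra_axioms B)
  have S: "N \<in> S \<longleftrightarrow> map_prod N N \<in> AP.pre_einstein" for N
    unfolding S_def alg_def[symmetric] pre_einstein_iff by blast
  obtain M where M: "M \<in> AP.pre_einstein" using AP.pre_einstein_exists by blast
  then obtain N where "M = map_prod N N" unfolding AP.pre_einstein_def by (auto simp: algC_def)
  then have "N \<in> S" using M S by blast
  moreover have "\<exists>\<phi>\<in>grp. N' = \<phi> \<circ> N \<circ> inv \<phi>" if NN: "N \<in> S" "N' \<in> S" for N N'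
  proof -
    obtain P where P: "P \<in> grpC" "map_prod N' N' = P \<circ> map_prod N N \<circ> inv P"
      using AP.pre_einstein_conjugate NN S by blast
    then obtain p where p: "p \<in> grp" "P = map_prod p p" unfolding grpC_def by blast
    have "bij p" using p(1) by (simp add: grp_iff)
    then have "map_prod N' N' = map_prod (p \<circ> N \<circ> inv p) (p \<circ> N \<circ> inv p)"
      using P(2) p(2) by (simp add: inv_map_prod map_prod_compose)
    then have "N' = p \<circ> N \<circ> inv p" by (auto simp: fun_eq_iff)
    then show ?thesis using p(1) by blast
  qed
  moreover have "c \<in> \<rat>" if "N \<in> S" "eigenvalue_of sC (map_prod N N) c" for N c
    using that S AP.pre_einstein_rational unfolding eigenvalue_of_def by blast
  ultimately show ?thesis unfolding grp_def[symmetric] by blast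
qed

theorem theorem4p9:
  "(\<forall>(scale :: real \<Rightarrow> 'v::ab_group_add \<Rightarrow> 'v) bracket g.
      fd_lie_algebra scale bracket \<and> is_metric scale g \<longrightarrow>
      (let S = {N \<in> conf_algebra scale g \<inter> lie_derivations scale bracket.
                  is_diagonalizable (complexify scale) (map_prod N N) \<and>
                  (\<forall>\<psi> \<in> conf_algebra scale g \<inter> lie_derivations scale bracket.
                     lin_trace scale (N \<circ> \<psi>) = lin_trace scale \<psi>)}
       in S \<noteq> {} \<and>
          (\<forall>N\<in>S. \<forall>N'\<in>S. \<exists>\<phi> \<in> conf_group scale g \<inter> lie_automorphisms scale bracket.
             N' = \<phi> \<circ> N \<circ> inv \<phi>) \<and>
          (\<forall>N\<in>S. \<forall>c. eigenvalue_of (complexify scale) (map_prod N N) c \<longrightarrow> c \<in> \<rat>)))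
   \<and>
   (\<forall>(scale :: complex \<Rightarrow> 'w::ab_group_add \<Rightarrow> 'w) bracket g.
      fd_lie_algebra scale bracket \<and> is_metric scale g \<longrightarrow>
      (let S = {N \<in> conf_algebra scale g \<inter> lie_derivations scale bracket.
                  is_diagonalizable scale N \<and>
                  (\<forall>\<psi> \<in> conf_algebra scale g \<inter> lie_derivations scale bracket.
                     lin_trace scale (N \<circ> \<psi>) = lin_trace scale \<psi>)}
       in S \<noteq> {} \<and>
          (\<forall>N\<in>S. \<forall>N'\<in>S. \<exists>\<phi> \<in> conf_group scale g \<inter> lie_automorphisms scale bracket.
             N' = \<phi> \<circ> N \<circ> inv \<phi>) \<and>
          (\<forall>N\<in>S. \<forall>c. eigenvalue_of scale N c \<longrightarrow> c \<in> \<rat>)))"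
  unfolding Let_def
  by (rule conjI; intro allI impI; elim conjE; (rule pre_einstein_real | rule pre_einstein_complex); assumption)

end
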